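(* Let $\phi(s)=\sum_{n\ge1}a(n)\lambda_n^{-s}$ be a Dirichlet series belonging to the class $\mathcal A$ with parameter $r>0$ and dual series $\psi(s)=\sum_{n\ge1}b(n)\mu_n^{-s}$ (see context). Suppose that $b(n)=\overline{a(n)}$ and $\lambda_n=\mu_n$ for all $n$, and that the abscissa of absolute convergence $\sigma_a$ of $\phi$ satisfies $\sigma_a<\min\{1,r\}+\frac12\max\{1,r\}$. Let $\Theta(z;a;\lambda)=\sum_{n=1}^\infty a(n)e^{-\lambda_nz}$ for $\mathrm{Re}(z)>0$. If $$\Theta\left(e^{i\left(\frac\pi2-\epsilon\right)};a;\lambda\right)=o\left(\epsilon^{-\frac{r+1}2}\right),\qquad\epsilon\to0^+,$$ then $\phi(s)$ has infinitely many zeros on the critical line $\mathrm{Re}(s)=\frac r2$.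
   Context: Hecke pair with parameter $r>0$: $(\lambda_n)_{n\ge1}$, $(\mu_n)_{n\ge1}$ are sequences of positive numbers strictly increasing to $\infty$; $(a(n))_{n\ge1}$, $(b(n))_{n\ge1}$ are complex sequences, not identically zero; $\phi(s)=\sum_{n\ge1}a(n)\lambda_n^{-s}$ and $\psi(s)=\sum_{n\ge1}b(n)\mu_n^{-s}$ have finite abscissas of absolute convergence $\sigma_a$, $\sigma_b$; and there is a meromorphic function $\chi$ on $\mathbb C$ such that (1) $\chi(s)=\Gamma(s)\phi(s)$ for $\mathrm{Re}(s)>\sigma_a$ and $\chi(s)=\Gamma(r-s)\psi(r-s)$ for $\mathrm{Re}(s)<r-\sigma_b$; (2) $\lim_{|\mathrm{Im}(s)|\to\infty}\chi(s)=0$ uniformly in every strip $\sigma_1\le\mathrm{Re}(s)\le\sigma_2$; (3) the singularities of $\chi$ are at most poles and are confined to some compact set. Class $\mathcal A$: $\phi$ belongs to $\mathcal A$ (with parameter $r$ and dual series $\psi$) if $(\phi,\psi)$ is a Hecke pair with parameter $r$; $\phi$ and $\psi$ have analytic continuations to $\mathbb C$, analytic except for possible simple poles at $s=r$; and the coefficients are extended to $n=0$ by $a(0):=-\phi(0)$, $b(0):=-\psi(0)$. *)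

theory Defs
  imports "HOL-Complex_Analysis.Complex_Analysis" "HOL-Library.Landau_Symbols"
begin

(* Sequences (c(n)), n >= 1, are functions on nat; the value at 0 plays no role in any series,
   so series over n >= 1 are written with Suc n. *)

definition dirichlet_series :: "(nat \<Rightarrow> complex) \<Rightarrow> (nat \<Rightarrow> real) \<Rightarrow> complex \<Rightarrow> complex" where
  "dirichlet_series c l s = (\<Sum>n. c (Suc n) * of_real (l (Suc n)) powr (- s))"

(* Absolute convergence at s depends only on Re s. The value is \<infinity> if the series converges
   absolutely nowhere and -\<infinity> if it converges absolutely everywhere. *)
definition abs_conv_abscissa :: "(nat \<Rightarrow> complex) \<Rightarrow> (nat \<Rightarrow> real) \<Rightarrow> ereal" where
  "abs_conv_abscissa c l =
     (INF s \<in> {s. summable (\<lambda>n. norm (c (Suc n) * of_real (l (Suc n)) powr (- s)))}. ereal (Re s))"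

definition frequency_seq :: "(nat \<Rightarrow> real) \<Rightarrow> bool" where
  "frequency_seq l \<longleftrightarrow>
     (\<forall>n\<ge>1. l n > 0) \<and> strict_mono_on {1..} l \<and> filterlim l at_top sequentially"

(* The two functional identities are identities of meromorphic functions. Since HOL sets Gamma to 0
   at its poles, they are only required away from the poles of the Gamma factor; this matters
   only if an abscissa is negative. Likewise, meromorphic_on puts no condition on the value of
   chi at a pole or removable singularity.
   Together with meromorphy, holomorphy of chi off a compact set says that the singularities
   are at most poles and lie in that set. *)
definition hecke_pair ::
  "real \<Rightarrow> (nat \<Rightarrow> complex) \<Rightarrow> (nat \<Rightarrow> real) \<Rightarrow> (nat \<Rightarrow> complex) \<Rightarrow> (nat \<Rightarrow> real) \<Rightarrow> bool" where
  "hecke_pair r a l b m \<longleftrightarrow>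
     r > 0 \<and> frequency_seq l \<and> frequency_seq m \<and>
     (\<exists>n\<ge>1. a n \<noteq> 0) \<and> (\<exists>n\<ge>1. b n \<noteq> 0) \<and>
     \<bar>abs_conv_abscissa a l\<bar> \<noteq> \<infinity> \<and> \<bar>abs_conv_abscissa b m\<bar> \<noteq> \<infinity> \<and>
     (\<exists>chi. chi meromorphic_on UNIV \<and>
        (\<forall>s. ereal (Re s) > abs_conv_abscissa a l \<and> s \<notin> \<int>\<^sub>\<le>\<^sub>0 \<longrightarrow>
             chi s = Gamma s * dirichlet_series a l s) \<and>
        (\<forall>s. ereal (Re s) < ereal r - abs_conv_abscissa b m \<and> of_real r - s \<notin> \<int>\<^sub>\<le>\<^sub>0 \<longrightarrow>
             chi s = Gamma (of_real r - s) * dirichlet_series b m (of_real r - s)) \<and>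
        (\<forall>\<sigma>1 \<sigma>2. uniform_limit {\<sigma>1..\<sigma>2} (\<lambda>t \<sigma>. chi (Complex \<sigma> t)) (\<lambda>_. 0) at_infinity) \<and>
        (\<exists>K. compact K \<and> chi holomorphic_on (- K)))"

(* F is the analytic continuation of the Dirichlet series to the whole plane,
   with at most a simple pole, at r. By the identity theorem F is unique away from r. *)
definition continuation_simple_pole ::
  "real \<Rightarrow> (nat \<Rightarrow> complex) \<Rightarrow> (nat \<Rightarrow> real) \<Rightarrow> (complex \<Rightarrow> complex) \<Rightarrow> bool" where
  "continuation_simple_pole r c l F \<longleftrightarrow>
     (\<forall>s. ereal (Re s) > abs_conv_abscissa c l \<longrightarrow> F s = dirichlet_series c l s) \<and>
     F holomorphic_on (- {of_real r}) \<and>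
     (F analytic_on {of_real r} \<or> is_pole F (of_real r) \<and> zorder F (of_real r) = -1)"

(* The entries a 0 and b 0, unused in the series, carry the extension of the coefficients to n = 0. *)
definition class_A ::
  "real \<Rightarrow> (nat \<Rightarrow> complex) \<Rightarrow> (nat \<Rightarrow> real) \<Rightarrow> (nat \<Rightarrow> complex) \<Rightarrow> (nat \<Rightarrow> real) \<Rightarrow>
   (complex \<Rightarrow> complex) \<Rightarrow> (complex \<Rightarrow> complex) \<Rightarrow> bool" where
  "class_A r a l b m \<phi> \<psi> \<longleftrightarrow>
     hecke_pair r a l b m \<and>
     continuation_simple_pole r a l \<phi> \<and> continuation_simple_pole r b m \<psi> \<and>
     a 0 = - \<phi> 0 \<and> b 0 = - \<psi> 0"

definition Theta :: "complex \<Rightarrow> (nat \<Rightarrow> complex) \<Rightarrow> (nat \<Rightarrow> real) \<Rightarrow> complex" where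
  "Theta z c l = (\<Sum>n. c (Suc n) * exp (- of_real (l (Suc n)) * z))"

end

theory Submission
  imports Defs "HOL-Real_Asymp.Real_Asymp"
begin

text \<open>Hardy's method. Far from the real axis \<open>X(s) = \<Gamma>(s) \<phi>(s)\<close> satisfies
  \<open>X(s) = cnj (X(r - cnj s))\<close>, so \<open>X\<close> is real on the critical line. With finitely many zeros there, \<open>X\<close> has
  constant sign for \<open>t \<ge> T\<close>; Mellin inversion of \<open>\<Theta>\<close> then turns the hypothesis on \<open>\<Theta>\<close> into the bound
  \<open>o(\<epsilon> powr (-(r+1)/2))\<close> for the integral of \<open>|X(r/2+it)| exp((pi/2-\<epsilon>)t)\<close> over \<open>t \<ge> T\<close>.
  On the other hand, moving the integral of \<open>\<phi>(s) p^k \<lambda>^p exp(2\<i>\<epsilon>p)\<close>, \<open>p = s - c - \<i>T\<close>, from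
  the critical line to the line \<open>Re s = c\<close> of absolute convergence changes it by a bounded amount,
  and there the term with frequency \<open>\<lambda>\<close> gives it the exact order \<open>\<epsilon>^(-k-1)\<close>. By Stirling's bound
  for \<open>1/\<Gamma>\<close>, this contradicts the upper bound. Phragmen-Lindelof on half-strips supplies
  Stirling's bound and the growth of \<open>X\<close>.\<close>

section \<open>Phragmen-Lindelof and contour shifts\<close>

text \<open>The exponents balance as follows. On the critical line \<open>1/\<Gamma>\<close> is at
  most of order exp(pi t/2) t^((1-r)/2), so the weight turns |\<phi>| into at most a constant times
  |X| exp((pi/2 - 2\<epsilon>)t) t^q with q = k + (1-r)/2. One half of the damping
  exp(-2\<epsilon>t) absorbs t^q at the cost \<epsilon>^(-q); the other half leaves exactly the
  integral that is o(\<epsilon>^(-(r+1)/2)). Their product is o(\<epsilon>^(-k-1)), against a lower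
  bound of that very order. The power p^k is there because (1-r)/2 is negative for r > 1; then
  t^((1-r)/2) alone would give no power of \<epsilon> to trade, whereas k > r makes q positive.
  Placing the origin of p at the corner c + \<i>T turns the integral on Re s = c into explicit
  Laplace transforms of u^k, and keeps the horizontal edge bounded in \<epsilon>. Symmetry, constant
  sign and growth are available only above some height, since the singularities and the finitely
  many zeros are merely known to be bounded; hence half-lines and bounded errors instead of exact
  shifts. The lines Re s = 1/2 + N are convenient because |\<Gamma>| is elementary there.\<close>

lemma phragmen_lindelof_half_strip:
  fixes f :: "complex \<Rightarrow> complex"
  assumes hol: "f holomorphic_on {s. Im s > T0}" and T: "T0 < T"
    and growth: "\<And>\<sigma> t. \<lbrakk>\<alpha> \<le> \<sigma>; \<sigma> \<le> \<beta>; t \<ge> T\<rbrakk> \<Longrightarrow> norm (f (Complex \<sigma> t)) \<le> A * exp (B * t)"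
    and left: "\<And>t. t \<ge> T \<Longrightarrow> norm (f (Complex \<alpha> t)) \<le> M"
    and right: "\<And>t. t \<ge> T \<Longrightarrow> norm (f (Complex \<beta> t)) \<le> M"
  obtains M' where "M' > 0" "\<And>\<sigma> t. \<lbrakk>\<alpha> \<le> \<sigma>; \<sigma> \<le> \<beta>; t \<ge> T\<rbrakk> \<Longrightarrow> norm (f (Complex \<sigma> t)) \<le> M'"
proof -
  \<comment> \<open>The second entry bounds the bottom edge. The 1 makes \<open>M'\<close> positive
    and covers the top edge, where the damped growth stays below the factor
    \<open>E\<close>.\<close>
  define M' where "M' = max (max M (A * exp (B * T))) 1"
  have M': "M' \<ge> M" "M' \<ge> A * exp (B * T)" "M' \<ge> 1" by (auto simp: M'_def)
  define R where "R = max \<bar>\<alpha>\<bar> \<bar>\<beta>\<bar>"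
  have "norm (f (Complex \<sigma>0 t0)) \<le> M'" if s0: "\<alpha> \<le> \<sigma>0" "\<sigma>0 \<le> \<beta>" "t0 \<ge> T" for \<sigma>0 t0
  proof -
    have bd: "norm (f (Complex \<sigma>0 t0)) \<le> M' * exp (\<delta> * (R\<^sup>2 + t0\<^sup>2))" if d: "\<delta> > 0" for \<delta>
    proof -
      define E where "E = exp (\<delta> * R\<^sup>2)"
      have "((\<lambda>Y. A * exp (B * Y - \<delta> * Y\<^sup>2)) \<longlongrightarrow> 0) at_top" using d by real_asymp
      hence "eventually (\<lambda>Y. A * exp (B * Y - \<delta> * Y\<^sup>2) < 1) at_top"
        by (rule order_tendstoD) auto
      hence "eventually (\<lambda>Y. A * exp (B * Y - \<delta> * Y\<^sup>2) < 1 \<and> Y \<ge> t0) at_top"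
        using eventually_ge_at_top eventually_conj by blast
      then obtain Y where Y: "A * exp (B * Y - \<delta> * Y\<^sup>2) < 1" "Y \<ge> t0"
        by (auto simp: eventually_at_top_linorder)
      \<comment> \<open>The factor exp(\<delta> s^2) has modulus exp(\<delta>(\<sigma>^2 - t^2)); in
        a strip this beats every growth exp(B t), so the maximum principle applies on a rectangle
        that is tall enough.\<close>
      define g where "g s = f s * exp (of_real \<delta> * s\<^sup>2)" for s
      have ng: "norm (g (Complex \<sigma> t)) = norm (f (Complex \<sigma> t)) * exp (\<delta> * (\<sigma>\<^sup>2 - t\<^sup>2))" for \<sigma> t
        by (simp add: g_def norm_mult power2_eq_square)
      have sq: "\<delta> * (\<sigma>\<^sup>2 - t\<^sup>2) \<le> \<delta> * R\<^sup>2 - \<delta> * t\<^sup>2" if "\<alpha> \<le> \<sigma>" "\<sigma> \<le> \<beta>" for \<sigma> t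
      proof -
        have "\<bar>\<sigma>\<bar> \<le> \<bar>R\<bar>" using that by (auto simp: R_def)
        hence "\<sigma>\<^sup>2 \<le> R\<^sup>2" by (simp add: abs_le_square_iff)
        thus ?thesis using d by (simp add: right_diff_distrib)
      qed
      define S where "S = cbox (Complex \<alpha> T) (Complex \<beta> Y)"
      have sub: "S \<subseteq> {s. Im s > T0}" using T by (auto simp: S_def in_cbox_complex_iff)
      have gh: "g holomorphic_on {s. Im s > T0}" unfolding g_def
        by (intro holomorphic_intros hol)
      have "norm (g (Complex \<sigma>0 t0)) \<le> M' * E"
      proof (rule maximum_modulus_frontier[of g S])
        show "g holomorphic_on interior S" using gh sub interior_subset
          by (meson holomorphic_on_subset)
        show "continuous_on (closure S) g"
          using gh sub by (auto simp: S_def intro: holomorphic_on_imp_continuous_on holomorphic_on_subset)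
        show "bounded S" by (simp add: S_def)
        show "Complex \<sigma>0 t0 \<in> S" using s0 Y by (auto simp: S_def in_cbox_complex_iff)
        fix z assume "z \<in> frontier S"
        hence z: "z \<in> S" "z \<notin> box (Complex \<alpha> T) (Complex \<beta> Y)"
          by (auto simp: S_def frontier_cbox)
        obtain \<sigma> t where zz: "z = Complex \<sigma> t" by (cases z)
        have b: "\<alpha> \<le> \<sigma>" "\<sigma> \<le> \<beta>" "T \<le> t" "t \<le> Y" 
          using z(1) by (auto simp: S_def in_cbox_complex_iff zz)
        have or: "\<sigma> = \<alpha> \<or> \<sigma> = \<beta> \<or> t = T \<or> t = Y" 
          using z(2) b by (auto simp: in_box_complex_iff zz)
        have e: "exp (\<delta> * (\<sigma>\<^sup>2 - t\<^sup>2)) \<le> E"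
          unfolding E_def using sq[OF b(1,2), of t] d by (smt (verit) exp_le_cancel_iff mult_nonneg_nonneg zero_le_power2)
        show "norm (g z) \<le> M' * E"
        proof (cases "t = Y")
          case False
          hence "norm (f z) \<le> M'" using or left[of t] right[of t] growth[of \<sigma> t] b M' zz
            by (metis order_trans)
          thus ?thesis unfolding zz ng using e M' by (intro mult_mono) auto
        next
          case True
          have "norm (g z) \<le> (A * exp (B * Y)) * exp (\<delta> * R\<^sup>2 - \<delta> * Y\<^sup>2)"
            unfolding zz ng True using growth[of \<sigma> Y] b sq[OF b(1,2), of Y] True
            by (intro mult_mono) (auto intro: order_trans[OF norm_ge_zero])
          also have "\<dots> = (A * exp (B * Y - \<delta> * Y\<^sup>2)) * E"
            by (simp add: E_def exp_diff exp_add field_simps)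
          also have "\<dots> \<le> M' * E" using Y M' by (intro mult_right_mono) (auto simp: E_def)
          finally show ?thesis .
        qed
      qed
      hence "norm (f (Complex \<sigma>0 t0)) * exp (\<delta> * (\<sigma>0\<^sup>2 - t0\<^sup>2)) * exp (\<delta> * (t0\<^sup>2 - \<sigma>0\<^sup>2))
          \<le> M' * E * exp (\<delta> * (t0\<^sup>2 - \<sigma>0\<^sup>2))" unfolding ng by (intro mult_right_mono) auto
      moreover have "exp (\<delta> * (\<sigma>0\<^sup>2 - t0\<^sup>2)) * exp (\<delta> * (t0\<^sup>2 - \<sigma>0\<^sup>2)) = 1"
        by (simp add: mult_exp_exp algebra_simps)
      ultimately have "norm (f (Complex \<sigma>0 t0)) \<le> M' * (E * exp (\<delta> * (t0\<^sup>2 - \<sigma>0\<^sup>2)))"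
        by (simp add: mult.assoc)
      also have "E * exp (\<delta> * (t0\<^sup>2 - \<sigma>0\<^sup>2)) = exp (\<delta> * (R\<^sup>2 + t0\<^sup>2 - \<sigma>0\<^sup>2))"
        by (simp add: E_def mult_exp_exp algebra_simps)
      also have "M' * \<dots> \<le> M' * exp (\<delta> * (R\<^sup>2 + t0\<^sup>2))"
        using d M' by (intro mult_left_mono) (auto simp: mult_left_mono intro: order_trans[of _ 0])
      finally show ?thesis .
    qed
    \<comment> \<open>The point is fixed and \<open>M'\<close> is independent of \<delta>, so
      \<delta> may tend to 0.\<close>
    have "((\<lambda>\<delta>. M' * exp (\<delta> * (R\<^sup>2 + t0\<^sup>2))) \<longlongrightarrow> M' * exp (0 * (R\<^sup>2 + t0\<^sup>2))) (at_right 0)"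
      by (intro tendsto_intros)
    moreover have "eventually (\<lambda>\<delta>. norm (f (Complex \<sigma>0 t0)) \<le> M' * exp (\<delta> * (R\<^sup>2 + t0\<^sup>2))) (at_right 0)"
      using bd by (auto simp: eventually_at_right_less intro: eventually_mono[OF eventually_at_right_less])
    ultimately show ?thesis using tendsto_lowerbound[of _ "M'" "at_right 0"] by force
  qed
  thus ?thesis using that[of M'] M' by auto
qed

section \<open>Moving vertical lines of integration\<close>

lemma integrable_exp_abs:
  fixes \<delta> :: real assumes "\<delta> > 0"
  shows "integrable lborel (\<lambda>t::real. exp (- \<delta> * \<bar>t\<bar>))"
proof -
  have 1: "set_integrable lborel {0..} (\<lambda>t. exp (- \<delta> * t))"
  proof -
    have "(\<lambda>t. exp (- \<delta> * t)) absolutely_integrable_on {0..}"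
      using integrable_on_exp_minus_to_infinity[OF assms, of 0]
      by (intro nonnegative_absolutely_integrable_1) auto
    thus ?thesis unfolding set_integrable_def by (subst (asm) integrable_completion) auto
  qed
  have "integrable lborel (\<lambda>t. indicator {0..} (-t) *\<^sub>R exp (- \<delta> * (-t)))"
    using lborel_integrable_real_affine[OF 1[unfolded set_integrable_def], of "-1" 0] by simp
  from Bochner_Integration.integrable_add[OF this 1[unfolded set_integrable_def]]
  show ?thesis
    by (rule Bochner_Integration.integrable_bound) (auto intro!: AE_I2 simp: indicator_def)
qed

lemma set_integrable_exp_bound:
  fixes f :: "real \<Rightarrow> complex"
  assumes cont: "continuous_on {T..} f" and "\<delta> > 0"
    and bd: "\<And>t. t \<ge> T \<Longrightarrow> norm (f t) \<le> A * exp (- \<delta> * \<bar>t\<bar>)"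
  shows "set_integrable lborel {T..} f"
proof -
  have "set_borel_measurable lborel {T..} f"
    using borel_measurable_continuous_on_indicator[OF _ cont] by (simp add: set_borel_measurable_def)
  moreover have "integrable lborel (\<lambda>t. A * exp (- \<delta> * \<bar>t\<bar>))"
    using integrable_exp_abs[OF assms(2)] by simp
  ultimately show ?thesis unfolding set_integrable_def set_borel_measurable_def
  proof (rule_tac Bochner_Integration.integrable_bound)
    show "AE t in lborel. norm (indicator {T..} t *\<^sub>R f t) \<le> norm (A * exp (- \<delta> * \<bar>t\<bar>))"
    proof (rule AE_I2)
      fix t :: real
      show "norm (indicator {T..} t *\<^sub>R f t) \<le> norm (A * exp (- \<delta> * \<bar>t\<bar>))"
        using bd[of t] abs_ge_self[of "A * exp (- \<delta> * \<bar>t\<bar>)"]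
        by (cases "t \<ge> T") (simp_all add: indicator_def del: abs_mult abs_exp_cancel)
    qed
  qed auto
qed

text \<open>A primitive \<open>P\<close> on the convex set \<open>S\<close> takes the place of
  Cauchy's theorem. Both vertical integrals are increments of \<open>P\<close>, so they differ by
  two horizontal increments, which the mean value inequality bounds by length times
  supremum.\<close>

lemma contour_shift_rectangle:
  fixes F :: "complex \<Rightarrow> complex"
  assumes S: "convex S" "open S" "F holomorphic_on S"
    and ab: "\<alpha> \<le> \<beta>" and TY: "T \<le> Y"
    and sub: "\<And>\<sigma> t. \<lbrakk>\<alpha> \<le> \<sigma>; \<sigma> \<le> \<beta>; T \<le> t; t \<le> Y\<rbrakk> \<Longrightarrow> Complex \<sigma> t \<in> S"
    and bot: "\<And>\<sigma>. \<lbrakk>\<alpha> \<le> \<sigma>; \<sigma> \<le> \<beta>\<rbrakk> \<Longrightarrow> norm (F (Complex \<sigma> T)) \<le> B1"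
    and top: "\<And>\<sigma>. \<lbrakk>\<alpha> \<le> \<sigma>; \<sigma> \<le> \<beta>\<rbrakk> \<Longrightarrow> norm (F (Complex \<sigma> Y)) \<le> B2"
  shows "norm ((LBINT t:{T..Y}. F (Complex \<alpha> t)) - (LBINT t:{T..Y}. F (Complex \<beta> t)))
           \<le> (\<beta> - \<alpha>) * (B1 + B2)"
proof -
  have "\<exists>P. \<forall>z\<in>S. (P has_field_derivative F z) (at z within S)"
  proof (rule holomorphic_convex_primitive'[OF S])
    fix P assume "\<And>z. z \<in> S \<Longrightarrow> (P has_field_derivative F z) (at z within S)"
    thus ?thesis by (intro exI[of _ P]) auto
  qed
  then obtain P where P: "\<forall>z\<in>S. (P has_field_derivative F z) (at z within S)"
    by (rule exE)
  have P': "(P has_field_derivative F z) (at z)" if "z \<in> S" for z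
    using bspec[OF P that] unfolding at_within_open[OF that S(2)] .
  have vert: "(LBINT t:{T..Y}. F (Complex \<sigma> t)) = (P (Complex \<sigma> Y) - P (Complex \<sigma> T)) / \<i>"
    if s: "\<alpha> \<le> \<sigma>" "\<sigma> \<le> \<beta>" for \<sigma>
  proof -
    have "(\<integral>t. indicator {T..Y} t *\<^sub>R F (Complex \<sigma> t) \<partial>lborel) = P (Complex \<sigma> Y) / \<i> - P (Complex \<sigma> T) / \<i>"
    proof (rule integral_FTC_Icc[OF TY])
      fix t assume t: "T \<le> t" "t \<le> Y"
      have c: "((\<lambda>t. Complex \<sigma> t) has_vector_derivative \<i>) (at t within {T..Y})"
      proof -
        have "((\<lambda>t. of_real \<sigma> + \<i> * of_real t) has_vector_derivative \<i>) (at t within {T..Y})"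
          by (auto intro!: derivative_eq_intros)
        thus ?thesis by (simp add: Complex_eq)
      qed
      have "((P \<circ> Complex \<sigma>) has_vector_derivative (\<i> * F (Complex \<sigma> t))) (at t within {T..Y})"
        using field_vector_diff_chain_within[OF c, of P] P'[OF sub[OF s t]]
        by (metis has_field_derivative_at_within)
      from has_vector_derivative_mult_right[OF this, of "inverse \<i>"]
      show "((\<lambda>t. P (Complex \<sigma> t) / \<i>) has_vector_derivative F (Complex \<sigma> t)) (at t within {T..Y})"
        by (simp add: field_simps o_def)
    next
      have "continuous_on {T..Y} (F \<circ> Complex \<sigma>)"
      proof (rule continuous_on_compose)
        show "continuous_on {T..Y} (Complex \<sigma>)"
          unfolding Complex_eq[abs_def] by (intro continuous_intros)
        show "continuous_on (Complex \<sigma> ` {T..Y}) F"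
          using holomorphic_on_imp_continuous_on[OF S(3)] sub s
          by (auto elim!: continuous_on_subset)
      qed
      thus "continuous_on {T..Y} (\<lambda>t. F (Complex \<sigma> t))" by (simp add: o_def)
    qed
    thus ?thesis by (simp add: set_lebesgue_integral_def algebra_simps)
  qed
  have hor: "norm (P (Complex \<beta> t) - P (Complex \<alpha> t)) \<le> B * (\<beta> - \<alpha>)" 
    if t: "T \<le> t" "t \<le> Y" and b: "\<And>\<sigma>. \<lbrakk>\<alpha> \<le> \<sigma>; \<sigma> \<le> \<beta>\<rbrakk> \<Longrightarrow> norm (F (Complex \<sigma> t)) \<le> B" for t B
  proof -
    define L where "L = closed_segment (Complex \<alpha> t) (Complex \<beta> t)"
    have L: "\<exists>\<sigma>. z = Complex \<sigma> t \<and> \<alpha> \<le> \<sigma> \<and> \<sigma> \<le> \<beta>" if "z \<in> L" for z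
    proof -
      have "\<exists>u. z = (1 - u) *\<^sub>R Complex \<alpha> t + u *\<^sub>R Complex \<beta> t \<and> 0 \<le> u \<and> u \<le> 1"
        using that unfolding L_def closed_segment_def by (rule CollectD)
      then obtain u where u: "z = (1 - u) *\<^sub>R Complex \<alpha> t + u *\<^sub>R Complex \<beta> t" "0 \<le> u" "u \<le> 1"
        by (elim exE conjE)
      have "z = Complex (\<alpha> + u * (\<beta> - \<alpha>)) t"
        using u(1) by (simp add: complex_eq_iff algebra_simps)
      moreover have "0 \<le> u * (\<beta> - \<alpha>)" using u ab by simp
      moreover have "u * (\<beta> - \<alpha>) \<le> \<beta> - \<alpha>" using u ab by (simp add: mult_left_le_one_le)
      ultimately show ?thesis by (intro exI[of _ "\<alpha> + u * (\<beta> - \<alpha>)"]) linarith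
    qed
    have "norm (P (Complex \<beta> t) - P (Complex \<alpha> t)) \<le> B * norm (Complex \<beta> t - Complex \<alpha> t)"
    proof (rule field_differentiable_bound[of L P F])
      show "convex L" by (simp add: L_def)
      fix z assume "z \<in> L"
      then obtain \<sigma> where s: "z = Complex \<sigma> t" "\<alpha> \<le> \<sigma>" "\<sigma> \<le> \<beta>" using L by blast
      show "(P has_field_derivative F z) (at z within L)"
        using P'[OF sub[OF s(2,3) t]] s(1) by (auto intro: has_field_derivative_at_within)
      show "norm (F z) \<le> B" using b s by auto
    qed (auto simp: L_def)
    also have "norm (Complex \<beta> t - Complex \<alpha> t) = \<beta> - \<alpha>" using ab by (simp add: cmod_def)
    finally show ?thesis .
  qed
  have "(LBINT t:{T..Y}. F (Complex \<alpha> t)) - (LBINT t:{T..Y}. F (Complex \<beta> t)) =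
        ((P (Complex \<beta> T) - P (Complex \<alpha> T)) - (P (Complex \<beta> Y) - P (Complex \<alpha> Y))) / \<i>"
    using ab by (simp add: vert field_simps)
  also have "norm \<dots> \<le> norm (P (Complex \<beta> T) - P (Complex \<alpha> T)) + norm (P (Complex \<beta> Y) - P (Complex \<alpha> Y))"
    unfolding norm_divide norm_ii div_by_1 by (rule norm_triangle_ineq4)
  also have "\<dots> \<le> B1 * (\<beta> - \<alpha>) + B2 * (\<beta> - \<alpha>)"
    using hor[of T, OF _ _ bot] hor[of Y, OF _ _ top] TY by (intro add_mono) auto
  finally show ?thesis by (simp add: algebra_simps)
qed

text \<open>The top edge dies with \<open>g\<close>, the bottom edge stays and gives the error. For
  an integrand depending on a parameter, a bound \<open>B\<close> free of the parameter makes the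
  shift harmless.\<close>

lemma contour_shift_half_line:
  fixes F :: "complex \<Rightarrow> complex"
  assumes hol: "F holomorphic_on {s. Im s > T0}" and T: "T0 < T" and ab: "\<alpha> \<le> \<beta>"
    and inta: "set_integrable lborel {T..} (\<lambda>t. F (Complex \<alpha> t))"
    and intb: "set_integrable lborel {T..} (\<lambda>t. F (Complex \<beta> t))"
    and bot: "\<And>\<sigma>. \<lbrakk>\<alpha> \<le> \<sigma>; \<sigma> \<le> \<beta>\<rbrakk> \<Longrightarrow> norm (F (Complex \<sigma> T)) \<le> B"
    and bd: "\<And>\<sigma> t. \<lbrakk>\<alpha> \<le> \<sigma>; \<sigma> \<le> \<beta>; T \<le> t\<rbrakk> \<Longrightarrow> norm (F (Complex \<sigma> t)) \<le> g t"
    and g: "(g \<longlongrightarrow> 0) at_top"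
  shows "norm ((LBINT t:{T..}. F (Complex \<alpha> t)) - (LBINT t:{T..}. F (Complex \<beta> t))) \<le> (\<beta> - \<alpha>) * B"
proof -
  have conv: "convex {s. Im s > T0}" "open {s. Im s > T0}"
    by (auto simp: convex_halfspace_Im_gt open_halfspace_Im_gt)
  have "((\<lambda>Y. norm ((LBINT t:{T..Y}. F (Complex \<alpha> t)) - (LBINT t:{T..Y}. F (Complex \<beta> t)))) \<longlongrightarrow>
    norm ((LBINT t:{T..}. F (Complex \<alpha> t)) - (LBINT t:{T..}. F (Complex \<beta> t)))) at_top"
    by (intro tendsto_intros tendsto_set_lebesgue_integral_at_top inta intb) auto
  moreover have "((\<lambda>Y. (\<beta> - \<alpha>) * (B + g Y)) \<longlongrightarrow> (\<beta> - \<alpha>) * (B + 0)) at_top"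
    by (intro tendsto_intros g)
  moreover have "eventually (\<lambda>Y. norm ((LBINT t:{T..Y}. F (Complex \<alpha> t)) - (LBINT t:{T..Y}. F (Complex \<beta> t))) \<le> (\<beta> - \<alpha>) * (B + g Y)) at_top"
    using eventually_ge_at_top[of T]
  proof eventually_elim
    case (elim Y)
    show ?case
      by (rule contour_shift_rectangle[OF conv hol ab elim]) (use T bot bd elim in auto)
  qed
  ultimately show ?thesis using tendsto_le[OF trivial_limit_at_top_linorder] by fastforce
qed

lemma integral_UNIV_limit:
  fixes f :: "real \<Rightarrow> complex"
  assumes "integrable lborel f"
  shows "(\<lambda>n. LBINT t:{- real n..real n}. f t) \<longlonglongrightarrow> integral\<^sup>L lborel f"
  unfolding set_lebesgue_integral_def
proof (rule integral_dominated_convergence[where w="\<lambda>t. norm (f t)"])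
  show "AE x in lborel. (\<lambda>n. indicator {- real n..real n} x *\<^sub>R f x) \<longlonglongrightarrow> f x"
  proof (rule AE_I2)
    fix x :: real
    obtain N where N: "real N \<ge> \<bar>x\<bar>" using real_arch_simple[of "\<bar>x\<bar>"] by blast
    have "eventually (\<lambda>n. indicator {- real n..real n} x *\<^sub>R f x = f x) sequentially"
      using eventually_ge_at_top[of N] by eventually_elim (use N in \<open>auto simp: indicator_def\<close>)
    thus "(\<lambda>n. indicator {- real n..real n} x *\<^sub>R f x) \<longlonglongrightarrow> f x" by (rule tendsto_eventually)
  qed
qed (use assms in \<open>auto intro!: AE_I2 simp: indicator_def\<close>)

text \<open>Both horizontal edges recede to infinity and vanish with \<open>g\<close>, so here the
  shift is exact.\<close>

lemma contour_shift_full_line: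
  fixes F :: "complex \<Rightarrow> complex"
  assumes hol: "F holomorphic_on {s. Re s > \<alpha>0}" and T: "\<alpha>0 < \<alpha>" and ab: "\<alpha> \<le> \<beta>"
    and inta: "integrable lborel (\<lambda>t. F (Complex \<alpha> t))"
    and intb: "integrable lborel (\<lambda>t. F (Complex \<beta> t))"
    and bd: "\<And>\<sigma> t. \<lbrakk>\<alpha> \<le> \<sigma>; \<sigma> \<le> \<beta>; \<bar>t\<bar> \<ge> 1\<rbrakk> \<Longrightarrow> norm (F (Complex \<sigma> t)) \<le> g \<bar>t\<bar>"
    and g: "(g \<longlongrightarrow> 0) at_top"
  shows "(\<integral>t. F (Complex \<alpha> t) \<partial>lborel) = (\<integral>t. F (Complex \<beta> t) \<partial>lborel)"
proof -
  have conv: "convex {s. Re s > \<alpha>0}" "open {s. Re s > \<alpha>0}"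
    by (auto simp: convex_halfspace_Re_gt open_halfspace_Re_gt)
  let ?D = "\<lambda>n. norm ((LBINT t:{-real n..real n}. F (Complex \<alpha> t)) - (LBINT t:{-real n..real n}. F (Complex \<beta> t)))"
  have "?D \<longlonglongrightarrow> norm ((\<integral>t. F (Complex \<alpha> t) \<partial>lborel) - (\<integral>t. F (Complex \<beta> t) \<partial>lborel))"
    by (intro tendsto_intros integral_UNIV_limit inta intb)
  moreover have "(\<lambda>n. (\<beta> - \<alpha>) * (g (real n) + g (real n))) \<longlonglongrightarrow> (\<beta> - \<alpha>) * (0 + 0)"
    by (intro tendsto_intros filterlim_compose[OF g] filterlim_real_sequentially)
  moreover have "eventually (\<lambda>n. ?D n \<le> (\<beta> - \<alpha>) * (g (real n) + g (real n))) sequentially"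
    using eventually_ge_at_top[of 1]
  proof eventually_elim
    case (elim n)
    show ?case
      by (rule contour_shift_rectangle[OF conv hol ab]) 
         (use T bd[of _ "real n"] bd[of _ "- real n"] elim in auto)
  qed
  ultimately have "norm ((\<integral>t. F (Complex \<alpha> t) \<partial>lborel) - (\<integral>t. F (Complex \<beta> t) \<partial>lborel)) \<le> (\<beta> - \<alpha>) * (0 + 0)"
    using tendsto_le[OF trivial_limit_sequentially] by blast
  thus ?thesis by simp
qed

section \<open>Bounds for the Gamma function on vertical strips\<close>

text \<open>On this line \<open>1 - z = cnj z\<close>, so the reflection formula becomes a formula
  for the squared modulus, and the sine becomes a hyperbolic cosine. This is the source of the rate
  \<open>pi / 2\<close> in the estimates of \<Gamma>.\<close>

lemma norm_Gamma_half_line_sq: "(norm (Gamma (Complex (1/2) t)))\<^sup>2 = pi / cosh (pi * t)"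
proof -
  define z where "z = Complex (1/2) t"
  have c: "1 - z = cnj z" by (simp add: z_def complex_eq_iff)
  have "of_real ((norm (Gamma z))\<^sup>2) = Gamma z * cnj (Gamma z)" by (rule complex_norm_square)
  also have "\<dots> = of_real pi / sin (of_real pi * z)"
    by (simp add: cnj_Gamma c[symmetric] Gamma_reflection_complex)
  also have "of_real pi * z = of_real pi / 2 + \<i> * (of_real (pi * t))"
    by (simp add: z_def complex_eq_iff)
  also have "sin (of_real pi / 2 + \<i> * (of_real (pi * t))) = cos (\<i> * of_real (pi * t) :: complex)"
    by (simp add: sin_add)
  also have "\<dots> = of_real (cosh (pi * t))" 
    by (simp add: cosh_conv_cos[symmetric] cosh_field_def flip: exp_of_real)
  finally have "complex_of_real ((norm (Gamma z))\<^sup>2) = complex_of_real (pi / cosh (pi * t))" by simp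
  thus ?thesis by (simp only: of_real_eq_iff z_def)
qed

lemma norm_Gamma_half_line_le: "norm (Gamma (Complex (1/2) t)) \<le> sqrt (2 * pi) * exp (- (pi * \<bar>t\<bar> / 2))"
proof (rule power2_le_imp_le)
  have "exp (pi * \<bar>t\<bar>) / 2 \<le> cosh (pi * t)"
    by (cases "t \<ge> 0") (auto simp: cosh_def)
  hence "pi / cosh (pi * t) \<le> pi / (exp (pi * \<bar>t\<bar>) / 2)" by (intro divide_left_mono) auto
  also have "\<dots> = (sqrt (2 * pi) * exp (- (pi * \<bar>t\<bar> / 2)))\<^sup>2"
    by (simp add: power_mult_distrib exp_minus field_simps flip: exp_double)
  finally show "(norm (Gamma (Complex (1/2) t)))\<^sup>2 \<le> (sqrt (2 * pi) * exp (- (pi * \<bar>t\<bar> / 2)))\<^sup>2"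
    by (simp add: norm_Gamma_half_line_sq)
qed auto

lemma norm_Gamma_half_line_ge: "exp (- (pi * \<bar>t\<bar> / 2)) \<le> norm (Gamma (Complex (1/2) t))"
proof (rule power2_le_imp_le)
  have "cosh (pi * t) \<le> exp (pi * \<bar>t\<bar>)"
    by (cases "t \<ge> 0") (auto simp: cosh_def mult_nonneg_nonpos intro!: order_trans[of "exp (- (pi * t))"] )
  hence "1 / exp (pi * \<bar>t\<bar>) \<le> pi / cosh (pi * t)" using pi_ge_two by (intro frac_le) auto
  moreover have "1 / exp (pi * \<bar>t\<bar>) = (exp (- (pi * \<bar>t\<bar> / 2)))\<^sup>2"
    by (simp add: exp_minus field_simps flip: exp_double)
  ultimately show "(exp (- (pi * \<bar>t\<bar> / 2)))\<^sup>2 \<le> (norm (Gamma (Complex (1/2) t)))\<^sup>2"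
    by (simp add: norm_Gamma_half_line_sq)
qed auto

lemma notin_nonpos_Ints_Re: "Re s > 0 \<Longrightarrow> s \<notin> \<int>\<^sub>\<le>\<^sub>0"
  by (auto elim!: nonpos_Ints_cases)

lemma notin_nonpos_Ints_Im: "Im s \<noteq> 0 \<Longrightarrow> s \<notin> \<int>\<^sub>\<le>\<^sub>0"
  by (auto elim!: nonpos_Ints_cases)

lemma norm_Gamma_half_int_le:
  "norm (Gamma (Complex (1/2 + real N) t)) \<le> sqrt (2 * pi) * (real N + 1 + \<bar>t\<bar>) ^ N * exp (- (pi * \<bar>t\<bar> / 2))"
proof (induction N)
  case 0 thus ?case using norm_Gamma_half_line_le[of t] by simp
next
  case (Suc N)
  define z where "z = Complex (1/2 + real N) t"
  have "norm z \<le> \<bar>1/2 + real N\<bar> + \<bar>t\<bar>" using cmod_le[of z] by (simp add: z_def)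
  hence nz: "norm z \<le> real (Suc N) + 1 + \<bar>t\<bar>" by simp
  have "Complex (1/2 + real (Suc N)) t = z + 1" by (simp add: z_def complex_eq_iff)
  hence "Gamma (Complex (1/2 + real (Suc N)) t) = z * Gamma z"
    using Gamma_plus1[of z] notin_nonpos_Ints_Re[of z] by (simp add: z_def)
  hence "norm (Gamma (Complex (1/2 + real (Suc N)) t)) = norm z * norm (Gamma z)" by (simp add: norm_mult)
  also have "\<dots> \<le> (real (Suc N) + 1 + \<bar>t\<bar>) * (sqrt (2 * pi) * (real (Suc N) + 1 + \<bar>t\<bar>) ^ N * exp (- (pi * \<bar>t\<bar> / 2)))"
  proof (intro mult_mono nz)
    have "norm (Gamma z) \<le> sqrt (2 * pi) * (real N + 1 + \<bar>t\<bar>) ^ N * exp (- (pi * \<bar>t\<bar> / 2))"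
      using Suc by (simp add: z_def)
    also have "\<dots> \<le> sqrt (2 * pi) * (real (Suc N) + 1 + \<bar>t\<bar>) ^ N * exp (- (pi * \<bar>t\<bar> / 2))"
      by (intro mult_right_mono mult_left_mono power_mono) auto
    finally show "norm (Gamma z) \<le> \<dots>" .
  qed auto
  finally show ?case by (simp add: mult_ac)
qed

text \<open>Each unit step to the right divides by some \<open>z\<close> with
  \<open>norm z \<ge> t\<close>, so it gains a factor \<open>1 / t\<close>. At half-integers this
  already is the order predicted by Stirling's formula.\<close>

lemma norm_rGamma_half_int_le:
  assumes "t \<ge> 1"
  shows "norm (rGamma (Complex (1/2 + real N) t)) \<le> exp (pi * t / 2) / t ^ N"
proof (induction N)
  case 0
  have "1 / norm (Gamma (Complex (1/2) t)) \<le> 1 / exp (- (pi * \<bar>t\<bar> / 2))"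
    by (intro divide_left_mono norm_Gamma_half_line_ge mult_pos_pos) 
       (auto simp: Gamma_eq_zero_iff notin_nonpos_Ints_Re)
  thus ?case using assms by (simp add: rGamma_inverse_Gamma norm_inverse norm_divide exp_minus field_simps)
next
  case (Suc N)
  define z where "z = Complex (1/2 + real N) t"
  have nz: "norm z \<ge> t" using abs_Im_le_cmod[of z] assms by (simp add: z_def)
  hence "z \<noteq> 0" using assms by auto
  have "Complex (1/2 + real (Suc N)) t = z + 1" by (simp add: z_def complex_eq_iff)
  hence "rGamma (Complex (1/2 + real (Suc N)) t) = rGamma z / z"
    using rGamma_plus1[of z] \<open>z \<noteq> 0\<close> by (simp add: field_simps)
  hence "norm (rGamma (Complex (1/2 + real (Suc N)) t)) = norm (rGamma z) / norm z" by (simp add: norm_divide)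
  also have "\<dots> \<le> (exp (pi * t / 2) / t ^ N) / t"
    using Suc nz assms by (intro frac_le) (auto simp: z_def)
  finally show ?case by (simp add: field_simps)
qed

lemma norm_Gamma_le_Gamma_Re:
  assumes "Re s > 0" shows "norm (Gamma s) \<le> Gamma (Re s)"
proof -
  have "norm (integral {0..} (\<lambda>t. of_real t powr (s - 1) / of_real (exp t)))
     \<le> integral {0..} (\<lambda>t. t powr (Re s - 1) / exp t)"
  proof (rule integral_norm_bound_integral)
    show "(\<lambda>t. of_real t powr (s - 1) / of_real (exp t)) integrable_on {0..}"
      using Gamma_integral_complex[OF assms] by (rule has_integral_integrable)
    show "(\<lambda>t. t powr (Re s - 1) / exp t) integrable_on {0..}"
      using Gamma_integral_real[OF assms] by (rule has_integral_integrable)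
    show "norm (complex_of_real t powr (s - 1) / of_real (exp t)) \<le> t powr (Re s - 1) / exp t" 
      if "t \<in> {0..}" for t
      using that by (simp add: norm_divide norm_powr_real_powr)
  qed
  thus ?thesis using Gamma_integral_complex[OF assms] Gamma_integral_real[OF assms]
    by (simp add: integral_unique)
qed

lemma Gamma_strip_bounded:
  assumes "0 < (a::real)"
  obtains K where "K > 0" "\<And>s. \<lbrakk>a \<le> Re s; Re s \<le> b\<rbrakk> \<Longrightarrow> norm (Gamma s) \<le> K"
proof -
  have "continuous_on {a..b} (Gamma :: real \<Rightarrow> real)"
    by (intro continuous_on_Gamma) (use assms in \<open>auto elim!: nonpos_Ints_cases\<close>)
  hence "bounded (Gamma ` {a..b})" by (intro compact_imp_bounded compact_continuous_image) auto
  then obtain K where K: "K > 0" "\<And>x. x \<in> {a..b} \<Longrightarrow> norm (Gamma x) \<le> K"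
    by (auto simp: bounded_pos)
  show ?thesis
  proof (rule that[OF K(1)])
    fix s assume s: "a \<le> Re s" "Re s \<le> b"
    have "norm (Gamma s) \<le> Gamma (Re s)" using s assms by (intro norm_Gamma_le_Gamma_Re) auto
    also have "\<dots> \<le> K" using K(2)[of "Re s"] s by auto
    finally show "norm (Gamma s) \<le> K" .
  qed
qed

lemma norm_exp_i_pi_half: "norm (exp (\<i> * of_real pi / 2 * s)) = exp (- (pi * Im s / 2))"
  "norm (exp (- (\<i> * of_real pi / 2 * s))) = exp (pi * Im s / 2)"
  by (simp_all add: mult_ac)

text \<open>Multiplication by exp(-\<i> pi s/2) removes the decay exp(-pi t/2), and division by
  s^(N+1) removes the polynomial. The quotient is bounded on two neighbouring half-integer lines and
  of exponential growth between them, so Phragmen-Lindelof applies. The power of t is not sharp, but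
  it suffices to make horizontal edges vanish.\<close>

lemma Gamma_strip_decay:
  obtains C where "C > 0" "\<And>\<sigma> t. \<lbrakk>1/2 + real N \<le> \<sigma>; \<sigma> \<le> 1/2 + real (Suc N); t \<ge> 1\<rbrakk>
     \<Longrightarrow> norm (Gamma (Complex \<sigma> t)) \<le> C * (real N + 2 + t) ^ Suc N * exp (- (pi * t / 2))"
proof -
  define f where "f s = Gamma s * exp (- (\<i> * of_real pi / 2 * s)) / s ^ Suc N" for s
  have nf: "norm (f (Complex \<sigma> t)) = norm (Gamma (Complex \<sigma> t)) * exp (pi * t / 2) / norm (Complex \<sigma> t) ^ Suc N" for \<sigma> t
    by (simp add: f_def norm_mult norm_divide norm_power norm_exp_i_pi_half del: power_Suc)
  have hol: "f holomorphic_on {s. Im s > 0}" unfolding f_def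
    by (intro holomorphic_intros) (auto simp: notin_nonpos_Ints_Im)
  obtain K where K: "K > 0" "\<And>s. \<lbrakk>1/2 + real N \<le> Re s; Re s \<le> 1/2 + real (Suc N)\<rbrakk> \<Longrightarrow> norm (Gamma s) \<le> K"
    using Gamma_strip_bounded[of "1/2 + real N" "1/2 + real (Suc N)"] by auto
  have ge1: "norm (Complex \<sigma> t) \<ge> t" if "t \<ge> 1" for \<sigma> t using abs_Im_le_cmod[of "Complex \<sigma> t"] that by simp
  define M where "M = sqrt (2 * pi) * (real N + 3) ^ Suc N"
  have edge: "norm (f (Complex (1/2 + real j) t)) \<le> M" if j: "j = N \<or> j = Suc N" and t: "t \<ge> 1" for j t
  proof -
    have "norm (Gamma (Complex (1/2 + real j) t)) \<le> sqrt (2 * pi) * (real j + 1 + \<bar>t\<bar>) ^ j * exp (- (pi * \<bar>t\<bar> / 2))"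
      by (rule norm_Gamma_half_int_le)
    also have "\<dots> \<le> sqrt (2 * pi) * ((real N + 3) * t) ^ Suc N * exp (- (pi * \<bar>t\<bar> / 2))"
    proof (intro mult_right_mono mult_left_mono)
      have "real j + 1 + \<bar>t\<bar> \<le> (real N + 2) * 1 + t" using j t by auto
      also have "\<dots> \<le> (real N + 2) * t + t" using t by (intro add_mono mult_left_mono) auto
      finally have a: "real j + 1 + \<bar>t\<bar> \<le> (real N + 3) * t" by (simp add: algebra_simps)
      have "(real j + 1 + \<bar>t\<bar>) ^ j \<le> (real j + 1 + \<bar>t\<bar>) ^ Suc N"
        using j t by (intro power_increasing) auto
      also have "\<dots> \<le> ((real N + 3) * t) ^ Suc N" using a by (intro power_mono) auto
      finally show "(real j + 1 + \<bar>t\<bar>) ^ j \<le> ((real N + 3) * t) ^ Suc N" .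
    qed auto
    also have "\<dots> = M * t ^ Suc N * exp (- (pi * t / 2))" using t by (simp add: M_def power_mult_distrib)
    finally have G: "norm (Gamma (Complex (1/2 + real j) t)) \<le> M * t ^ Suc N * exp (- (pi * t / 2))" .
    have "norm (f (Complex (1/2 + real j) t)) \<le> (M * t ^ Suc N * exp (- (pi * t / 2))) * exp (pi * t / 2) / t ^ Suc N"
      unfolding nf using t G ge1[OF t]
      by (intro frac_le mult_mono power_mono) (auto simp: M_def)
    also have "\<dots> = M" using t by (simp add: exp_minus)
    finally show ?thesis .
  qed
  obtain M' where M': "M' > 0" "\<And>\<sigma> t. \<lbrakk>1/2 + real N \<le> \<sigma>; \<sigma> \<le> 1/2 + real (Suc N); t \<ge> 1\<rbrakk> \<Longrightarrow> norm (f (Complex \<sigma> t)) \<le> M'"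
  proof (rule phragmen_lindelof_half_strip[OF hol, of 1 "1/2 + real N" "1/2 + real (Suc N)" K "pi/2" M])
    fix \<sigma> t assume s: "1/2 + real N \<le> \<sigma>" "\<sigma> \<le> 1/2 + real (Suc N)" "(t::real) \<ge> 1"
    have "norm (f (Complex \<sigma> t)) \<le> K * exp (pi * t / 2) / 1"
      unfolding nf using s K(2)[of "Complex \<sigma> t"] K(1) ge1[of t \<sigma>]
      by (intro frac_le mult_mono) (auto intro!: one_le_power simp del: power_Suc)
    thus "norm (f (Complex \<sigma> t)) \<le> K * exp (pi / 2 * t)" by (simp add: mult_ac)
  next
    fix t :: real assume t: "t \<ge> 1"
    show "norm (f (Complex (1/2 + real N) t)) \<le> M" using edge[of N t] t by simp
    show "norm (f (Complex (1/2 + real (Suc N)) t)) \<le> M" using edge[of "Suc N" t] t by (simp del: of_nat_Suc)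
  qed auto
  show ?thesis
  proof (rule that[OF M'(1)])
    fix \<sigma> t assume s: "1/2 + real N \<le> \<sigma>" "\<sigma> \<le> 1/2 + real (Suc N)" "(t::real) \<ge> 1"
    have le: "norm (Complex \<sigma> t) \<le> real N + 2 + t" using cmod_le[of "Complex \<sigma> t"] s by simp
    have pos: "norm (Complex \<sigma> t) > 0" using ge1[of t \<sigma>] s by linarith
    have "norm (Gamma (Complex \<sigma> t)) = norm (f (Complex \<sigma> t)) * norm (Complex \<sigma> t) ^ Suc N * exp (- (pi * t / 2))"
      using pos by (simp add: nf exp_minus)
    also have "\<dots> \<le> M' * (real N + 2 + t) ^ Suc N * exp (- (pi * t / 2))"
      using le M' s by (intro mult_right_mono mult_mono power_mono) auto
    finally show "norm (Gamma (Complex \<sigma> t)) \<le> M' * (real N + 2 + t) ^ Suc N * exp (- (pi * t / 2))" .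
  qed
qed

section \<open>The order of 1/Gamma in vertical strips\<close>

text \<open>Up to a rotation this is the factor s^(s-1/2) of Stirling's formula. The point
  \<open>- \<i> * s\<close> lies in the right half-plane, with argument
  \<open>- arctan (\<sigma> / t)\<close>; so the modulus is |s|^(\<sigma>-1/2) times exp(t
  arctan(\<sigma>/t)), and t arctan(\<sigma>/t) lies between 0 and \<sigma>. Without the rotation a
  factor exp(-pi t/2) would remain.\<close>

lemma norm_exp_mult_Ln:
  assumes t: "t \<ge> 1" and s: "\<sigma> \<ge> 0"
  shows "norm (Complex \<sigma> t) powr (\<sigma> - 1/2) \<le> norm (exp ((Complex \<sigma> t - 1/2) * Ln (- \<i> * Complex \<sigma> t)))"
    and "norm (exp ((Complex \<sigma> t - 1/2) * Ln (- \<i> * Complex \<sigma> t))) \<le> norm (Complex \<sigma> t) powr (\<sigma> - 1/2) * exp \<sigma>"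
proof -
  define w where "w = - \<i> * Complex \<sigma> t"
  have w: "Re w = t" "Im w = - \<sigma>" by (simp_all add: w_def)
  have w0: "w \<noteq> 0" using t w by auto
  have nw: "norm w = norm (Complex \<sigma> t)" by (simp add: w_def norm_mult)
  have pos: "norm (Complex \<sigma> t) > 0" using nw w0 by (metis zero_less_norm_iff)
  have im: "Im (Ln w) = - arctan (\<sigma> / t)" using t w by (subst Im_Ln_eq[OF w0]) (simp add: arctan_minus)
  have "0 \<le> arctan (\<sigma> / t)" using t s by simp
  hence a0: "0 \<le> t * arctan (\<sigma> / t)" using t by simp
  have "arctan (\<sigma> / t) \<le> \<sigma> / t" using t s by (intro arctan_le_self) auto
  hence a1: "t * arctan (\<sigma> / t) \<le> \<sigma>" using t by (simp add: field_simps)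
  have "norm (exp ((Complex \<sigma> t - 1/2) * Ln w)) = exp ((\<sigma> - 1/2) * ln (norm w) - t * Im (Ln w))"
    using w0 by (simp add: Re_Ln)
  also have "\<dots> = norm (Complex \<sigma> t) powr (\<sigma> - 1/2) * exp (t * arctan (\<sigma> / t))"
    using pos by (simp add: im nw powr_def exp_add)
  finally have e: "norm (exp ((Complex \<sigma> t - 1/2) * Ln w)) = norm (Complex \<sigma> t) powr (\<sigma> - 1/2) * exp (t * arctan (\<sigma> / t))" .
  show "norm (Complex \<sigma> t) powr (\<sigma> - 1/2) \<le> norm (exp ((Complex \<sigma> t - 1/2) * Ln (- \<i> * Complex \<sigma> t)))"
    using a0 unfolding w_def[symmetric] e by (simp add: mult_le_cancel_left1)
  show "norm (exp ((Complex \<sigma> t - 1/2) * Ln (- \<i> * Complex \<sigma> t))) \<le> norm (Complex \<sigma> t) powr (\<sigma> - 1/2) * exp \<sigma>"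
    using a1 unfolding w_def[symmetric] e by (intro mult_left_mono) auto
qed

text \<open>The reflection formula trades 1/\<Gamma>(z) for \<Gamma>(1-z), at the price of a sine of
  size exp(pi t). The exponent is twice the true one, but Phragmen-Lindelof only asks for some
  exponential bound.\<close>

lemma rGamma_strip_crude:
  obtains K where "K > 0" "\<And>\<sigma> t. \<lbrakk>0 \<le> \<sigma>; \<sigma> \<le> real M; t \<ge> 1\<rbrakk> \<Longrightarrow> norm (rGamma (Complex \<sigma> t)) \<le> K * exp (pi * t)"
proof -
  obtain K where K: "K > 0" "\<And>s. \<lbrakk>1 \<le> Re s; Re s \<le> 2 + real M\<rbrakk> \<Longrightarrow> norm (Gamma s) \<le> K"
    using Gamma_strip_bounded[of 1 "2 + real M"] by auto
  show ?thesis
  proof (rule that[OF K(1)])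
    fix \<sigma> t assume s: "0 \<le> \<sigma>" "\<sigma> \<le> real M" "(t::real) \<ge> 1"
    define z where "z = Complex \<sigma> t"
    have nz: "1 - z \<notin> \<int>\<^sub>\<le>\<^sub>0" using s by (intro notin_nonpos_Ints_Im) (simp add: z_def)
    have "rGamma z * rGamma (1 - z) = sin (of_real pi * z) / of_real pi" by (rule rGamma_reflection_complex)
    hence "rGamma z = sin (of_real pi * z) / of_real pi * Gamma (1 - z)"
    proof -
      have "rGamma z = rGamma z * rGamma (1 - z) * Gamma (1 - z)"
        using nz by (simp add: rGamma_inverse_Gamma[of "1 - z"] Gamma_eq_zero_iff)
      thus ?thesis by (simp only: rGamma_reflection_complex)
    qed
    hence 1: "norm (rGamma z) = norm (sin (of_real pi * z)) / pi * norm (Gamma (1 - z))"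
      by (simp add: norm_mult norm_divide)
    \<comment> \<open>\<open>M + 1\<close> unit steps bring \<open>1 - z\<close> into a strip to the
      right of the imaginary axis, where \<Gamma> is bounded.\<close>
    have "pochhammer (1 - z) (Suc M) = Gamma (1 - z + of_nat (Suc M)) / Gamma (1 - z)"
      by (rule pochhammer_Gamma[OF nz])
    hence "norm (pochhammer (1 - z) (Suc M)) * norm (Gamma (1 - z)) = norm (Gamma (1 - z + of_nat (Suc M)))"
      using nz by (simp add: norm_divide Gamma_eq_zero_iff)
    also have "\<dots> \<le> K" using s by (intro K(2)) (auto simp: z_def)
    finally have 2: "norm (pochhammer (1 - z) (Suc M)) * norm (Gamma (1 - z)) \<le> K" .
    \<comment> \<open>Every factor has imaginary part \<open>- t\<close>, hence modulus at least 1;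
      moving back to the left can only decrease |\<Gamma>|.\<close>
    have "1 \<le> norm (pochhammer (1 - z) (Suc M))"
      unfolding pochhammer_prod prod_norm[symmetric]
    proof (rule prod_ge_1)
      fix i :: nat
      show "1 \<le> norm (1 - z + of_nat i)" using abs_Im_le_cmod[of "1 - z + of_nat i"] s by (simp add: z_def)
    qed
    hence "1 * norm (Gamma (1 - z)) \<le> norm (pochhammer (1 - z) (Suc M)) * norm (Gamma (1 - z))"
      by (intro mult_right_mono) auto
    hence 3: "norm (Gamma (1 - z)) \<le> K" using 2 by simp
    have "norm (sin (of_real pi * z)) \<le> exp \<bar>Im (of_real pi * z)\<bar>"
      using cmod_sin_le_exp[of 1 "of_real pi * z"] by simp
    hence "norm (sin (of_real pi * z)) / pi \<le> exp (pi * t) / 1"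
      using s pi_ge_two by (intro frac_le) (auto simp: z_def)
    hence "norm (rGamma z) \<le> exp (pi * t) * K" unfolding 1 using 3 by (intro mult_mono) auto
    thus "norm (rGamma (Complex \<sigma> t)) \<le> K * exp (pi * t)" by (simp add: z_def mult.commute)
  qed
qed

lemma norm_Complex_le_mult: "\<lbrakk>0 \<le> \<sigma>; t \<ge> 1\<rbrakk> \<Longrightarrow> norm (Complex \<sigma> t) \<le> (\<sigma> + 1) * t"
  using cmod_le[of "Complex \<sigma> t"] mult_left_mono[of 1 t \<sigma>] by (simp add: algebra_simps)

text \<open>Phragmen-Lindelof applied to the quotient of \<open>1 / \<Gamma>\<close> by its Stirling approximation
  interpolates the explicit bounds at half-integers.\<close>

lemma rGamma_strip_bound_half:
  obtains C where "C > 0" "\<And>\<sigma> t. \<lbrakk>1/2 \<le> \<sigma>; \<sigma> \<le> 1/2 + real M; t \<ge> 1\<rbrakk>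
     \<Longrightarrow> norm (rGamma (Complex \<sigma> t)) \<le> C * exp (pi * t / 2) * t powr (1/2 - \<sigma>)"
proof -
  \<comment> \<open>The second factor has modulus exp(-pi t/2) and the third is of order
    t^(\<sigma>-1/2), so boundedness of \<open>f\<close> is exactly the claim.\<close>
  define f where "f s = rGamma s * exp (\<i> * of_real pi / 2 * s) * exp ((s - 1/2) * Ln (- \<i> * s))" for s
  define E where "E \<sigma> t = norm (exp ((Complex \<sigma> t - 1/2) * Ln (- \<i> * Complex \<sigma> t)))" for \<sigma> t
  have nf: "norm (f (Complex \<sigma> t)) = norm (rGamma (Complex \<sigma> t)) * exp (- (pi * t / 2)) * E \<sigma> t" for \<sigma> t
    unfolding f_def norm_mult norm_exp_i_pi_half E_def by simp
  have hol: "f holomorphic_on {s. Im s > 0}" unfolding f_def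
    by (intro holomorphic_intros) (auto simp: complex_nonpos_Reals_iff)
  obtain K where K: "K > 0" "\<And>\<sigma> t. \<lbrakk>0 \<le> \<sigma>; \<sigma> \<le> real (Suc M); t \<ge> 1\<rbrakk> \<Longrightarrow> norm (rGamma (Complex \<sigma> t)) \<le> K * exp (pi * t)"
    using rGamma_strip_crude[of "Suc M"] by blast
  have E2: "E \<sigma> t \<le> ((real M + 2) * t) powr (\<sigma> - 1/2) * exp (real M + 1)"
    if "1/2 \<le> \<sigma>" "\<sigma> \<le> 1/2 + real M" "t \<ge> 1" for \<sigma> t
  proof -
    have "E \<sigma> t \<le> norm (Complex \<sigma> t) powr (\<sigma> - 1/2) * exp \<sigma>"
      unfolding E_def using that by (intro norm_exp_mult_Ln(2)) auto
    also have "norm (Complex \<sigma> t) \<le> (\<sigma> + 1) * t" using that by (intro norm_Complex_le_mult) auto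
    hence "norm (Complex \<sigma> t) \<le> (real M + 2) * t"
      using that mult_right_mono[of "\<sigma> + 1" "real M + 2" t] by linarith
    hence "norm (Complex \<sigma> t) powr (\<sigma> - 1/2) * exp \<sigma> \<le> ((real M + 2) * t) powr (\<sigma> - 1/2) * exp (real M + 1)"
      using that by (intro mult_mono powr_mono2) auto
    finally show ?thesis .
  qed
  define L where "L = (real M + 2) ^ M * exp (real M + 1)"
  have edge: "norm (f (Complex (1/2 + real j) t)) \<le> L" if j: "j = 0 \<or> j = M" and t: "t \<ge> 1" for j t
  proof -
    have jM: "j \<le> M" using j by auto
    have "E (1/2 + real j) t \<le> ((real M + 2) * t) powr (1/2 + real j - 1/2) * exp (real M + 1)"
      using jM t by (intro E2) auto
    also have "((real M + 2) * t) powr (1/2 + real j - 1/2) = (real M + 2) ^ j * t ^ j"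
      using t by (simp add: powr_realpow power_mult_distrib)
    also have "(real M + 2) ^ j * t ^ j * exp (real M + 1) \<le> (real M + 2) ^ M * t ^ j * exp (real M + 1)"
      using t jM by (intro mult_right_mono power_increasing) auto
    finally have e: "E (1/2 + real j) t \<le> L * t ^ j" by (simp add: L_def mult_ac)
    have "norm (f (Complex (1/2 + real j) t)) \<le> (exp (pi * t / 2) / t ^ j) * exp (- (pi * t / 2)) * (L * t ^ j)"
      unfolding nf using t norm_rGamma_half_int_le[OF t, of j] e
      by (intro mult_mono) (auto simp: E_def)
    also have "\<dots> = L" using t by (simp add: exp_minus)
    finally show ?thesis .
  qed
  obtain M' where M': "M' > 0" "\<And>\<sigma> t. \<lbrakk>1/2 + real 0 \<le> \<sigma>; \<sigma> \<le> 1/2 + real M; t \<ge> 1\<rbrakk> \<Longrightarrow> norm (f (Complex \<sigma> t)) \<le> M'"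
  proof (rule phragmen_lindelof_half_strip[OF hol, of 1 "1/2 + real 0" "1/2 + real M" 
        "K * (exp ((real M + 2) * real M) * exp (real M + 1))" "pi + real M * (real M + 2)" L])
    fix \<sigma> t assume s: "1/2 + real 0 \<le> \<sigma>" "\<sigma> \<le> 1/2 + real M" "(t::real) \<ge> 1"
    \<comment> \<open>Any exponential growth is admissible in the interior, so the power of
      \<open>q\<close> is given away to \<open>exp (real M * q)\<close> by
      \<open>ln q \<le> q\<close>.\<close>
    define q where "q = (real M + 2) * t"
    have q1: "q \<ge> 1" unfolding q_def using s mult_mono[of 1 "real M + 2" 1 t] by auto
    have "q powr (\<sigma> - 1/2) \<le> q powr (real M)" using s q1 by (intro powr_mono) auto
    also have "\<dots> = exp (real M * ln q)" using q1 by (simp add: powr_def)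
    also have "\<dots> \<le> exp (real M * q)" using q1 ln_bound[of q] by (auto intro!: mult_left_mono)
    finally have q2: "q powr (\<sigma> - 1/2) \<le> exp (real M * q)" .
    have "E \<sigma> t \<le> q powr (\<sigma> - 1/2) * exp (real M + 1)" unfolding q_def using s by (intro E2) auto
    also have "\<dots> \<le> exp (real M * q) * exp (real M + 1)" using q2 by (intro mult_right_mono) auto
    finally have e: "E \<sigma> t \<le> exp (real M * q) * exp (real M + 1)" .
    have "norm (f (Complex \<sigma> t)) \<le> (K * exp (pi * t)) * 1 * (exp (real M * q) * exp (real M + 1))"
      unfolding nf using s K(1) K(2)[of \<sigma> t] e
      by (intro mult_mono) (auto simp: E_def)
    also have "\<dots> = K * exp (real M + 1) * exp ((pi + real M * (real M + 2)) * t)"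
      by (simp add: q_def algebra_simps exp_add)
    also have "\<dots> \<le> K * (exp ((real M + 2) * real M) * exp (real M + 1)) * exp ((pi + real M * (real M + 2)) * t)"
      using K(1) by (intro mult_right_mono mult_left_mono) (auto simp: mult_le_cancel_right1)
    finally show "norm (f (Complex \<sigma> t)) \<le> K * (exp ((real M + 2) * real M) * exp (real M + 1)) * exp ((pi + real M * (real M + 2)) * t)" .
  next
    fix t :: real assume t: "t \<ge> 1"
    show "norm (f (Complex (1/2 + real 0) t)) \<le> L" using edge[of 0 t] t by blast
    show "norm (f (Complex (1/2 + real M) t)) \<le> L" using edge[of M t] t by blast
  qed auto
  show ?thesis
  proof (rule that[OF M'(1)])
    fix \<sigma> t assume s: "1/2 \<le> \<sigma>" "\<sigma> \<le> 1/2 + real M" "(t::real) \<ge> 1"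
    \<comment> \<open>Undoing the normalisation takes the lower bound for the Stirling factor,
      whereas the edges took the upper one.\<close>
    have "norm (Complex \<sigma> t) \<ge> t" using abs_Im_le_cmod[of "Complex \<sigma> t"] s by simp
    hence "t powr (\<sigma> - 1/2) \<le> norm (Complex \<sigma> t) powr (\<sigma> - 1/2)" using s by (intro powr_mono2) auto
    also have "\<dots> \<le> E \<sigma> t" unfolding E_def using s by (intro norm_exp_mult_Ln(1)) auto
    finally have E: "t powr (\<sigma> - 1/2) \<le> E \<sigma> t" .
    have "norm (rGamma (Complex \<sigma> t)) * exp (- (pi * t / 2)) * t powr (\<sigma> - 1/2) \<le> norm (f (Complex \<sigma> t))"
      unfolding nf using E by (intro mult_left_mono) auto
    also have "\<dots> \<le> M'" using s by (intro M'(2)) auto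
    finally have "norm (rGamma (Complex \<sigma> t)) * exp (- (pi * t / 2)) * t powr (\<sigma> - 1/2) * (exp (pi * t / 2) * t powr (1/2 - \<sigma>))
       \<le> M' * (exp (pi * t / 2) * t powr (1/2 - \<sigma>))" by (intro mult_right_mono) auto
    moreover have "t powr (\<sigma> - 1/2) * t powr (1/2 - \<sigma>) = 1" using s by (simp add: powr_add[symmetric])
    moreover have "exp (- (pi * t / 2)) * exp (pi * t / 2) = 1" by (simp add: exp_minus)
    moreover have "n * a * u * (b * v) = n * (a * b) * (u * v)" for n a u b v :: real
      by (simp only: mult_ac)
    ultimately show "norm (rGamma (Complex \<sigma> t)) \<le> M' * exp (pi * t / 2) * t powr (1/2 - \<sigma>)"
      by (simp only: mult_1_right mult.assoc)
  qed
qed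

text \<open>The range below 1/2 matters because the critical abscissa r/2 may lie there. In
  \<open>rGamma z = z * rGamma (z + 1)\<close> the factor \<open>z\<close>, of order t, exactly
  compensates the change of the exponent.\<close>

lemma rGamma_strip_bound:
  obtains C where "C > 0" "\<And>\<sigma> t. \<lbrakk>0 \<le> \<sigma>; \<sigma> \<le> 1/2 + real M; t \<ge> 1\<rbrakk>
     \<Longrightarrow> norm (rGamma (Complex \<sigma> t)) \<le> C * exp (pi * t / 2) * t powr (1/2 - \<sigma>)"
proof -
  obtain C where C: "C > 0" "\<And>\<sigma> t. \<lbrakk>1/2 \<le> \<sigma>; \<sigma> \<le> 1/2 + real (Suc M); t \<ge> 1\<rbrakk>
     \<Longrightarrow> norm (rGamma (Complex \<sigma> t)) \<le> C * exp (pi * t / 2) * t powr (1/2 - \<sigma>)"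
    using rGamma_strip_bound_half[of "Suc M"] by blast
  have M1: "real M + 2 > 0" by simp
  show ?thesis
  proof (rule that[of "(real M + 2) * C"])
    show "(real M + 2) * C > 0" using C(1) M1 by (rule_tac mult_pos_pos)
    fix \<sigma> t assume s: "0 \<le> \<sigma>" "\<sigma> \<le> 1/2 + real M" "(t::real) \<ge> 1"
    define z where "z = Complex \<sigma> t"
    have z1: "z + 1 = Complex (\<sigma> + 1) t" by (simp add: z_def complex_eq_iff)
    have "norm z \<le> (\<sigma> + 1) * t" unfolding z_def using s by (intro norm_Complex_le_mult) auto
    also have "\<dots> \<le> (real M + 2) * t" using s by (intro mult_right_mono) auto
    finally have nz: "norm z \<le> (real M + 2) * t" .
    have "norm (rGamma z) = norm z * norm (rGamma (z + 1))"
      by (subst rGamma_plus1[symmetric]) (simp add: norm_mult)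
    also have "\<dots> \<le> ((real M + 2) * t) * (C * exp (pi * t / 2) * t powr (1/2 - (\<sigma> + 1)))"
      unfolding z1 using s nz by (intro mult_mono C(2)) auto
    also have "t powr (1/2 - (\<sigma> + 1)) = t powr (1/2 - \<sigma>) / t"
      using s powr_diff[of t "1/2 - \<sigma>" 1] by (simp add: algebra_simps)
    finally show "norm (rGamma (Complex \<sigma> t)) \<le> (real M + 2) * C * exp (pi * t / 2) * t powr (1/2 - \<sigma>)"
      using s by (simp add: z_def mult_ac)
  qed
qed

section \<open>Mellin inversion of the exponential\<close>

lemma power_le_fact_exp:
  fixes x :: real assumes "x \<ge> 0" shows "x ^ N \<le> fact N * exp x"
proof -
  have s: "summable (\<lambda>n. x ^ n / fact n)" using summable_exp[of x] by (simp add: field_simps)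
  have "x ^ N / fact N = sum (\<lambda>n. x ^ n / fact n) {N}" by simp
  also have "\<dots> \<le> (\<Sum>n. x ^ n / fact n)"
    by (rule sum_le_suminf[OF s]) (use assms in auto)
  also have "\<dots> = exp x" by (simp add: exp_def divide_inverse mult.commute)
  finally show ?thesis by (simp add: field_simps)
qed

text \<open>The part \<open>\<eta> = \<kappa> - \<delta>\<close> of the rate pays for the
  polynomial: a single term of the exponential series bounds (\<eta>(a+t))^N by N!
  exp(\<eta>(a+t)).\<close>

lemma power_exp_absorb:
  fixes a \<kappa> \<delta> :: real assumes "a \<ge> 0" "\<delta> < \<kappa>"
  obtains A where "A > 0" "\<And>t. t \<ge> 0 \<Longrightarrow> (a + t) ^ N * exp (- \<kappa> * t) \<le> A * exp (- \<delta> * t)"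
proof
  define \<eta> where "\<eta> = \<kappa> - \<delta>"
  have \<eta>: "\<eta> > 0" using assms by (simp add: \<eta>_def)
  show "fact N / \<eta> ^ N * exp (\<eta> * a) > 0" using \<eta> by simp
  fix t :: real assume t: "t \<ge> 0"
  have "(\<eta> * (a + t)) ^ N \<le> fact N * exp (\<eta> * (a + t))"
    using assms t \<eta> by (intro power_le_fact_exp) auto
  hence "\<eta> ^ N * (a + t) ^ N \<le> fact N * exp (\<eta> * (a + t))" by (simp only: power_mult_distrib)
  hence "(a + t) ^ N \<le> fact N / \<eta> ^ N * exp (\<eta> * (a + t))"
    using \<eta> by (simp add: pos_le_divide_eq mult.commute)
  hence "(a + t) ^ N * exp (- \<kappa> * t) \<le> fact N / \<eta> ^ N * exp (\<eta> * (a + t)) * exp (- \<kappa> * t)"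
    by (intro mult_right_mono) auto
  also have "\<dots> = fact N / \<eta> ^ N * exp (\<eta> * a) * exp (- \<delta> * t)"
    by (simp add: \<eta>_def mult_exp_exp algebra_simps)
  finally show "(a + t) ^ N * exp (- \<kappa> * t) \<le> fact N / \<eta> ^ N * exp (\<eta> * a) * exp (- \<delta> * t)" .
qed

section \<open>Laplace transforms of exponentially decaying functions\<close>

lemma integrable_exp_abs_bound:
  fixes f :: "real \<Rightarrow> complex"
  assumes "continuous_on UNIV f" and "\<delta> > 0"
    and bd: "\<And>t. norm (f t) \<le> A * exp (- \<delta> * \<bar>t\<bar>)"
  shows "integrable lborel f"
proof (rule Bochner_Integration.integrable_bound)
  show "integrable lborel (\<lambda>t. A * exp (- \<delta> * \<bar>t\<bar>))"
    using integrable_exp_abs[OF assms(2)] by simp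
  show "f \<in> borel_measurable lborel" using borel_measurable_continuous_onI[OF assms(1)] by simp
  show "AE t in lborel. norm (f t) \<le> norm (A * exp (- \<delta> * \<bar>t\<bar>))"
  proof (rule AE_I2)
    fix t show "norm (f t) \<le> norm (A * exp (- \<delta> * \<bar>t\<bar>))"
      using bd[of t] abs_ge_self[of "A * exp (- \<delta> * \<bar>t\<bar>)"] unfolding real_norm_def by linarith
  qed
qed

lemma continuous_on_Complex [continuous_intros]:
  "\<lbrakk>continuous_on S f; continuous_on S g\<rbrakk> \<Longrightarrow> continuous_on S (\<lambda>x. Complex (f x) (g x))"
  unfolding Complex_eq by (intro continuous_intros)

lemma norm_exp_Complex_mult:
  "norm (exp (- (Complex \<sigma> t * w))) = exp (- (\<sigma> * Re w) + t * Im w)"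
  by simp

text \<open>Decay is required at every rate below \<kappa>, not at \<kappa> itself. In this form the
  class is closed under multiplication by linear factors without any change of \<kappa>, and
  \<Gamma> on a vertical line belongs to it with \<kappa> = pi/2.\<close>

definition exp_decay :: "real \<Rightarrow> (real \<Rightarrow> complex) \<Rightarrow> bool" where
  "exp_decay \<kappa> G \<longleftrightarrow> continuous_on UNIV G \<and> (\<forall>\<delta><\<kappa>. \<exists>A. \<forall>t. norm (G t) \<le> A * exp (- \<delta> * \<bar>t\<bar>))"

lemma exp_decayI:
  assumes "continuous_on UNIV G" "a \<ge> 0" "C \<ge> 0"
    and bd: "\<And>t. norm (G t) \<le> C * (a + \<bar>t\<bar>) ^ N * exp (- (\<kappa> * \<bar>t\<bar>))"
  shows "exp_decay \<kappa> G"
  unfolding exp_decay_def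
proof (intro conjI allI impI assms(1))
  fix \<delta> assume "\<delta> < \<kappa>"
  then obtain A where A: "A > 0" "\<And>t. t \<ge> 0 \<Longrightarrow> (a + t) ^ N * exp (- \<kappa> * t) \<le> A * exp (- \<delta> * t)"
    using power_exp_absorb[OF assms(2), of \<delta> \<kappa> N] by blast
  have "norm (G t) \<le> C * A * exp (- \<delta> * \<bar>t\<bar>)" for t
    using bd[of t] mult_left_mono[OF A(2)[of "\<bar>t\<bar>"] assms(3)] by (simp add: mult.assoc)
  thus "\<exists>A. \<forall>t. norm (G t) \<le> A * exp (- \<delta> * \<bar>t\<bar>)" by blast
qed

text \<open>Since the abscissa \<open>c\<close> is fixed, Re w contributes only a constant factor,
  while Im w costs |Im w| of the rate.\<close>

lemma exp_decay_kernel: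
  assumes G: "exp_decay \<kappa> G" and w: "\<bar>Im w\<bar> < \<kappa>"
  shows "exp_decay (\<kappa> - \<bar>Im w\<bar>) (\<lambda>t. G t * exp (- (Complex c t * w)))"
  unfolding exp_decay_def
proof (intro conjI allI impI)
  show "continuous_on UNIV (\<lambda>t. G t * exp (- (Complex c t * w)))"
    using G by (auto simp: exp_decay_def intro!: continuous_intros)
  fix \<delta> assume "\<delta> < \<kappa> - \<bar>Im w\<bar>"
  hence "\<delta> + \<bar>Im w\<bar> < \<kappa>" by simp
  then obtain A where A: "\<And>t. norm (G t) \<le> A * exp (- (\<delta> + \<bar>Im w\<bar>) * \<bar>t\<bar>)" using G unfolding exp_decay_def by blast
  have "norm (G t * exp (- (Complex c t * w))) \<le> (A * exp (- (c * Re w))) * exp (- \<delta> * \<bar>t\<bar>)" for t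
  proof -
    have "norm (exp (- (Complex c t * w))) \<le> exp (- (c * Re w) + \<bar>t\<bar> * \<bar>Im w\<bar>)"
      unfolding norm_exp_Complex_mult using abs_ge_self[of "t * Im w"] by (simp add: abs_mult)
    hence "norm (G t * exp (- (Complex c t * w))) \<le> (A * exp (- (\<delta> + \<bar>Im w\<bar>) * \<bar>t\<bar>)) * exp (- (c * Re w) + \<bar>t\<bar> * \<bar>Im w\<bar>)"
      unfolding norm_mult using A[of t] by (intro mult_mono) (auto intro: order_trans[OF norm_ge_zero])
    also have "\<dots> = (A * exp (- (c * Re w))) * exp (- \<delta> * \<bar>t\<bar>)"
      by (simp add: exp_add[symmetric] algebra_simps)
    finally show ?thesis .
  qed
  thus "\<exists>A. \<forall>t. norm (G t * exp (- (Complex c t * w))) \<le> A * exp (- \<delta> * \<bar>t\<bar>)" by blast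
qed

lemma exp_decay_mult_linear:
  assumes G: "exp_decay \<kappa> G"
  shows "exp_decay \<kappa> (\<lambda>t. Complex c t * G t)"
  unfolding exp_decay_def
proof (intro conjI allI impI)
  show "continuous_on UNIV (\<lambda>t. Complex c t * G t)"
    using G by (auto simp: exp_decay_def intro!: continuous_intros)
  fix \<delta> assume d: "\<delta> < \<kappa>"
  \<comment> \<open>An intermediate rate: the step from \<delta>' down to \<delta> pays for the
    linear factor.\<close>
  define \<delta>' where "\<delta>' = (\<delta> + \<kappa>) / 2"
  have d': "\<delta> < \<delta>'" "\<delta>' < \<kappa>" using d by (auto simp: \<delta>'_def)
  obtain A where A: "\<And>t. norm (G t) \<le> A * exp (- \<delta>' * \<bar>t\<bar>)" using G d' unfolding exp_decay_def by blast
  have A0: "A \<ge> 0" using order_trans[OF norm_ge_zero A[of 0]] by simp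
  obtain B where B: "B > 0" "\<And>t. t \<ge> 0 \<Longrightarrow> (\<bar>c\<bar> + t) ^ 1 * exp (- \<delta>' * t) \<le> B * exp (- \<delta> * t)"
    using power_exp_absorb[of "\<bar>c\<bar>" \<delta> \<delta>' 1] d' by auto
  have "norm (Complex c t * G t) \<le> (A * B) * exp (- \<delta> * \<bar>t\<bar>)" for t
  proof -
    have "norm (Complex c t * G t) \<le> (\<bar>c\<bar> + \<bar>t\<bar>) * (A * exp (- \<delta>' * \<bar>t\<bar>))"
      unfolding norm_mult using A[of t] cmod_le[of "Complex c t"] by (intro mult_mono) auto
    also have "\<dots> = A * ((\<bar>c\<bar> + \<bar>t\<bar>) ^ 1 * exp (- \<delta>' * \<bar>t\<bar>))" by simp
    also have "\<dots> \<le> A * (B * exp (- \<delta> * \<bar>t\<bar>))" using B(2)[of "\<bar>t\<bar>"] A0 by (intro mult_left_mono) auto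
    finally show ?thesis by (simp add: mult_ac)
  qed
  thus "\<exists>A. \<forall>t. norm (Complex c t * G t) \<le> A * exp (- \<delta> * \<bar>t\<bar>)" by blast
qed

lemma exp_decay_integrable:
  assumes "exp_decay \<kappa> G" "\<kappa> > 0" shows "integrable lborel G"
proof -
  have "\<kappa> / 2 < \<kappa>" using assms by simp
  then obtain A where "\<And>t. norm (G t) \<le> A * exp (- (\<kappa>/2) * \<bar>t\<bar>)" using assms unfolding exp_decay_def by blast
  thus ?thesis using assms by (intro integrable_exp_abs_bound[where \<delta>="\<kappa>/2"]) (auto simp: exp_decay_def)
qed

text \<open>Differentiation under the integral by a direct estimate of the difference quotient: the
  second-order Taylor remainder of the exponential leaves an error of size
  \<open>B * norm h\<close>, because two powers of \<open>Complex c t\<close> do not destroy the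
  decay.\<close>

lemma laplace_has_field_derivative:
  assumes G: "exp_decay \<kappa> G" and w: "\<bar>Im w\<bar> < \<kappa>"
  shows "((\<lambda>w. \<integral>t. G t * exp (- (Complex c t * w)) \<partial>lborel) has_field_derivative
          (\<integral>t. - (Complex c t * G t * exp (- (Complex c t * w))) \<partial>lborel)) (at w)"
proof -
  \<comment> \<open>Half of the available rate. The kernel times two powers of
    \<open>Complex c t\<close> decays at rate \<eta>, of which an increment \<open>h\<close> with
    \<open>norm h < \<eta> / 2\<close> uses up at most one half.\<close>
  define \<eta> where "\<eta> = (\<kappa> - \<bar>Im w\<bar>) / 2"
  have \<eta>: "\<eta> > 0" using w by (simp add: \<eta>_def)
  define K where "K t = G t * exp (- (Complex c t * w))" for t
  define D1 where "D1 = (\<integral>t. - (Complex c t * G t * exp (- (Complex c t * w))) \<partial>lborel)"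
  have int0: "integrable lborel (\<lambda>t. G t * exp (- (Complex c t * v)))" if "\<bar>Im v\<bar> < \<kappa>" for v
    using exp_decay_integrable[OF exp_decay_kernel[OF G that, of c]] that by simp
  have int1: "integrable lborel (\<lambda>t. - (Complex c t * G t * exp (- (Complex c t * w))))"
    using exp_decay_integrable[OF exp_decay_kernel[OF exp_decay_mult_linear[OF G, of c] w, of c]] w by simp
  have "exp_decay (\<kappa> - \<bar>Im w\<bar>) (\<lambda>t. Complex c t * (Complex c t * (G t * exp (- (Complex c t * w)))))"
    by (intro exp_decay_mult_linear exp_decay_kernel[OF G w])
  moreover have "\<eta> < \<kappa> - \<bar>Im w\<bar>" using w by (simp add: \<eta>_def)
  ultimately obtain A where A: "\<And>t. norm (Complex c t * (Complex c t * K t)) \<le> A * exp (- \<eta> * \<bar>t\<bar>)"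
    unfolding exp_decay_def K_def by blast
  define r where "r = \<eta> / 2"
  have r: "r > 0" using \<eta> by (simp add: r_def)
  define B where "B = (\<integral>t. A * exp (r * \<bar>c\<bar>) * exp (- r * \<bar>t\<bar>) \<partial>lborel)"
  have key: "norm (((\<integral>t. G t * exp (- (Complex c t * (w + h))) \<partial>lborel) - (\<integral>t. G t * exp (- (Complex c t * w)) \<partial>lborel)) / h - D1) \<le> B * norm h"
    if h: "h \<noteq> 0" "norm h < r" for h
  proof -
    have "\<bar>Im (w + h)\<bar> \<le> \<bar>Im w\<bar> + norm h" using abs_Im_le_cmod[of h] by simp
    also have "\<dots> < \<kappa>" using h \<eta> by (simp add: r_def \<eta>_def field_simps)
    finally have wh: "\<bar>Im (w + h)\<bar> < \<kappa>" .
    have "((\<integral>t. G t * exp (- (Complex c t * (w + h))) \<partial>lborel) - (\<integral>t. G t * exp (- (Complex c t * w)) \<partial>lborel)) / h - D1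
       = (\<integral>t. (G t * exp (- (Complex c t * (w + h))) - G t * exp (- (Complex c t * w))) / h - - (Complex c t * G t * exp (- (Complex c t * w))) \<partial>lborel)"
      unfolding D1_def using int0[OF wh] int0[OF w] int1 by simp
    also have "norm \<dots> \<le> (\<integral>t. A * exp (r * \<bar>c\<bar>) * exp (- r * \<bar>t\<bar>) * norm h \<partial>lborel)"
    proof (rule Bochner_Integration.integral_norm_bound_integral)
      show "integrable lborel (\<lambda>t. A * exp (r * \<bar>c\<bar>) * exp (- r * \<bar>t\<bar>) * norm h)"
        using integrable_exp_abs[OF r] by simp
      fix t :: real
      define s where "s = Complex c t"
      have "norm (exp (- (s * h)) - (\<Sum>k\<le>1. (- (s * h)) ^ k / fact k)) \<le> exp \<bar>Re (- (s * h))\<bar> * norm (- (s * h)) ^ Suc 1 / fact 1"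
        by (rule Taylor_exp)
      moreover have "exp (- (s * h)) - 1 + s * h = exp (- (s * h)) - (\<Sum>k\<le>1. (- (s * h)) ^ k / fact k)" by simp
      ultimately have T: "norm (exp (- (s * h)) - 1 + s * h) \<le> exp \<bar>Re (- (s * h))\<bar> * (norm s * norm h)\<^sup>2"
        by (simp only: norm_minus_cancel norm_mult fact_1 div_by_1 Suc_1)
      have "\<bar>Re (- (s * h))\<bar> \<le> norm s * norm h" using abs_Re_le_cmod[of "- (s * h)"] by (simp add: norm_mult)
      also have "\<dots> \<le> (\<bar>c\<bar> + \<bar>t\<bar>) * r" using h cmod_le[of s] by (intro mult_mono) (auto simp: s_def)
      finally have "exp \<bar>Re (- (s * h))\<bar> \<le> exp (r * \<bar>c\<bar> + r * \<bar>t\<bar>)" by (simp add: algebra_simps)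
      hence T2: "norm (exp (- (s * h)) - 1 + s * h) \<le> exp (r * \<bar>c\<bar> + r * \<bar>t\<bar>) * (norm s * norm h)\<^sup>2"
        using T by (meson order_trans mult_right_mono zero_le_power2)
      have "(G t * exp (- (s * (w + h))) - G t * exp (- (s * w))) / h - - (s * G t * exp (- (s * w)))
         = K t * (exp (- (s * h)) - 1 + s * h) / h"
        using h by (simp add: K_def s_def[symmetric] ring_distribs exp_add exp_diff exp_minus divide_simps)
      also have "norm \<dots> = norm (K t) * norm (exp (- (s * h)) - 1 + s * h) / norm h"
        by (simp add: norm_mult norm_divide)
      also have "\<dots> \<le> norm (K t) * (exp (r * \<bar>c\<bar> + r * \<bar>t\<bar>) * (norm s * norm h)\<^sup>2) / norm h"
        using T2 by (intro divide_right_mono mult_left_mono) auto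
      also have "\<dots> = norm (s * (s * K t)) * (exp (r * \<bar>c\<bar> + r * \<bar>t\<bar>) * norm h)"
        using h by (simp add: norm_mult power2_eq_square field_simps)
      also have "\<dots> \<le> (A * exp (- \<eta> * \<bar>t\<bar>)) * (exp (r * \<bar>c\<bar> + r * \<bar>t\<bar>) * norm h)"
        using A[of t] by (intro mult_right_mono) (auto simp: s_def)
      also have "\<dots> = A * (exp (- \<eta> * \<bar>t\<bar>) * exp (r * \<bar>c\<bar> + r * \<bar>t\<bar>)) * norm h" by (simp only: mult_ac)
      also have "exp (- \<eta> * \<bar>t\<bar>) * exp (r * \<bar>c\<bar> + r * \<bar>t\<bar>) = exp (r * \<bar>c\<bar>) * exp (- r * \<bar>t\<bar>)"
        by (simp add: mult_exp_exp r_def field_simps)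
      finally show "norm ((G t * exp (- (Complex c t * (w + h))) - G t * exp (- (Complex c t * w))) / h - - (Complex c t * G t * exp (- (Complex c t * w)))) \<le> A * exp (r * \<bar>c\<bar>) * exp (- r * \<bar>t\<bar>) * norm h"
        unfolding s_def by (simp only: mult_ac)
    qed (use int0[OF wh] int0[OF w] int1 in simp)
    also have "\<dots> = B * norm h" unfolding B_def by simp
    finally show ?thesis .
  qed
  have "((\<lambda>h. ((\<integral>t. G t * exp (- (Complex c t * (w + h))) \<partial>lborel) - (\<integral>t. G t * exp (- (Complex c t * w)) \<partial>lborel)) / h) \<longlongrightarrow> D1) (at 0)"
  proof (rule Lim_transform_bound[THEN LIM_zero_cancel])
    show "((\<lambda>h. B * norm h) \<longlongrightarrow> (0::real)) (at (0::complex))"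
      by (auto intro!: tendsto_eq_intros)
    show "\<forall>\<^sub>F h in at 0. norm (((\<integral>t. G t * exp (- (Complex c t * (w + h))) \<partial>lborel) - (\<integral>t. G t * exp (- (Complex c t * w)) \<partial>lborel)) / h - D1) \<le> norm (B * norm h)"
      unfolding eventually_at using key r 
      by (intro exI[of _ r]) (auto intro: order_trans[OF _ abs_ge_self])
  qed
  thus ?thesis unfolding D1_def[symmetric] DERIV_def .
qed

section \<open>The exponential function as an inverse Mellin transform\<close>

lemma exp_decay_Gamma: "exp_decay (pi / 2) (\<lambda>t. Gamma (Complex (1/2 + real N) t))"
proof (rule exp_decayI)
  show "continuous_on UNIV (\<lambda>t. Gamma (Complex (1/2 + real N) t))"
    by (rule continuous_on_compose2[OF continuous_on_Gamma[of "{s. Re s > 0}"]])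
       (auto simp: notin_nonpos_Ints_Re intro!: continuous_intros)
  show "norm (Gamma (Complex (1/2 + real N) t)) \<le> sqrt (2 * pi) * (real N + 1 + \<bar>t\<bar>) ^ N * exp (- (pi / 2 * \<bar>t\<bar>))" for t
    using norm_Gamma_half_int_le[of N t] by (simp add: field_simps)
qed auto

lemma norm_Gamma_Complex_uminus: "norm (Gamma (Complex \<sigma> (- t))) = norm (Gamma (Complex \<sigma> t))"
proof -
  have "Complex \<sigma> (- t) = cnj (Complex \<sigma> t)" by (simp add: complex_eq_iff)
  thus ?thesis by (metis cnj_Gamma complex_mod_cnj)
qed

text \<open>In the right half-plane \<Gamma> has no pole to cross, and |Im w| < pi/2 leaves some
  decay on the horizontal edges. The shift is by exactly one so that
  \<open>s * Gamma s = Gamma (s + 1)\<close> can become a differential equation in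
  \<open>w\<close>.\<close>

lemma Gamma_vertical_shift:
  assumes w: "\<bar>Im w\<bar> < pi / 2"
  shows "(\<integral>t. Gamma (Complex (1/2 + real N) t) * exp (- (Complex (1/2 + real N) t * w)) \<partial>lborel)
       = (\<integral>t. Gamma (Complex (1/2 + real (Suc N)) t) * exp (- (Complex (1/2 + real (Suc N)) t * w)) \<partial>lborel)"
proof -
  define F where "F s = Gamma s * exp (- (s * w))" for s
  obtain C where C: "C > 0" "\<And>\<sigma> t. \<lbrakk>1/2 + real N \<le> \<sigma>; \<sigma> \<le> 1/2 + real (Suc N); t \<ge> 1\<rbrakk>
     \<Longrightarrow> norm (Gamma (Complex \<sigma> t)) \<le> C * (real N + 2 + t) ^ Suc N * exp (- (pi * t / 2))"
    using Gamma_strip_decay[of N] by blast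
  define \<delta> where "\<delta> = (pi / 2 - \<bar>Im w\<bar>) / 2"
  have \<delta>: "\<delta> > 0" "\<delta> < pi / 2 - \<bar>Im w\<bar>" using w by (auto simp: \<delta>_def)
  obtain A where A: "A > 0" "\<And>t. t \<ge> 0 \<Longrightarrow> (real N + 2 + t) ^ Suc N * exp (- (pi / 2 - \<bar>Im w\<bar>) * t) \<le> A * exp (- \<delta> * t)"
    using power_exp_absorb[of "real N + 2", OF _ \<delta>(2), of "Suc N"] by auto
  define E where "E = exp ((1/2 + real (Suc N)) * \<bar>Re w\<bar>)"
  have int: "integrable lborel (\<lambda>t. F (Complex (1/2 + real M) t))" for M
    using exp_decay_integrable[OF exp_decay_kernel[OF exp_decay_Gamma[of M] w, of "1/2 + real M"]] w
    unfolding F_def by simp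
  show ?thesis unfolding F_def[symmetric]
  proof (rule contour_shift_full_line[of F 0])
    show "F holomorphic_on {s. Re s > 0}" unfolding F_def
      by (intro holomorphic_intros) (auto simp: notin_nonpos_Ints_Re)
    show "((\<lambda>t. C * E * (A * exp (- \<delta> * t))) \<longlongrightarrow> 0) at_top" using \<delta>(1) by real_asymp
    fix \<sigma> t :: real assume s: "1/2 + real N \<le> \<sigma>" "\<sigma> \<le> 1/2 + real (Suc N)" "\<bar>t\<bar> \<ge> 1"
    have "norm (Gamma (Complex \<sigma> t)) = norm (Gamma (Complex \<sigma> \<bar>t\<bar>))"
      by (cases "t \<ge> 0") (auto simp: norm_Gamma_Complex_uminus)
    hence G: "norm (Gamma (Complex \<sigma> t)) \<le> C * (real N + 2 + \<bar>t\<bar>) ^ Suc N * exp (- (pi * \<bar>t\<bar> / 2))"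
      using C(2)[of \<sigma> "\<bar>t\<bar>"] s by simp
    have "- (\<sigma> * Re w) \<le> \<sigma> * \<bar>Re w\<bar>" using s abs_ge_minus_self[of "\<sigma> * Re w"] by (simp add: abs_mult)
    also have "\<dots> \<le> (1/2 + real (Suc N)) * \<bar>Re w\<bar>" using s by (intro mult_right_mono) auto
    finally have "norm (exp (- (Complex \<sigma> t * w))) \<le> exp ((1/2 + real (Suc N)) * \<bar>Re w\<bar> + \<bar>t\<bar> * \<bar>Im w\<bar>)"
      unfolding norm_exp_Complex_mult using abs_ge_self[of "t * Im w"] unfolding abs_mult exp_le_cancel_iff by linarith
    hence "norm (F (Complex \<sigma> t)) \<le> (C * (real N + 2 + \<bar>t\<bar>) ^ Suc N * exp (- (pi * \<bar>t\<bar> / 2))) * (E * exp (\<bar>t\<bar> * \<bar>Im w\<bar>))"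
      unfolding F_def norm_mult E_def exp_add[symmetric] using G C(1) by (intro mult_mono) auto
    also have "\<dots> = C * E * ((real N + 2 + \<bar>t\<bar>) ^ Suc N * (exp (- (pi * \<bar>t\<bar> / 2)) * exp (\<bar>t\<bar> * \<bar>Im w\<bar>)))"
      by (simp only: mult_ac)
    also have "exp (- (pi * \<bar>t\<bar> / 2)) * exp (\<bar>t\<bar> * \<bar>Im w\<bar>) = exp (- (pi / 2 - \<bar>Im w\<bar>) * \<bar>t\<bar>)"
      by (simp add: mult_exp_exp algebra_simps)
    also have "C * E * ((real N + 2 + \<bar>t\<bar>) ^ Suc N * \<dots>) \<le> C * E * (A * exp (- \<delta> * \<bar>t\<bar>))"
      using C(1) A(2)[of "\<bar>t\<bar>"] by (intro mult_left_mono) (auto simp: E_def)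
    finally show "norm (F (Complex \<sigma> t)) \<le> C * E * (A * exp (- \<delta> * \<bar>t\<bar>))" .
  qed (use int[of N] int[of "Suc N"] in \<open>simp_all del: of_nat_Suc\<close>)
qed

text \<open>The constant is \<open>2 * pi\<close> by Mellin inversion, but its value plays no role below.\<close>

lemma Mellin_Gamma_exp:
  obtains C where "\<And>w. \<bar>Im w\<bar> < pi / 2 \<Longrightarrow>
     (\<integral>t. Gamma (Complex (1/2 + real N) t) * exp (- (Complex (1/2 + real N) t * w)) \<partial>lborel) = C * exp (- exp w)"
proof -
  define c where "c = 1/2 + real N"
  define D where "D w = (\<integral>t. Gamma (Complex c t) * exp (- (Complex c t * w)) \<partial>lborel)" for w
  define S where "S = {w. \<bar>Im w\<bar> < pi / 2}"
  have "S = {w. Im w < pi / 2} \<inter> {w. Im w > - (pi / 2)}" by (auto simp: S_def)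
  hence convS: "convex S"
    by (simp only:) (intro convex_Int convex_halfspace_Im_lt convex_halfspace_Im_gt)
  \<comment> \<open>Differentiation brings down -s, and s\<Gamma>(s) exp(-sw) = exp(w) \<Gamma>(s+1)
    exp(-(s+1)w). This is the same integrand one unit further to the right, so D' = - exp(w)
    D.\<close>
  have der: "(D has_field_derivative (- exp w * D w)) (at w)" if w: "w \<in> S" for w
  proof -
    have w': "\<bar>Im w\<bar> < pi / 2" using w by (simp add: S_def)
    have "- (Complex c t * Gamma (Complex c t) * exp (- (Complex c t * w)))
         = - exp w * (Gamma (Complex (1/2 + real (Suc N)) t) * exp (- (Complex (1/2 + real (Suc N)) t * w)))" for t
    proof -
      have e: "Complex (1/2 + real (Suc N)) t = Complex c t + 1" by (simp add: c_def complex_eq_iff)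
      have "Gamma (Complex c t + 1) = Complex c t * Gamma (Complex c t)"
        by (rule Gamma_plus1) (simp add: notin_nonpos_Ints_Re c_def)
      thus ?thesis unfolding e by (simp add: ring_distribs exp_add exp_minus exp_diff field_simps)
    qed
    hence "(\<integral>t. - (Complex c t * Gamma (Complex c t) * exp (- (Complex c t * w))) \<partial>lborel)
      = - exp w * (\<integral>t. Gamma (Complex (1/2 + real (Suc N)) t) * exp (- (Complex (1/2 + real (Suc N)) t * w)) \<partial>lborel)"
      by simp
    also have "\<dots> = - exp w * D w" unfolding D_def c_def using Gamma_vertical_shift[OF w', of N] by simp
    finally show ?thesis
      using laplace_has_field_derivative[OF exp_decay_Gamma[of N] w', of c] unfolding D_def c_def by simp
  qed
  \<comment> \<open>The function exp(exp w) is an integrating factor of this equation.\<close>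
  have "\<exists>C. \<forall>w\<in>S. D w * exp (exp w) = C"
  proof (rule has_field_derivative_zero_constant[OF convS])
    fix w assume "w \<in> S"
    have "((\<lambda>w. D w * exp (exp w)) has_field_derivative (- exp w * D w) * exp (exp w) + exp w * exp (exp w) * D w) (at w)"
      by (rule derivative_eq_intros der[OF \<open>w \<in> S\<close>] refl)+ simp
    thus "((\<lambda>w. D w * exp (exp w)) has_field_derivative 0) (at w within S)"
      by (auto intro: has_field_derivative_at_within)
  qed
  then obtain C where C: "\<And>w. w \<in> S \<Longrightarrow> D w * exp (exp w) = C" by blast
  show ?thesis
  proof (rule that)
    fix w assume "\<bar>Im w\<bar> < pi / 2"
    hence "D w * exp (exp w) = C" by (intro C) (simp add: S_def)
    thus "(\<integral>t. Gamma (Complex (1/2 + real N) t) * exp (- (Complex (1/2 + real N) t * w)) \<partial>lborel) = C * exp (- exp w)"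
      unfolding D_def c_def by (auto simp: exp_minus field_simps)
  qed
qed

section \<open>Resonance of a Dirichlet series\<close>

text \<open>Integration by parts gives P_(k+1) = ((k+1) P_k - u^(k+1) exp(-wu)) / w. With the
  primitive normalised to vanish at infinity, the integral over the half-line is
  \<open>- P 0\<close>.\<close>

lemma power_exp_primitive:
  fixes w :: complex assumes w: "Re w > 0"
  shows "\<exists>P. (\<forall>u. (P has_vector_derivative (of_real u ^ k * exp (- (w * of_real u)))) (at u)) \<and>
     P 0 = - fact k / w ^ Suc k \<and> (P \<longlongrightarrow> 0) at_top"
proof -
  have w0: "w \<noteq> 0" using w by auto
  define e where "e u = exp (- (w * of_real u))" for u :: real
  have e: "(e has_vector_derivative (- w * e u)) (at u)" for u
    unfolding e_def
    by (rule has_vector_derivative_real_field[of "\<lambda>z. exp (- (w * z))"]) (auto intro!: derivative_eq_intros)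
  have lim: "((\<lambda>u. of_real u ^ k * e u) \<longlongrightarrow> 0) at_top" for k
  proof (rule tendsto_norm_zero_cancel)
    obtain A where A: "\<And>t. t \<ge> 0 \<Longrightarrow> (0 + t) ^ k * exp (- Re w * t) \<le> A * exp (- (Re w / 2) * t)"
      using power_exp_absorb[of 0 "Re w / 2" "Re w" k] w by auto
    show "((\<lambda>u. norm (of_real u ^ k * e u)) \<longlongrightarrow> 0) at_top"
    proof (rule tendsto_sandwich[of "\<lambda>_. 0" _ _ "\<lambda>t. A * exp (- (Re w / 2) * t)"])
      show "((\<lambda>t. A * exp (- (Re w / 2) * t)) \<longlongrightarrow> 0) at_top" using w by real_asymp
      show "\<forall>\<^sub>F t in at_top. norm (of_real t ^ k * e t) \<le> A * exp (- (Re w / 2) * t)"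
        using eventually_ge_at_top[of 0] by eventually_elim (use A in \<open>simp add: norm_mult norm_power e_def\<close>)
    qed auto
  qed
  have "\<exists>P. (\<forall>u. (P has_vector_derivative (of_real u ^ k * e u)) (at u)) \<and> P 0 = - fact k / w ^ Suc k \<and> (P \<longlongrightarrow> 0) at_top"
  proof (induction k)
    case 0
    show ?case
    proof (intro exI[of _ "\<lambda>u. - e u / w"] conjI allI)
      show "((\<lambda>u. - e u / w) has_vector_derivative (of_real u ^ 0 * e u)) (at u)" for u
        using has_vector_derivative_mult_right[OF e[of u], of "- 1 / w"] w0 by simp
      show "((\<lambda>u. - e u / w) \<longlongrightarrow> 0) at_top"
        using tendsto_mult_right[OF lim[of 0], of "- 1 / w"] by simp
    qed (simp add: e_def)
  next
    case (Suc k)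
    then obtain P where P: "\<forall>u. (P has_vector_derivative (of_real u ^ k * e u)) (at u)" "P 0 = - fact k / w ^ Suc k" "(P \<longlongrightarrow> 0) at_top"
      by (elim exE conjE)
    define Q where "Q u = (of_nat (Suc k) / w) * P u - (1 / w) * (of_real u ^ Suc k * e u)" for u
    show ?case
    proof (intro exI[of _ Q] conjI allI)
      fix u
      have p: "((\<lambda>u. complex_of_real u ^ Suc k) has_vector_derivative (of_nat (Suc k) * of_real u ^ k)) (at u)"
        by (rule has_vector_derivative_real_field[of "\<lambda>z. z ^ Suc k"]) (rule DERIV_power_Suc[OF DERIV_ident, THEN DERIV_cong], simp)
      have "(Q has_vector_derivative ((of_nat (Suc k) / w) * (of_real u ^ k * e u) - (1 / w) * (of_real u ^ Suc k * (- w * e u) + of_nat (Suc k) * of_real u ^ k * e u))) (at u)"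
        unfolding Q_def using P(1)
        by (intro has_vector_derivative_diff has_vector_derivative_mult_right has_vector_derivative_mult p e) auto
      also have "(of_nat (Suc k) / w) * (of_real u ^ k * e u) - (1 / w) * (of_real u ^ Suc k * (- w * e u) + of_nat (Suc k) * of_real u ^ k * e u)
         = of_real u ^ Suc k * e u" using w0 by (simp add: field_simps del: power_Suc of_nat_Suc)
      finally show "(Q has_vector_derivative (of_real u ^ Suc k * e u)) (at u)" .
    next
      show "Q 0 = - fact (Suc k) / w ^ Suc (Suc k)" by (simp add: Q_def P(2))
      have "(Q \<longlongrightarrow> (of_nat (Suc k) / w) * 0 - (1 / w) * 0) at_top"
        unfolding Q_def by (intro tendsto_intros P(3) lim)
      thus "(Q \<longlongrightarrow> 0) at_top" by simp
    qed
  qed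
  thus ?thesis by (simp add: e_def)
qed

lemma set_integrable_power_exp:
  fixes w :: complex assumes w: "Re w > 0"
  shows "set_integrable lborel {0..} (\<lambda>u. of_real u ^ k * exp (- (w * of_real u)))"
proof -
  obtain A where A: "\<And>t. t \<ge> 0 \<Longrightarrow> (0 + t) ^ k * exp (- Re w * t) \<le> A * exp (- (Re w / 2) * t)"
    using power_exp_absorb[of 0 "Re w / 2" "Re w" k] w by auto
  show ?thesis
  proof (rule set_integrable_exp_bound)
    show "Re w / 2 > 0" using w by simp
    show "norm (of_real u ^ k * exp (- (w * of_real u))) \<le> A * exp (- (Re w / 2) * \<bar>u\<bar>)" if "u \<ge> 0" for u
      using A[OF that] that by (simp add: norm_mult norm_power)
  qed (intro continuous_intros)
qed

lemma integral_power_exp: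
  fixes w :: complex assumes w: "Re w > 0"
  shows "(LBINT u:{0..}. of_real u ^ k * exp (- (w * of_real u))) = fact k / w ^ Suc k"
proof -
  obtain P where P: "\<forall>u. (P has_vector_derivative (of_real u ^ k * exp (- (w * of_real u)))) (at u)"
     "P 0 = - fact k / w ^ Suc k" "(P \<longlongrightarrow> 0) at_top"
    using power_exp_primitive[OF w, of k] by (elim exE conjE)
  have fin: "(LBINT u:{0..Y}. of_real u ^ k * exp (- (w * of_real u))) = P Y - P 0" if "Y \<ge> 0" for Y
    unfolding set_lebesgue_integral_def
  proof (rule integral_FTC_Icc[OF that])
    show "continuous_on {0..Y} (\<lambda>u. of_real u ^ k * exp (- (w * of_real u)))" by (intro continuous_intros)
  qed (use P in \<open>auto intro: has_vector_derivative_at_within\<close>)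
  have "((\<lambda>Y. LBINT u:{0..Y}. of_real u ^ k * exp (- (w * of_real u))) \<longlongrightarrow> (LBINT u:{0..}. of_real u ^ k * exp (- (w * of_real u)))) at_top"
    by (intro tendsto_set_lebesgue_integral_at_top set_integrable_power_exp w) auto
  moreover have "((\<lambda>Y. P Y - P 0) \<longlongrightarrow> 0 - P 0) at_top" by (intro tendsto_intros P)
  hence "((\<lambda>Y. LBINT u:{0..Y}. of_real u ^ k * exp (- (w * of_real u))) \<longlongrightarrow> 0 - P 0) at_top"
    by (rule Lim_transform_eventually) (rule eventually_mono[OF eventually_ge_at_top[of 0]], simp add: fin)
  ultimately have "(LBINT u:{0..}. of_real u ^ k * exp (- (w * of_real u))) = 0 - P 0"
    by (rule tendsto_unique[OF trivial_limit_at_top_linorder])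
  thus ?thesis by (simp add: P(2))
qed

lemma integral_power_exp_real:
  fixes \<epsilon> :: real assumes "\<epsilon> > 0"
  shows "set_integrable lborel {0..} (\<lambda>u. u ^ k * exp (- (\<epsilon> * u)))"
    and "(LBINT u:{0..}. u ^ k * exp (- (\<epsilon> * u))) = fact k / \<epsilon> ^ Suc k"
proof -
  have 1: "set_integrable lborel {0..} (\<lambda>u. complex_of_real (u ^ k * exp (- (\<epsilon> * u))))"
    using set_integrable_power_exp[of "of_real \<epsilon>" k] assms by (simp flip: exp_of_real)
  thus "set_integrable lborel {0..} (\<lambda>u. u ^ k * exp (- (\<epsilon> * u)))" 
    by (simp add: set_integrable_def scaleR_conv_of_real complex_of_real_integrable_eq flip: of_real_mult)
  have "(LBINT u:{0..}. complex_of_real (u ^ k * exp (- (\<epsilon> * u)))) = of_real (fact k / \<epsilon> ^ Suc k)"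
    using integral_power_exp[of "of_real \<epsilon>" k] assms by (simp flip: exp_of_real)
  thus "(LBINT u:{0..}. u ^ k * exp (- (\<epsilon> * u))) = fact k / \<epsilon> ^ Suc k"
    unfolding set_integral_complex_of_real of_real_eq_iff .
qed

text \<open>Only the frequency \<open>x n0\<close> resonates with the weight; the other frequencies contribute
  boundedly as \<open>\<epsilon>\<close> tends to 0.\<close>

lemma exponential_sum_integral_lower_bound:
  fixes d :: "nat \<Rightarrow> complex" and x :: "nat \<Rightarrow> real"
  assumes sm: "summable (\<lambda>n. norm (d n))" and g: "g > 0"
    and gap: "\<And>n. n \<noteq> n0 \<Longrightarrow> \<bar>x n - x n0\<bar> \<ge> g" and \<epsilon>: "\<epsilon> > 0"
  shows "norm (LBINT u:{0..}. (\<Sum>n. d n * exp (- (\<i> * of_real (x n * u)))) * of_real u ^ k * exp (\<i> * of_real (x n0 * u)) * exp (- of_real (\<epsilon> * u)))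
     \<ge> norm (d n0) * fact k / \<epsilon> ^ Suc k - fact k / g ^ Suc k * (\<Sum>n. norm (d n))"
proof -
  \<comment> \<open>Damping and frequency difference in one complex rate. At \<open>n0\<close> it is
    \<epsilon>; elsewhere its modulus is at least \<open>g\<close>, whatever \<epsilon> is.\<close>
  define w where "w n = of_real \<epsilon> + \<i> * of_real (x n - x n0)" for n
  have Rew: "Re (w n) > 0" for n using \<epsilon> by (simp add: w_def)
  define h where "h n u = of_real u ^ k * exp (- (w n * of_real u))" for n u
  define f where "f n u = indicator {0..} u *\<^sub>R (d n * h n u)" for n u
  have nh: "norm (h n u) = u ^ k * exp (- (\<epsilon> * u))" if "u \<ge> 0" for n u
    using that by (simp add: h_def norm_mult norm_power w_def)
  have intf: "integrable lborel (f n)" for n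
    using set_integrable_mult_right[OF set_integrable_power_exp[OF Rew[of n], of k], of "d n"]
    unfolding set_integrable_def f_def h_def by simp
  have nf: "norm (f n u) = norm (d n) * (indicator {0..} u *\<^sub>R (u ^ k * exp (- (\<epsilon> * u))))" for n u
    using nh[of u n] by (cases "u \<ge> 0") (simp_all add: f_def norm_mult)
  \<comment> \<open>The norm does not see the oscillation, so these integrals are |d n| times a
    constant, and sum and integral may be interchanged.\<close>
  have inorm: "(\<integral>u. norm (f n u) \<partial>lborel) = norm (d n) * (fact k / \<epsilon> ^ Suc k)" for n
    unfolding nf using integral_power_exp_real(2)[OF \<epsilon>, of k] by (simp add: set_lebesgue_integral_def)
  have smu: "summable (\<lambda>n. norm (f n u))" for u unfolding nf by (intro summable_mult2 sm)
  have sms: "summable (\<lambda>n. \<integral>u. norm (f n u) \<partial>lborel)" unfolding inorm by (intro summable_mult2 sm)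
  define v where "v n = d n * (fact k / w n ^ Suc k)" for n
  have iv: "(\<integral>u. f n u \<partial>lborel) = v n" for n
    using integral_power_exp[OF Rew[of n], of k] unfolding f_def h_def v_def set_lebesgue_integral_def
    by (simp flip: mult_scaleR_right)
  have eq: "(LBINT u:{0..}. (\<Sum>n. d n * exp (- (\<i> * of_real (x n * u)))) * of_real u ^ k * exp (\<i> * of_real (x n0 * u)) * exp (- of_real (\<epsilon> * u))) = (\<integral>u. (\<Sum>n. f n u) \<partial>lborel)"
    unfolding set_lebesgue_integral_def
  proof (rule Bochner_Integration.integral_cong[OF refl])
    fix u :: real
    have s: "summable (\<lambda>n. d n * exp (- (\<i> * of_real (x n * u))))"
      by (rule summable_norm_cancel) (simp add: norm_mult sm)
    define X where "X = indicator {0..} u *\<^sub>R (of_real u ^ k * exp (\<i> * of_real (x n0 * u)) * exp (- complex_of_real (\<epsilon> * u)))"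
    have "f n u = d n * exp (- (\<i> * of_real (x n * u))) * X" for n
      by (simp add: f_def h_def w_def X_def exp_add[symmetric] scaleR_conv_of_real algebra_simps)
    hence "(\<Sum>n. f n u) = (\<Sum>n. d n * exp (- (\<i> * of_real (x n * u)))) * X"
      by (simp only: suminf_mult2[OF s])
    thus "indicator {0..} u *\<^sub>R ((\<Sum>n. d n * exp (- (\<i> * of_real (x n * u)))) * of_real u ^ k * exp (\<i> * of_real (x n0 * u)) * exp (- of_real (\<epsilon> * u))) = (\<Sum>n. f n u)"
      by (simp only: X_def mult.assoc mult_scaleR_right)
  qed
  have "v sums (\<integral>u. (\<Sum>n. f n u) \<partial>lborel)"
    using sums_integral[OF intf AE_I2 sms] smu unfolding iv by blast
  \<comment> \<open>Removing the resonant term leaves a series bounded by powers of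
    \<open>1 / g\<close> instead of \<open>1 / \<epsilon>\<close>.\<close>
  define v' where "v' n = (if n = n0 then 0 else v n)" for n
  have "(\<lambda>n. v n - (if n = n0 then v n0 else 0)) sums ((\<integral>u. (\<Sum>n. f n u) \<partial>lborel) - v n0)"
    by (intro sums_diff \<open>v sums _\<close> sums_single)
  moreover have "(\<lambda>n. v n - (if n = n0 then v n0 else 0)) = v'" by (auto simp: v'_def)
  ultimately have v': "(\<integral>u. (\<Sum>n. f n u) \<partial>lborel) - v n0 = suminf v'" by (simp add: sums_unique)
  have bv: "norm (v' n) \<le> fact k / g ^ Suc k * norm (d n)" for n
  proof (cases "n = n0")
    case False
    have "g \<le> \<bar>Im (w n)\<bar>" using gap[OF False] by (simp add: w_def)
    also have "\<dots> \<le> norm (w n)" by (rule abs_Im_le_cmod)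
    finally have "g \<le> norm (w n)" .
    hence "g ^ Suc k \<le> norm (w n) ^ Suc k" using g by (intro power_mono) auto
    hence "fact k / norm (w n) ^ Suc k \<le> fact k / g ^ Suc k" using g \<open>g \<le> norm (w n)\<close>
      by (intro divide_left_mono mult_pos_pos zero_less_power) auto
    hence "norm (d n) * (fact k / norm (w n) ^ Suc k) \<le> norm (d n) * (fact k / g ^ Suc k)"
      by (intro mult_left_mono) auto
    thus ?thesis using False by (simp add: v'_def v_def norm_mult norm_divide norm_power mult.commute)
  qed (use g in \<open>simp add: v'_def\<close>)
  have "norm (suminf v') \<le> (\<Sum>n. fact k / g ^ Suc k * norm (d n))"
    by (rule norm_suminf_le) (use bv sm in \<open>auto intro: summable_mult\<close>)
  also have "\<dots> = fact k / g ^ Suc k * (\<Sum>n. norm (d n))" by (rule suminf_mult[OF sm])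
  finally have 1: "norm ((\<integral>u. (\<Sum>n. f n u) \<partial>lborel) - v n0) \<le> fact k / g ^ Suc k * (\<Sum>n. norm (d n))"
    unfolding v' .
  have 2: "norm (v n0) = norm (d n0) * fact k / \<epsilon> ^ Suc k"
    using \<epsilon> by (simp add: v_def w_def norm_mult norm_divide norm_power)
  show ?thesis unfolding eq using 1 2 norm_triangle_ineq2[of "v n0" "v n0 - (\<integral>u. (\<Sum>n. f n u) \<partial>lborel)"]
    by (simp add: norm_minus_commute)
qed

section \<open>The completed function\<close>

lemma norm_dirichlet_term:
  assumes "x > 0" shows "norm (c * of_real x powr (- s)) = norm c * x powr (- Re s)"
  using assms by (simp add: norm_mult norm_powr_real_powr)

text \<open>Comparison with a point s' further to the left at which the series converges absolutely.
  The termwise inequality needs \<open>l (Suc n) \<ge> 1\<close>, which holds only from some index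
  on.\<close>

lemma dirichlet_summable:
  assumes l: "frequency_seq l" and s: "ereal (Re s) > abs_conv_abscissa c l"
  shows "summable (\<lambda>n. norm (c (Suc n) * of_real (l (Suc n)) powr (- s)))"
proof -
  obtain s' where s': "summable (\<lambda>n. norm (c (Suc n) * of_real (l (Suc n)) powr (- s')))" "Re s' < Re s"
    using s unfolding abs_conv_abscissa_def by (auto simp: INF_less_iff)
  have pos: "l (Suc n) > 0" for n using l by (simp add: frequency_seq_def)
  have "filterlim (\<lambda>n. l (Suc n)) at_top sequentially"
    using l by (auto simp: frequency_seq_def filterlim_sequentially_Suc)
  hence "eventually (\<lambda>n. l (Suc n) \<ge> 1) sequentially" by (simp add: filterlim_at_top)
  hence "eventually (\<lambda>n. norm (norm (c (Suc n) * of_real (l (Suc n)) powr (- s))) \<le> norm (c (Suc n) * of_real (l (Suc n)) powr (- s'))) sequentially"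
  proof eventually_elim
    case (elim n)
    have "l (Suc n) powr (- Re s) \<le> l (Suc n) powr (- Re s')" using elim s' by (intro powr_mono) auto
    hence "norm (c (Suc n)) * l (Suc n) powr (- Re s) \<le> norm (c (Suc n)) * l (Suc n) powr (- Re s')"
      by (rule mult_left_mono) simp
    thus ?case unfolding norm_dirichlet_term[OF pos, symmetric] by simp
  qed
  from summable_comparison_test_ev[OF this s'(1)] show ?thesis .
qed

lemma cnj_of_real_powr: "x > 0 \<Longrightarrow> cnj (of_real x powr z) = of_real x powr cnj z"
  by (simp add: powr_def Ln_of_real exp_cnj)

lemma dirichlet_series_cnj:
  assumes l: "frequency_seq l" and s: "ereal (Re s) > abs_conv_abscissa a l"
    and b: "\<And>n. n \<ge> 1 \<Longrightarrow> b n = cnj (a n)" and m: "\<And>n. n \<ge> 1 \<Longrightarrow> l n = m n"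
  shows "dirichlet_series b m (cnj s) = cnj (dirichlet_series a l s)"
proof -
  have "(\<lambda>n. cnj (a (Suc n) * of_real (l (Suc n)) powr (- s))) sums cnj (dirichlet_series a l s)"
    unfolding dirichlet_series_def sums_cnj
    by (intro summable_sums summable_norm_cancel[OF dirichlet_summable[OF l s]])
  moreover have "cnj (a (Suc n) * of_real (l (Suc n)) powr (- s)) = b (Suc n) * of_real (m (Suc n)) powr (- cnj s)" for n
  proof -
    have "l (Suc n) > 0" using l by (simp add: frequency_seq_def)
    hence "cnj (of_real (l (Suc n)) powr (- s)) = of_real (l (Suc n)) powr (- cnj s)"
      by (simp add: cnj_of_real_powr)
    thus ?thesis using b[of "Suc n"] m[of "Suc n"] by simp
  qed
  ultimately have "(\<lambda>n. b (Suc n) * of_real (m (Suc n)) powr (- cnj s)) sums cnj (dirichlet_series a l s)" by simp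
  thus ?thesis unfolding dirichlet_series_def[of b m] by (rule sums_unique[symmetric])
qed

text \<open>Here \<chi> is eliminated. Above its singularities it equals \<Gamma>\<phi> by
  continuation from the right and the reflected dual product by continuation from the left;
  conjugate coefficients then express \<psi> through \<phi>. Of the uniform decay of \<chi> only the
  bound 1 is kept.\<close>

lemma class_A_upper_half_plane:
  fixes \<phi> \<psi> :: "complex \<Rightarrow> complex"
  assumes A: "class_A r a l b m \<phi> \<psi>"
    and b: "\<And>n. n \<ge> 1 \<Longrightarrow> b n = cnj (a n)" and lm: "\<And>n. n \<ge> 1 \<Longrightarrow> l n = m n"
  obtains T0 where "T0 > 0"
    "\<And>s. Im s > T0 \<Longrightarrow> Gamma s * \<phi> s = cnj (Gamma (of_real r - cnj s) * \<phi> (of_real r - cnj s))"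
    "\<And>\<sigma>1 \<sigma>2. \<exists>T1. \<forall>\<sigma> t. \<sigma>1 \<le> \<sigma> \<and> \<sigma> \<le> \<sigma>2 \<and> t \<ge> T1 \<longrightarrow> norm (Gamma (Complex \<sigma> t) * \<phi> (Complex \<sigma> t)) \<le> 1"
proof -
  have H: "hecke_pair r a l b m" and P: "continuation_simple_pole r a l \<phi>" and Q: "continuation_simple_pole r b m \<psi>"
    using A by (auto simp: class_A_def)
  have l: "frequency_seq l" using H by (auto simp: hecke_pair_def)
  obtain \<alpha> where \<alpha>: "abs_conv_abscissa a l = ereal \<alpha>" using H by (cases "abs_conv_abscissa a l") (auto simp: hecke_pair_def)
  obtain \<beta> where \<beta>: "abs_conv_abscissa b m = ereal \<beta>" using H by (cases "abs_conv_abscissa b m") (auto simp: hecke_pair_def)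
  from H have "\<exists>chi. chi meromorphic_on UNIV \<and>
     (\<forall>s. ereal (Re s) > abs_conv_abscissa a l \<and> s \<notin> \<int>\<^sub>\<le>\<^sub>0 \<longrightarrow> chi s = Gamma s * dirichlet_series a l s) \<and>
     (\<forall>s. ereal (Re s) < ereal r - abs_conv_abscissa b m \<and> of_real r - s \<notin> \<int>\<^sub>\<le>\<^sub>0 \<longrightarrow>
       chi s = Gamma (of_real r - s) * dirichlet_series b m (of_real r - s)) \<and>
     (\<forall>\<sigma>1 \<sigma>2. uniform_limit {\<sigma>1..\<sigma>2} (\<lambda>t \<sigma>. chi (Complex \<sigma> t)) (\<lambda>_. 0) at_infinity) \<and>
     (\<exists>K. compact K \<and> chi holomorphic_on (- K))"
    unfolding hecke_pair_def by (elim conjE)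
  then obtain chi where "chi meromorphic_on UNIV \<and>
     (\<forall>s. ereal (Re s) > abs_conv_abscissa a l \<and> s \<notin> \<int>\<^sub>\<le>\<^sub>0 \<longrightarrow> chi s = Gamma s * dirichlet_series a l s) \<and>
     (\<forall>s. ereal (Re s) < ereal r - abs_conv_abscissa b m \<and> of_real r - s \<notin> \<int>\<^sub>\<le>\<^sub>0 \<longrightarrow>
       chi s = Gamma (of_real r - s) * dirichlet_series b m (of_real r - s)) \<and>
     (\<forall>\<sigma>1 \<sigma>2. uniform_limit {\<sigma>1..\<sigma>2} (\<lambda>t \<sigma>. chi (Complex \<sigma> t)) (\<lambda>_. 0) at_infinity) \<and>
     (\<exists>K. compact K \<and> chi holomorphic_on (- K))" by (rule exE)
  note chi = this[THEN conjunct2, THEN conjunct1] this[THEN conjunct2, THEN conjunct2, THEN conjunct1]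
    this[THEN conjunct2, THEN conjunct2, THEN conjunct2, THEN conjunct1]
    this[THEN conjunct2, THEN conjunct2, THEN conjunct2, THEN conjunct2]
  have chi1: "chi s = Gamma s * dirichlet_series a l s" if "Re s > \<alpha>" "s \<notin> \<int>\<^sub>\<le>\<^sub>0" for s
    using chi(1) that by (simp add: \<alpha>)
  have chi2: "chi s = Gamma (of_real r - s) * dirichlet_series b m (of_real r - s)"
    if "Re s < r - \<beta>" "of_real r - s \<notin> \<int>\<^sub>\<le>\<^sub>0" for s
    using chi(2) that by (simp add: \<beta>)
  have chi3: "uniform_limit {\<sigma>1..\<sigma>2} (\<lambda>t \<sigma>. chi (Complex \<sigma> t)) (\<lambda>_. 0) at_infinity" for \<sigma>1 \<sigma>2
    using chi(3) by simp
  obtain K where K: "compact K" "chi holomorphic_on (- K)"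
    using chi(4) by (elim conjE exE)
  obtain B where B: "B > 0" "\<And>s. s \<in> K \<Longrightarrow> norm s \<le> B" using compact_imp_bounded[OF K(1)] by (auto simp: bounded_pos)
  \<comment> \<open>A half-plane above a disc that contains all singularities. It is connected, so
    the identity theorem reaches all of it from a small overlap with the region of absolute
    convergence.\<close>
  define U where "U = {s. Im s > B}"
  have U: "open U" "connected U" unfolding U_def
    by (auto simp: open_halfspace_Im_gt convex_connected convex_halfspace_Im_gt)
  have Us: "Im s > 0" if "s \<in> U" for s using that B(1) by (simp add: U_def)
  have chol: "chi holomorphic_on U"
  proof (rule holomorphic_on_subset[OF K(2)])
    show "U \<subseteq> - K"
    proof
      fix s assume "s \<in> U"
      hence "norm s > B" using abs_Im_le_cmod[of s] by (simp add: U_def)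
      thus "s \<in> - K" using B(2)[of s] by auto
    qed
  qed
  note P' = P[unfolded continuation_simple_pole_def] and Q' = Q[unfolded continuation_simple_pole_def]
  have phol: "\<phi> holomorphic_on - {of_real r}" and qhol: "\<psi> holomorphic_on - {of_real r}"
    using P'[THEN conjunct2, THEN conjunct1] Q'[THEN conjunct2, THEN conjunct1] .
  have p: "\<phi> s = dirichlet_series a l s" if "Re s > \<alpha>" for s
    using P'[THEN conjunct1] that by (simp add: \<alpha>)
  have q: "\<psi> s = dirichlet_series b m s" if "Re s > \<beta>" for s
    using Q'[THEN conjunct1] that by (simp add: \<beta>)
  have nr: "s \<noteq> of_real r" if "Im s \<noteq> 0" for s using that by auto
  have c1: "chi s = Gamma s * \<phi> s" if s: "s \<in> U" for s
  proof (rule analytic_continuation_open[of "U \<inter> {s. Re s > \<alpha>}" U chi "\<lambda>s. Gamma s * \<phi> s"])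
    show "open (U \<inter> {s. Re s > \<alpha>})" by (intro open_Int U open_halfspace_Re_gt)
    have "Complex (\<alpha> + 1) (B + 1) \<in> U \<inter> {s. Re s > \<alpha>}" by (simp add: U_def)
    thus "U \<inter> {s. Re s > \<alpha>} \<noteq> {}" by blast
    show "(\<lambda>s. Gamma s * \<phi> s) holomorphic_on U"
      by (intro holomorphic_intros holomorphic_on_subset[OF phol]) 
         (use Us nr in \<open>force simp: notin_nonpos_Ints_Im\<close>)+
    show "chi z = Gamma z * \<phi> z" if "z \<in> U \<inter> {s. Re s > \<alpha>}" for z
      using that chi1[of z] p[of z] Us[of z] by (auto simp: notin_nonpos_Ints_Im)
  qed (use U chol s in auto)
  have c2: "chi s = Gamma (of_real r - s) * \<psi> (of_real r - s)" if s: "s \<in> U" for s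
  proof (rule analytic_continuation_open[of "U \<inter> {s. Re s < r - \<beta>}" U chi "\<lambda>s. Gamma (of_real r - s) * \<psi> (of_real r - s)"])
    show "open (U \<inter> {s. Re s < r - \<beta>})" by (intro open_Int U open_halfspace_Re_lt)
    have "Complex (r - \<beta> - 1) (B + 1) \<in> U \<inter> {s. Re s < r - \<beta>}" by (simp add: U_def)
    thus "U \<inter> {s. Re s < r - \<beta>} \<noteq> {}" by blast
    have "(\<psi> \<circ> (\<lambda>s. of_real r - s)) holomorphic_on U"
      by (intro holomorphic_on_compose holomorphic_intros holomorphic_on_subset[OF qhol])
         (use Us in force)
    thus "(\<lambda>s. Gamma (of_real r - s) * \<psi> (of_real r - s)) holomorphic_on U"
      by (intro holomorphic_intros) (use Us in \<open>force simp: notin_nonpos_Ints_Im o_def\<close>)+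
    show "chi z = Gamma (of_real r - z) * \<psi> (of_real r - z)" if "z \<in> U \<inter> {s. Re s < r - \<beta>}" for z
      using that chi2[of z] q[of "of_real r - z"] Us[of z] by (auto simp: notin_nonpos_Ints_Im)
  qed (use U chol s in auto)
  \<comment> \<open>Conjugate coefficients give this where both series converge absolutely. The open
    lower half-plane is connected and avoids the possible pole at \<open>r\<close>.\<close>
  have c3: "\<psi> s = cnj (\<phi> (cnj s))" if s: "Im s < 0" for s
  proof (rule analytic_continuation_open[of "{s. Im s < 0} \<inter> {s. Re s > max \<alpha> \<beta>}" "{s. Im s < 0}" \<psi> "\<lambda>s. cnj (\<phi> (cnj s))"])
    show "open ({s. Im s < 0} \<inter> {s. Re s > max \<alpha> \<beta>})" by (intro open_Int open_halfspace_Re_gt open_halfspace_Im_lt)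
    have "Complex (max \<alpha> \<beta> + 1) (-1) \<in> {s. Im s < 0} \<inter> {s. Re s > max \<alpha> \<beta>}" by (auto simp: max_def)
    thus "{s. Im s < 0} \<inter> {s. Re s > max \<alpha> \<beta>} \<noteq> {}" by blast
    show "\<psi> holomorphic_on {s. Im s < 0}" by (rule holomorphic_on_subset[OF qhol]) auto
    have "\<phi> holomorphic_on cnj ` {s. Im s < 0}"
      by (rule holomorphic_on_subset[OF phol]) (auto simp: complex_eq_iff)
    hence "(cnj \<circ> \<phi> \<circ> cnj) holomorphic_on {s. Im s < 0}"
      by (rule holomorphic_on_compose_cnj_cnj) (rule open_halfspace_Im_lt)
    thus "(\<lambda>s. cnj (\<phi> (cnj s))) holomorphic_on {s. Im s < 0}" by (simp add: o_def)
    show "\<psi> z = cnj (\<phi> (cnj z))" if z: "z \<in> {s. Im s < 0} \<inter> {s. Re s > max \<alpha> \<beta>}" for z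
      using z q[of z] p[of "cnj z"] dirichlet_series_cnj[where s = "cnj z", OF l _ b lm] by (simp add: \<alpha>)
  qed (use s in \<open>auto simp: open_halfspace_Im_lt convex_connected convex_halfspace_Im_lt\<close>)
  show ?thesis
  proof (rule that[OF B(1)])
    fix s assume "Im s > B"
    hence s: "s \<in> U" by (simp add: U_def)
    have "Gamma s * \<phi> s = Gamma (of_real r - s) * \<psi> (of_real r - s)" using c1[OF s] c2[OF s] by simp
    also have "\<psi> (of_real r - s) = cnj (\<phi> (of_real r - cnj s))" using c3[of "of_real r - s"] Us[OF s] by simp
    finally show "Gamma s * \<phi> s = cnj (Gamma (of_real r - cnj s) * \<phi> (of_real r - cnj s))"
      by (simp add: cnj_Gamma)
  next
    fix \<sigma>1 \<sigma>2
    have "eventually (\<lambda>t. \<forall>\<sigma>\<in>{\<sigma>1..\<sigma>2}. dist (chi (Complex \<sigma> t)) 0 < 1) at_infinity"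
      using uniform_limitD[OF chi3, of 1] by simp
    hence "\<exists>T. \<forall>t. T \<le> norm t \<longrightarrow> (\<forall>\<sigma>\<in>{\<sigma>1..\<sigma>2}. norm (chi (Complex \<sigma> t)) < 1)"
      by (simp add: eventually_at_infinity)
    then obtain T where "\<forall>t. T \<le> norm t \<longrightarrow> (\<forall>\<sigma>\<in>{\<sigma>1..\<sigma>2}. norm (chi (Complex \<sigma> t)) < 1)"
      by (rule exE)
    hence T: "norm (chi (Complex \<sigma> t)) < 1" if "norm t \<ge> T" "\<sigma> \<in> {\<sigma>1..\<sigma>2}" for t \<sigma>
      using that by blast
    show "\<exists>T1. \<forall>\<sigma> t. \<sigma>1 \<le> \<sigma> \<and> \<sigma> \<le> \<sigma>2 \<and> t \<ge> T1 \<longrightarrow> norm (Gamma (Complex \<sigma> t) * \<phi> (Complex \<sigma> t)) \<le> 1"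
    proof (intro exI[of _ "max T (B + 1)"] allI impI)
      fix \<sigma> t assume *: "\<sigma>1 \<le> \<sigma> \<and> \<sigma> \<le> \<sigma>2 \<and> t \<ge> max T (B + 1)"
      have "Complex \<sigma> t \<in> U" using * by (simp add: U_def)
      from c1[OF this] T[of t \<sigma>] * abs_ge_self[of t] show "norm (Gamma (Complex \<sigma> t) * \<phi> (Complex \<sigma> t)) \<le> 1" by auto
    qed
  qed
qed

text \<open>The mere bound |X| \<le> 1 is upgraded to the decay exp(-pi t/2), up to a power of t.
  The strip is symmetric about Re s = r/2: on its right edge \<phi> is bounded and \<Gamma> is
  known, on its left edge the functional equation gives the same modulus, and Phragmen-Lindelof
  interpolates.\<close>

lemma completed_function_growth:
  fixes \<phi> :: "complex \<Rightarrow> complex"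
  assumes phol: "\<phi> holomorphic_on - {of_real r}" and r: "r > 0" and T0: "T0 > 0"
    and fe: "\<And>s. Im s > T0 \<Longrightarrow> Gamma s * \<phi> s = cnj (Gamma (of_real r - cnj s) * \<phi> (of_real r - cnj s))"
    and lim: "\<And>\<sigma>1 \<sigma>2. \<exists>T1. \<forall>\<sigma> t. \<sigma>1 \<le> \<sigma> \<and> \<sigma> \<le> \<sigma>2 \<and> t \<ge> T1 \<longrightarrow> norm (Gamma (Complex \<sigma> t) * \<phi> (Complex \<sigma> t)) \<le> 1"
    and right: "\<And>t. norm (\<phi> (Complex (1/2 + real N) t)) \<le> S"
    and N: "r < 1/2 + real N"
  obtains T C where "T > T0" "T \<ge> 1" "C > 0"
    "\<And>\<sigma> t. \<lbrakk>r - (1/2 + real N) \<le> \<sigma>; \<sigma> \<le> 1/2 + real N; t \<ge> T\<rbrakk>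
       \<Longrightarrow> norm (Gamma (Complex \<sigma> t) * \<phi> (Complex \<sigma> t)) \<le> C * (real N + 1 + t) ^ N * exp (- (pi * t / 2))"
proof -
  define c where "c = 1/2 + real N"
  define X where "X s = Gamma s * \<phi> s" for s
  have S: "S \<ge> 0" using order_trans[OF norm_ge_zero right] .
  obtain T1 where T1: "\<And>\<sigma> t. \<lbrakk>r - c \<le> \<sigma>; \<sigma> \<le> c; t \<ge> T1\<rbrakk> \<Longrightarrow> norm (X (Complex \<sigma> t)) \<le> 1"
    using lim[of "r - c" c] by (auto simp: X_def)
  define T where "T = max (max T1 (T0 + 1)) 1"
  have T: "T \<ge> T1" "T > T0" "T \<ge> 1" by (auto simp: T_def)
  define f where "f s = X s * exp (- (\<i> * of_real pi / 2 * s)) / s ^ N" for s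
  have nf: "norm (f (Complex \<sigma> t)) = norm (X (Complex \<sigma> t)) * exp (pi * t / 2) / norm (Complex \<sigma> t) ^ N" for \<sigma> t
    by (simp add: f_def norm_mult norm_divide norm_power norm_exp_i_pi_half)
  have hol: "f holomorphic_on {s. Im s > T0}" unfolding f_def X_def
    by (intro holomorphic_intros holomorphic_on_subset[OF phol]) (use T0 in \<open>auto simp: notin_nonpos_Ints_Im\<close>)
  have ge1: "norm (Complex \<sigma> t) \<ge> t" if "t \<ge> 1" for \<sigma> t using abs_Im_le_cmod[of "Complex \<sigma> t"] that by simp
  define M where "M = S * sqrt (2 * pi) * (real N + 2) ^ N"
  have edge: "norm (f (Complex \<sigma> t)) \<le> M" if X: "norm (X (Complex \<sigma> t)) = norm (X (Complex c t))" and t: "t \<ge> T" for \<sigma> t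
  proof -
    have t1: "t \<ge> 1" using t T by simp
    have "norm (X (Complex c t)) \<le> (sqrt (2 * pi) * (real N + 1 + \<bar>t\<bar>) ^ N * exp (- (pi * \<bar>t\<bar> / 2))) * S"
      unfolding X_def norm_mult c_def using norm_Gamma_half_int_le[of N t] right[of t] by (intro mult_mono) auto
    also have "\<dots> \<le> (sqrt (2 * pi) * ((real N + 2) * t) ^ N * exp (- (pi * t / 2))) * S"
    proof (intro mult_right_mono mult_mono mult_left_mono power_mono S)
      show "real N + 1 + \<bar>t\<bar> \<le> (real N + 2) * t" using t1 mult_left_mono[of 1 t "real N + 1"] by (simp add: algebra_simps)
    qed (use t1 in auto)
    also have "\<dots> = M * t ^ N * exp (- (pi * t / 2))" by (simp add: M_def power_mult_distrib)
    finally have "norm (f (Complex \<sigma> t)) \<le> (M * t ^ N * exp (- (pi * t / 2))) * exp (pi * t / 2) / t ^ N"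
      unfolding nf X using t1 ge1[OF t1] S by (intro frac_le mult_mono power_mono) (auto simp: M_def)
    also have "\<dots> = M" using t1 by (simp add: exp_minus)
    finally show ?thesis .
  qed
  obtain M' where M': "M' > 0" "\<And>\<sigma> t. \<lbrakk>r - c \<le> \<sigma>; \<sigma> \<le> c; t \<ge> T\<rbrakk> \<Longrightarrow> norm (f (Complex \<sigma> t)) \<le> M'"
  proof (rule phragmen_lindelof_half_strip[OF hol T(2), of "r - c" c 1 "pi/2" M])
    fix \<sigma> t assume s: "r - c \<le> \<sigma>" "\<sigma> \<le> c" "t \<ge> T"
    have "norm (f (Complex \<sigma> t)) \<le> 1 * exp (pi * t / 2) / 1"
      unfolding nf using s T T1[of \<sigma> t] ge1[of t \<sigma>]
      by (intro frac_le mult_mono) (auto intro!: one_le_power)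
    thus "norm (f (Complex \<sigma> t)) \<le> 1 * exp (pi / 2 * t)" by (simp add: mult_ac)
  next
    fix t assume t: "t \<ge> T"
    show "norm (f (Complex c t)) \<le> M" by (rule edge[OF HOL.refl t])
    have "X (Complex (r - c) t) = cnj (X (of_real r - cnj (Complex (r - c) t)))"
      unfolding X_def using t T by (intro fe) simp
    also have "of_real r - cnj (Complex (r - c) t) = Complex c t" by (simp add: complex_eq_iff)
    finally have "norm (X (Complex (r - c) t)) = norm (X (Complex c t))" by simp
    from edge[OF this t] show "norm (f (Complex (r - c) t)) \<le> M" .
  qed auto
  show ?thesis
  proof (rule that[OF T(2,3) M'(1)])
    fix \<sigma> t assume s: "r - (1/2 + real N) \<le> \<sigma>" "\<sigma> \<le> 1/2 + real N" "t \<ge> T"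
    have t1: "t \<ge> 1" using s T by simp
    have le: "norm (Complex \<sigma> t) \<le> real N + 1 + t" using cmod_le[of "Complex \<sigma> t"] s r t1 by simp
    have pos: "norm (Complex \<sigma> t) > 0" using ge1[OF t1, of \<sigma>] t1 by linarith
    have "norm (X (Complex \<sigma> t)) = norm (f (Complex \<sigma> t)) * norm (Complex \<sigma> t) ^ N * exp (- (pi * t / 2))"
      using pos by (simp add: nf exp_minus)
    also have "\<dots> \<le> M' * (real N + 1 + t) ^ N * exp (- (pi * t / 2))"
      using le M' s t1 by (intro mult_right_mono mult_mono power_mono) (auto simp: c_def)
    finally show "norm (Gamma (Complex \<sigma> t) * \<phi> (Complex \<sigma> t)) \<le> M' * (real N + 1 + t) ^ N * exp (- (pi * t / 2))"
      by (simp add: X_def)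
  qed
qed

text \<open>Mellin inversion on the line \<open>Re s = 1/2 + N\<close>, moved to \<open>Re s = r/2\<close> only in the upper
  part of the plane; the rest of the integral stays bounded as \<open>\<theta>\<close> tends to \<open>pi/2\<close>.\<close>

lemma theta_critical_line_integral:
  fixes \<phi> :: "complex \<Rightarrow> complex"
  assumes phol: "\<phi> holomorphic_on - {of_real r}" and r: "r > 0" and T0: "T0 > 0"
    and l: "\<And>n. l (Suc n) > 0"
    and sm: "summable (\<lambda>n. norm (a (Suc n) * of_real (l (Suc n)) powr (- of_real (1/2 + real N))))"
    and ser: "\<And>t. \<phi> (Complex (1/2 + real N) t) = dirichlet_series a l (Complex (1/2 + real N) t)"
    and N: "r < 1/2 + real N"
    and T: "T > T0" "T \<ge> 1" and C: "C > 0"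
    and growth: "\<And>\<sigma> t. \<lbrakk>r - (1/2 + real N) \<le> \<sigma>; \<sigma> \<le> 1/2 + real N; t \<ge> T\<rbrakk>
       \<Longrightarrow> norm (Gamma (Complex \<sigma> t) * \<phi> (Complex \<sigma> t)) \<le> C * (real N + 1 + t) ^ N * exp (- (pi * t / 2))"
  obtains A B where "A > 0" "B > 0"
    "\<And>\<theta>. \<lbrakk>0 < \<theta>; \<theta> < pi / 2\<rbrakk> \<Longrightarrow>
       set_integrable lborel {T..} (\<lambda>t. Gamma (Complex (r/2) t) * \<phi> (Complex (r/2) t) * exp (- (Complex (r/2) t * (\<i> * of_real \<theta>))))"
    "\<And>\<theta>. \<lbrakk>0 < \<theta>; \<theta> < pi / 2\<rbrakk> \<Longrightarrow>
       norm (LBINT t:{T..}. Gamma (Complex (r/2) t) * \<phi> (Complex (r/2) t) * exp (- (Complex (r/2) t * (\<i> * of_real \<theta>))))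
         \<le> A * norm (Theta (exp (\<i> * of_real \<theta>)) a l) + B"
proof -
  define c where "c = 1/2 + real N"
  define G where "G t = Gamma (Complex c t)" for t
  define d where "d n = norm (a (Suc n) * of_real (l (Suc n)) powr (- of_real c))" for n
  define S where "S = (\<Sum>n. d n)"
  have smd: "summable d" using sm by (simp only: d_def[abs_def] c_def)
  have nd: "norm (a (Suc n) * of_real (l (Suc n)) powr (- Complex c t)) = d n" for n t
    by (simp add: d_def norm_dirichlet_term[OF l])
  have G: "exp_decay (pi / 2) G" unfolding G_def c_def by (rule exp_decay_Gamma)
  obtain K where K: "\<And>w. \<bar>Im w\<bar> < pi / 2 \<Longrightarrow> (\<integral>t. G t * exp (- (Complex c t * w)) \<partial>lborel) = K * exp (- exp w)"
    unfolding G_def c_def using Mellin_Gamma_exp[of N] by blast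
  have smt: "summable (\<lambda>n. a (Suc n) * of_real (l (Suc n)) powr (- Complex c t))" for t
    by (rule summable_norm_cancel) (simp add: nd smd)
  have phi: "\<phi> (Complex c t) = (\<Sum>n. a (Suc n) * of_real (l (Suc n)) powr (- Complex c t))" for t
    using ser[of t] by (simp add: c_def dirichlet_series_def)
  have phiS: "norm (\<phi> (Complex c t)) \<le> S" for t unfolding phi S_def by (rule norm_suminf_le) (auto simp: nd smd)
  define F where "F \<theta> s = Gamma s * \<phi> s * exp (- (s * (\<i> * of_real \<theta>)))" for \<theta> s
  have Fhol: "F \<theta> holomorphic_on {s. Im s > T0}" for \<theta> unfolding F_def
    by (intro holomorphic_intros holomorphic_on_subset[OF phol]) (use T0 in \<open>auto simp: notin_nonpos_Ints_Im\<close>)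
  have vcont: "continuous_on UNIV (\<lambda>t. \<phi> (Complex c t))"
    by (rule continuous_on_compose2[OF holomorphic_on_imp_continuous_on[OF phol]])
       (use N in \<open>auto simp: c_def complex_eq_iff intro!: continuous_intros\<close>)
  have Fcont: "continuous_on {T..} (\<lambda>t. F \<theta> (Complex \<sigma> t))" for \<theta> \<sigma>
    by (rule continuous_on_compose2[OF holomorphic_on_imp_continuous_on[OF Fhol]])
       (use T in \<open>auto intro!: continuous_intros\<close>)
  have nE: "norm (exp (- (Complex \<sigma> t * (\<i> * of_real \<theta>)))) = exp (t * \<theta>)" for \<sigma> t \<theta> by simp
  have mellin: "(\<integral>t. F \<theta> (Complex c t) \<partial>lborel) = K * Theta (exp (\<i> * of_real \<theta>)) a l"
    and Fint: "integrable lborel (\<lambda>t. F \<theta> (Complex c t))" if th: "0 < \<theta>" "\<theta> < pi / 2" for \<theta>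
  proof -
    \<comment> \<open>With this choice \<open>exp (w n)\<close> is \<open>l (Suc n)\<close> times
      exp(\<i>\<theta>), so the inverse Mellin transforms are the terms of \<Theta> at
      exp(\<i>\<theta>).\<close>
    define w where "w n = of_real (ln (l (Suc n))) + \<i> * of_real \<theta>" for n
    have w: "\<bar>Im (w n)\<bar> < pi / 2" for n using th by (simp add: w_def)
    define f where "f n t = a (Suc n) * (G t * exp (- (Complex c t * w n)))" for n t
    define H where "H t = norm (G t * exp (- (Complex c t * (\<i> * of_real \<theta>))))" for t
    have fe: "f n t = (a (Suc n) * of_real (l (Suc n)) powr (- Complex c t)) * (G t * exp (- (Complex c t * (\<i> * of_real \<theta>))))" for n t
    proof -
      have "- (Complex c t * w n) = - Complex c t * Ln (of_real (l (Suc n))) + - (Complex c t * (\<i> * of_real \<theta>))"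
        using l[of n] by (simp add: w_def Ln_of_real algebra_simps)
      hence "exp (- (Complex c t * w n)) = of_real (l (Suc n)) powr (- Complex c t) * exp (- (Complex c t * (\<i> * of_real \<theta>)))"
        using l[of n] by (simp only: exp_add powr_def) simp
      thus ?thesis by (simp only: f_def mult_ac)
    qed
    have nf: "norm (f n t) = d n * H t" for n t unfolding fe H_def by (simp add: norm_mult nd[unfolded norm_mult])
    have Hint: "integrable lborel H" unfolding H_def
      by (rule integrable_norm[OF exp_decay_integrable[OF exp_decay_kernel[OF G]]]) (use th in auto)
    have intf: "integrable lborel (f n)" for n unfolding f_def
      by (intro integrable_mult_right exp_decay_integrable[OF exp_decay_kernel[OF G w]]) (use w in simp)
    have ae: "AE t in lborel. summable (\<lambda>n. norm (f n t))" unfolding nf by (intro AE_I2 summable_mult2 smd)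
    have sms: "summable (\<lambda>n. \<integral>t. norm (f n t) \<partial>lborel)" unfolding nf by (simp add: summable_mult2 smd)
    have ew: "exp (w n) = of_real (l (Suc n)) * exp (\<i> * of_real \<theta>)" for n
      using l[of n] by (simp add: w_def exp_add exp_of_real)
    have sumf: "(\<Sum>n. f n t) = F \<theta> (Complex c t)" for t
      unfolding fe suminf_mult2[OF smt, symmetric] phi[symmetric] F_def G_def by (simp add: mult_ac)
    have i1: "(\<integral>t. f n t \<partial>lborel) = K * (a (Suc n) * exp (- of_real (l (Suc n)) * exp (\<i> * of_real \<theta>)))" for n
      unfolding f_def using K[OF w[of n]] by (simp add: ew)
    show "integrable lborel (\<lambda>t. F \<theta> (Complex c t))"
      using integrable_suminf[OF intf ae sms] by (simp add: sumf)
    have "(\<lambda>n. K * (a (Suc n) * exp (- of_real (l (Suc n)) * exp (\<i> * of_real \<theta>)))) sums (\<integral>t. F \<theta> (Complex c t) \<partial>lborel)"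
      using sums_integral[OF intf ae sms] by (simp add: sumf i1)
    note s1 = this
    show "(\<integral>t. F \<theta> (Complex c t) \<partial>lborel) = K * Theta (exp (\<i> * of_real \<theta>)) a l"
    \<comment> \<open>Summability of the terms of \<Theta> is read off from the series multiplied by
      \<open>K\<close>, which requires \<open>K \<noteq> 0\<close>; for \<open>K = 0\<close> both
      sides vanish.\<close>
    proof (cases "K = 0")
      case False
      have "summable (\<lambda>n. a (Suc n) * exp (- of_real (l (Suc n)) * exp (\<i> * of_real \<theta>)))"
        using sums_summable[OF s1] False by (subst (asm) summable_cmult_iff) auto
      from suminf_mult[OF this, of K] show ?thesis using sums_unique[OF s1] by (simp add: Theta_def)
    qed (use sums_unique[OF s1] in simp)
  qed
  have T1: "T \<ge> 0" using T by simp
  \<comment> \<open>Below height \<open>T\<close> the kernel exp(t\<theta>) is at most exp(T pi/2),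
    even for t tending to minus infinity, where \<Gamma> supplies the decay; hence a bound free of
    \<theta>.\<close>
  define B1 where "B1 = (\<integral>t. indicator {..T} t * (S * norm (G t) * exp (T * pi / 2)) \<partial>lborel)"
  have B1int: "integrable lborel (\<lambda>t. indicator {..T} t * (S * norm (G t) * exp (T * pi / 2)))"
    using integrable_mult_indicator[OF _ integrable_mult_right[OF integrable_mult_left[OF integrable_norm[OF exp_decay_integrable[OF G]]]], of "{..T}" S "exp (T * pi / 2)"]
    by (simp add: mult.assoc)
  have low: "norm (LBINT t:{..<T}. F \<theta> (Complex c t)) \<le> B1" if th: "0 < \<theta>" "\<theta> < pi / 2" for \<theta>
    unfolding set_lebesgue_integral_def B1_def
  proof (rule Bochner_Integration.integral_norm_bound_integral)
    show "integrable lborel (\<lambda>t. indicator {..<T} t *\<^sub>R F \<theta> (Complex c t))"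
      using Fint[OF th] by (intro integrable_mult_indicator) auto
    show "norm (indicator {..<T} t *\<^sub>R F \<theta> (Complex c t)) \<le> indicator {..T} t * (S * norm (G t) * exp (T * pi / 2))" for t
    proof (cases "t < T")
      case True
      have "t * \<theta> \<le> T * (pi / 2)"
      proof (cases "t \<ge> 0")
        case True thus ?thesis using \<open>t < T\<close> th by (intro mult_mono) auto
      next
        case False
        hence "t * \<theta> \<le> 0" using th by (intro mult_nonpos_nonneg) auto
        also have "0 \<le> T * (pi / 2)" using T1 by simp
        finally show ?thesis .
      qed
      hence "norm (F \<theta> (Complex c t)) \<le> norm (G t) * S * exp (T * pi / 2)"
        unfolding F_def norm_mult nE G_def using phiS[of t] order_trans[OF norm_ge_zero phiS[of t]]
        by (intro mult_mono mult_nonneg_nonneg) auto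
      thus ?thesis using True by (simp add: mult_ac)
    qed (use order_trans[OF norm_ge_zero phiS[of t]] in \<open>simp add: indicator_def\<close>)
  qed (rule B1int)
  \<comment> \<open>Bound on the horizontal edge at height \<open>T\<close>, independent of \<theta>
    because the remaining factor exp(-(pi/2-\<theta>)T) is at most 1.\<close>
  define E where "E = C * (real N + 1 + T) ^ N"
  have EC: "E \<ge> 0" using C T1 by (simp add: E_def)
  have Fb: "norm (F \<theta> (Complex \<sigma> t)) \<le> C * ((real N + 1 + t) ^ N * exp (- (pi / 2 - \<theta>) * t))"
    if "r - c \<le> \<sigma>" "\<sigma> \<le> c" "t \<ge> T" for \<theta> \<sigma> t
  proof -
    have "norm (F \<theta> (Complex \<sigma> t)) \<le> (C * (real N + 1 + t) ^ N * exp (- (pi * t / 2))) * exp (t * \<theta>)"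
      unfolding F_def norm_mult[of "Gamma _ * _"] nE using growth[of \<sigma> t] that by (intro mult_right_mono) (auto simp: c_def)
    also have "\<dots> = C * ((real N + 1 + t) ^ N * (exp (- (pi * t / 2)) * exp (t * \<theta>)))" by (simp only: mult_ac)
    also have "exp (- (pi * t / 2)) * exp (t * \<theta>) = exp (- (pi / 2 - \<theta>) * t)" by (simp add: mult_exp_exp algebra_simps)
    finally show ?thesis .
  qed
  have rc: "r - c \<le> r / 2" "r / 2 \<le> c" using N r by (auto simp: c_def)
  \<comment> \<open>The rate degenerates as \<theta> approaches pi/2. This is harmless: it serves
    only integrability and the vanishing of the top edge for each fixed \<theta>.\<close>
  have Fb2: "\<exists>A. \<exists>\<delta>>0. \<forall>\<sigma> t. r - c \<le> \<sigma> \<and> \<sigma> \<le> c \<and> t \<ge> T \<longrightarrow> norm (F \<theta> (Complex \<sigma> t)) \<le> A * exp (- \<delta> * \<bar>t\<bar>)"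
    if th: "\<theta> < pi / 2" for \<theta>
  proof -
    have d: "(pi / 2 - \<theta>) / 2 > 0" "(pi / 2 - \<theta>) / 2 < pi / 2 - \<theta>" using th by auto
    obtain A where A: "A > 0" "\<And>t. t \<ge> 0 \<Longrightarrow> (real N + 1 + t) ^ N * exp (- (pi / 2 - \<theta>) * t) \<le> A * exp (- ((pi / 2 - \<theta>) / 2) * t)"
      using power_exp_absorb[of "real N + 1", OF _ d(2), of N] by auto
    show ?thesis
    proof (rule exI[of _ "C * A"], rule exI[of _ "(pi / 2 - \<theta>) / 2"], intro conjI allI impI d(1))
      fix \<sigma> t assume s: "r - c \<le> \<sigma> \<and> \<sigma> \<le> c \<and> t \<ge> T"
      hence "norm (F \<theta> (Complex \<sigma> t)) \<le> C * ((real N + 1 + t) ^ N * exp (- (pi / 2 - \<theta>) * t))" using Fb by blast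
      also have "\<dots> \<le> C * (A * exp (- ((pi / 2 - \<theta>) / 2) * t))" using A(2)[of t] s T1 C by (intro mult_left_mono) auto
      finally show "norm (F \<theta> (Complex \<sigma> t)) \<le> C * A * exp (- ((pi / 2 - \<theta>) / 2) * \<bar>t\<bar>)" using s T1 by (simp add: mult.assoc)
    qed
  qed
  have Fset: "set_integrable lborel {T..} (\<lambda>t. F \<theta> (Complex \<sigma> t))" if th: "\<theta> < pi / 2" and s: "r - c \<le> \<sigma>" "\<sigma> \<le> c" for \<theta> \<sigma>
  proof -
    obtain A \<delta> where A: "\<delta> > 0" "\<forall>\<sigma> t. r - c \<le> \<sigma> \<and> \<sigma> \<le> c \<and> t \<ge> T \<longrightarrow> norm (F \<theta> (Complex \<sigma> t)) \<le> A * exp (- \<delta> * \<bar>t\<bar>)"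
      using Fb2[OF th] by blast
    show ?thesis by (rule set_integrable_exp_bound[OF Fcont A(1)]) (use A(2) s in blast)
  qed
  have up: "norm ((LBINT t:{T..}. F \<theta> (Complex (r/2) t)) - (LBINT t:{T..}. F \<theta> (Complex c t))) \<le> (c - r/2) * E"
    if th: "0 < \<theta>" "\<theta> < pi / 2" for \<theta>
  proof -
    obtain A \<delta> where A: "\<delta> > 0" "\<forall>\<sigma> t. r - c \<le> \<sigma> \<and> \<sigma> \<le> c \<and> t \<ge> T \<longrightarrow> norm (F \<theta> (Complex \<sigma> t)) \<le> A * exp (- \<delta> * \<bar>t\<bar>)"
      using Fb2[OF th(2)] by blast
    show ?thesis
    proof (rule contour_shift_half_line[OF Fhol T(1) rc(2) Fset[OF th(2) rc] Fset[OF th(2)]])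
      show "norm (F \<theta> (Complex \<sigma> T)) \<le> E" if "r / 2 \<le> \<sigma>" "\<sigma> \<le> c" for \<sigma>
      proof -
        have "norm (F \<theta> (Complex \<sigma> T)) \<le> C * ((real N + 1 + T) ^ N * exp (- (pi / 2 - \<theta>) * T))" using that rc by (intro Fb) auto
        also have "\<dots> \<le> C * ((real N + 1 + T) ^ N * 1)" using C T1 th by (intro mult_left_mono) (auto simp: mult_nonpos_nonneg)
        finally show ?thesis by (simp add: E_def)
      qed
      show "norm (F \<theta> (Complex \<sigma> t)) \<le> A * exp (- \<delta> * \<bar>t\<bar>)" if "r / 2 \<le> \<sigma>" "\<sigma> \<le> c" "t \<ge> T" for \<sigma> t
        using A(2) that rc by auto
      show "((\<lambda>t. A * exp (- \<delta> * \<bar>t\<bar>)) \<longlongrightarrow> 0) at_top" using A(1) by real_asymp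
    qed (use rc in auto)
  qed
  show ?thesis
  proof (rule that[of "norm K + 1" "B1 + (c - r/2) * E + 1"])
    \<comment> \<open>Any admissible angle would do in place of pi/4, since \<open>B1\<close> bounds
      a norm.\<close>
    have "B1 \<ge> 0" using low[of "pi / 4"] pi_gt_zero order_trans[OF norm_ge_zero] by auto
    thus "B1 + (c - r/2) * E + 1 > 0" using rc EC by (intro add_nonneg_pos add_nonneg_nonneg mult_nonneg_nonneg) auto
    fix \<theta> :: real assume th: "0 < \<theta>" "\<theta> < pi / 2"
    show "set_integrable lborel {T..} (\<lambda>t. Gamma (Complex (r/2) t) * \<phi> (Complex (r/2) t) * exp (- (Complex (r/2) t * (\<i> * of_real \<theta>))))"
      using Fset[OF th(2) rc] by (simp only: F_def)
    have "(\<integral>t. F \<theta> (Complex c t) \<partial>lborel) = (LBINT t:UNIV. F \<theta> (Complex c t))" by (simp add: set_lebesgue_integral_def)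
    also have "UNIV = {..<T} \<union> {T..}" by auto
    also have "(LBINT t:{..<T} \<union> {T..}. F \<theta> (Complex c t)) = (LBINT t:{..<T}. F \<theta> (Complex c t)) + (LBINT t:{T..}. F \<theta> (Complex c t))"
      by (rule set_integral_Un) (use Fint[OF th] in \<open>auto simp: set_integrable_def intro!: integrable_mult_indicator\<close>)
    finally have "(LBINT t:{T..}. F \<theta> (Complex c t)) = K * Theta (exp (\<i> * of_real \<theta>)) a l - (LBINT t:{..<T}. F \<theta> (Complex c t))"
      by (simp add: mellin[OF th])
    hence "norm (LBINT t:{T..}. F \<theta> (Complex c t)) \<le> norm K * norm (Theta (exp (\<i> * of_real \<theta>)) a l) + B1"
      using low[OF th] norm_triangle_ineq4[of "K * Theta (exp (\<i> * of_real \<theta>)) a l" "LBINT t:{..<T}. F \<theta> (Complex c t)"]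
      by (simp add: norm_mult)
    moreover have "norm (LBINT t:{T..}. F \<theta> (Complex (r/2) t)) \<le> (c - r/2) * E + norm (LBINT t:{T..}. F \<theta> (Complex c t))"
      using up[OF th] norm_triangle_ineq2[of "LBINT t:{T..}. F \<theta> (Complex (r/2) t)" "LBINT t:{T..}. F \<theta> (Complex c t)"] by simp
    ultimately have "norm (LBINT t:{T..}. F \<theta> (Complex (r/2) t)) \<le> (norm K + 1) * norm (Theta (exp (\<i> * of_real \<theta>)) a l) + (B1 + (c - r/2) * E + 1)"
      unfolding distrib_right mult_1_left using norm_ge_zero[of "Theta (exp (\<i> * of_real \<theta>)) a l"] by linarith
    thus "norm (LBINT t:{T..}. Gamma (Complex (r/2) t) * \<phi> (Complex (r/2) t) * exp (- (Complex (r/2) t * (\<i> * of_real \<theta>))))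
         \<le> (norm K + 1) * norm (Theta (exp (\<i> * of_real \<theta>)) a l) + (B1 + (c - r/2) * E + 1)"
      by (simp only: F_def)
  qed (simp add: add_nonneg_pos)
qed

section \<open>The weighted integral on the critical line\<close>

text \<open>On Re s = c the integrand is a damped exponential sum with one resonant frequency. For
  \<epsilon> > 0 the damping beats the polynomial growth of \<phi>, which allows the shift to
  \<open>\<alpha>\<close>; on the bottom edge the damping factor has modulus 1, so the error does
  not grow as \<epsilon> tends to 0.\<close>

lemma weighted_line_integral_lower_bound:
  fixes \<phi> :: "complex \<Rightarrow> complex"
  assumes phol: "\<phi> holomorphic_on {s. Im s > T0}" and T: "T > T0" "T \<ge> 0" and \<alpha>: "0 \<le> \<alpha>" "\<alpha> \<le> c"
    and growth: "\<And>\<sigma> t. \<lbrakk>\<alpha> \<le> \<sigma>; \<sigma> \<le> c; t \<ge> T\<rbrakk> \<Longrightarrow> norm (\<phi> (Complex \<sigma> t)) \<le> P * (Q + t) ^ M" and P: "P \<ge> 0" "Q \<ge> 0"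
    and sm: "summable (\<lambda>n. norm (d n))"
    and ser: "\<And>u. \<phi> (Complex c (T + u)) = (\<Sum>n. d n * exp (- (\<i> * of_real (x n * u))))"
    and g: "g > 0" and gap: "\<And>n. n \<noteq> n0 \<Longrightarrow> \<bar>x n - x n0\<bar> \<ge> g"
  obtains D where "\<And>\<epsilon>. \<epsilon> > 0 \<Longrightarrow> norm (d n0) * fact k / \<epsilon> ^ Suc k - D
     \<le> norm (LBINT u:{0..}. \<phi> (Complex \<alpha> (T + u)) * Complex (\<alpha> - c) u ^ k *
           exp (of_real (x n0) * Complex (\<alpha> - c) u) * exp (\<i> * of_real \<epsilon> * Complex (\<alpha> - c) u))"
    "\<And>\<epsilon>. \<epsilon> > 0 \<Longrightarrow> set_integrable lborel {0..} (\<lambda>u. \<phi> (Complex \<alpha> (T + u)) * Complex (\<alpha> - c) u ^ k *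
           exp (of_real (x n0) * Complex (\<alpha> - c) u) * exp (\<i> * of_real \<epsilon> * Complex (\<alpha> - c) u))"
proof -
  define F where "F \<epsilon> p = \<phi> (p + Complex c T) * p ^ k * exp (of_real (x n0) * p) * exp (\<i> * of_real \<epsilon> * p)" for \<epsilon> :: real and p
  have hol: "F \<epsilon> holomorphic_on {p. Im p > T0 - T}" for \<epsilon>
  proof -
    have "(\<phi> \<circ> (\<lambda>p. p + Complex c T)) holomorphic_on {p. Im p > T0 - T}"
      by (intro holomorphic_on_compose holomorphic_intros holomorphic_on_subset[OF phol]) auto
    thus ?thesis unfolding F_def o_def by (intro holomorphic_intros)
  qed
  have Feq: "F \<epsilon> (Complex (\<alpha> - c) u) = \<phi> (Complex \<alpha> (T + u)) * Complex (\<alpha> - c) u ^ k *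
           exp (of_real (x n0) * Complex (\<alpha> - c) u) * exp (\<i> * of_real \<epsilon> * Complex (\<alpha> - c) u)" for \<epsilon> u
  proof -
    have "Complex (\<alpha> - c) u + Complex c T = Complex \<alpha> (T + u)" by (simp add: complex_eq_iff)
    thus ?thesis by (simp add: F_def)
  qed
  \<comment> \<open>Large enough that \<open>a0 + u\<close> dominates both the base
    \<open>Q + t\<close> in the growth of \<phi> and the modulus of the variable \<open>p\<close> in
    the strip.\<close>
  define a0 where "a0 = Q + T + (c - \<alpha>)"
  have a0: "a0 \<ge> 0" using T \<alpha> P by (simp add: a0_def)
  define E where "E = P * exp (\<bar>x n0\<bar> * (c - \<alpha>))"
  have E: "E \<ge> 0" using P by (simp add: E_def)
  have bd: "norm (F \<epsilon> (Complex \<sigma> u)) \<le> E * ((a0 + u) ^ (M + k) * exp (- \<epsilon> * u))"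
    if s: "\<alpha> - c \<le> \<sigma>" "\<sigma> \<le> 0" "u \<ge> 0" for \<epsilon> \<sigma> u
  proof -
    have e: "Complex \<sigma> u + Complex c T = Complex (\<sigma> + c) (T + u)" by (simp add: complex_eq_iff)
    have "norm (\<phi> (Complex \<sigma> u + Complex c T)) \<le> P * (Q + (T + u)) ^ M"
      unfolding e using s by (intro growth) auto
    also have "\<dots> \<le> P * (a0 + u) ^ M" using P s T \<alpha> by (intro mult_left_mono power_mono) (auto simp: a0_def)
    finally have 1: "norm (\<phi> (Complex \<sigma> u + Complex c T)) \<le> P * (a0 + u) ^ M" .
    have "norm (Complex \<sigma> u) \<le> a0 + u" using cmod_le[of "Complex \<sigma> u"] s T P by (simp add: a0_def)
    hence 2: "norm (Complex \<sigma> u ^ k) \<le> (a0 + u) ^ k" unfolding norm_power by (intro power_mono) auto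
    have "x n0 * \<sigma> \<le> \<bar>x n0\<bar> * \<bar>\<sigma>\<bar>" using abs_ge_self[of "x n0 * \<sigma>"] by (simp add: abs_mult)
    also have "\<dots> \<le> \<bar>x n0\<bar> * (c - \<alpha>)" using s by (intro mult_left_mono) auto
    finally have 3: "norm (exp (of_real (x n0) * Complex \<sigma> u)) \<le> exp (\<bar>x n0\<bar> * (c - \<alpha>))" by simp
    have 4: "norm (exp (\<i> * of_real \<epsilon> * Complex \<sigma> u)) = exp (- \<epsilon> * u)" by simp
    have "norm (F \<epsilon> (Complex \<sigma> u)) \<le> (P * (a0 + u) ^ M) * (a0 + u) ^ k * exp (\<bar>x n0\<bar> * (c - \<alpha>)) * exp (- \<epsilon> * u)"
      unfolding F_def norm_mult[of "_ * _ * _"] norm_mult[of "_ * _ ^ _"] norm_mult[of "\<phi> _"] 4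
      using 1 2 3 P a0 s by (intro mult_mono mult_nonneg_nonneg) auto
    also have "\<dots> = E * ((a0 + u) ^ (M + k) * exp (- \<epsilon> * u))" by (simp add: E_def power_add mult_ac)
    finally show ?thesis .
  qed
  have bd2: "\<exists>A. \<forall>\<sigma> u. \<alpha> - c \<le> \<sigma> \<and> \<sigma> \<le> 0 \<and> u \<ge> 0 \<longrightarrow> norm (F \<epsilon> (Complex \<sigma> u)) \<le> A * exp (- (\<epsilon> / 2) * \<bar>u\<bar>)"
    if \<epsilon>: "\<epsilon> > 0" for \<epsilon>
  proof -
    obtain A where A: "A > 0" "\<And>t. t \<ge> 0 \<Longrightarrow> (a0 + t) ^ (M + k) * exp (- \<epsilon> * t) \<le> A * exp (- (\<epsilon> / 2) * t)"
      using power_exp_absorb[OF a0, of "\<epsilon> / 2" \<epsilon> "M + k"] \<epsilon> by auto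
    show ?thesis
    proof (intro exI[of _ "E * A"] allI impI)
      fix \<sigma> u :: real assume s: "\<alpha> - c \<le> \<sigma> \<and> \<sigma> \<le> 0 \<and> u \<ge> 0"
      hence "norm (F \<epsilon> (Complex \<sigma> u)) \<le> E * ((a0 + u) ^ (M + k) * exp (- \<epsilon> * u))" using bd by blast
      also have "\<dots> \<le> E * (A * exp (- (\<epsilon> / 2) * u))" using A(2)[of u] s E by (intro mult_left_mono) auto
      finally show "norm (F \<epsilon> (Complex \<sigma> u)) \<le> E * A * exp (- (\<epsilon> / 2) * \<bar>u\<bar>)" using s by (simp add: mult.assoc)
    qed
  qed
  have int: "set_integrable lborel {0..} (\<lambda>u. F \<epsilon> (Complex \<sigma> u))" if \<epsilon>: "\<epsilon> > 0" and s: "\<alpha> - c \<le> \<sigma>" "\<sigma> \<le> 0" for \<epsilon> \<sigma>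
  proof -
    obtain A where A: "\<forall>\<sigma> u. \<alpha> - c \<le> \<sigma> \<and> \<sigma> \<le> 0 \<and> u \<ge> 0 \<longrightarrow> norm (F \<epsilon> (Complex \<sigma> u)) \<le> A * exp (- (\<epsilon> / 2) * \<bar>u\<bar>)"
      using bd2[OF \<epsilon>] by (rule exE)
    have cont: "continuous_on {0..} (\<lambda>u. F \<epsilon> (Complex \<sigma> u))"
      by (rule continuous_on_compose2[OF holomorphic_on_imp_continuous_on[OF hol]])
         (use T in \<open>auto intro!: continuous_intros\<close>)
    show ?thesis by (rule set_integrable_exp_bound[OF cont, of "\<epsilon> / 2" A]) (use A s \<epsilon> in auto)
  qed
  \<comment> \<open>The non-resonant frequencies plus the bottom edge; neither depends on
    \<epsilon>.\<close>
  define D where "D = fact k / g ^ Suc k * (\<Sum>n. norm (d n)) + (0 - (\<alpha> - c)) * (E * a0 ^ (M + k))"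
  show ?thesis
  proof (rule that)
    fix \<epsilon> :: real assume \<epsilon>: "\<epsilon> > 0"
    obtain A where A: "\<forall>\<sigma> u. \<alpha> - c \<le> \<sigma> \<and> \<sigma> \<le> 0 \<and> u \<ge> 0 \<longrightarrow> norm (F \<epsilon> (Complex \<sigma> u)) \<le> A * exp (- (\<epsilon> / 2) * \<bar>u\<bar>)"
      using bd2[OF \<epsilon>] by (rule exE)
    have 1: "norm ((LBINT u:{0..}. F \<epsilon> (Complex (\<alpha> - c) u)) - (LBINT u:{0..}. F \<epsilon> (Complex 0 u))) \<le> (0 - (\<alpha> - c)) * (E * a0 ^ (M + k))"
    proof (rule contour_shift_half_line[OF hol _ _ int[OF \<epsilon>] int[OF \<epsilon>]])
      show "norm (F \<epsilon> (Complex \<sigma> 0)) \<le> E * a0 ^ (M + k)" if "\<alpha> - c \<le> \<sigma>" "\<sigma> \<le> 0" for \<sigma>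
        using bd[of \<sigma> 0 \<epsilon>] that by simp
      show "((\<lambda>u. A * exp (- (\<epsilon> / 2) * \<bar>u\<bar>)) \<longlongrightarrow> 0) at_top" using \<epsilon> by real_asymp
    qed (use T \<alpha> A in auto)
    have "F \<epsilon> (Complex 0 u) = \<i> ^ k * ((\<Sum>n. d n * exp (- (\<i> * of_real (x n * u)))) * of_real u ^ k * exp (\<i> * of_real (x n0 * u)) * exp (- of_real (\<epsilon> * u)))" for u
    proof -
      have e: "Complex 0 u + Complex c T = Complex c (T + u)" "Complex 0 u = \<i> * of_real u" by (simp_all add: complex_eq_iff)
      have e2: "\<i> * of_real \<epsilon> * (\<i> * of_real u) = - complex_of_real (\<epsilon> * u)" by (simp add: complex_eq_iff)
      have e3: "of_real (x n0) * (\<i> * of_real u) = \<i> * complex_of_real (x n0 * u)" by (simp add: complex_eq_iff)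
      show ?thesis unfolding F_def e(1) ser unfolding e(2) e2 e3 power_mult_distrib by (simp only: mult_ac)
    qed
    hence "(LBINT u:{0..}. F \<epsilon> (Complex 0 u)) = \<i> ^ k * (LBINT u:{0..}. (\<Sum>n. d n * exp (- (\<i> * of_real (x n * u)))) * of_real u ^ k * exp (\<i> * of_real (x n0 * u)) * exp (- of_real (\<epsilon> * u)))"
      by (simp only: set_integral_mult_right)
    hence e: "norm (LBINT u:{0..}. F \<epsilon> (Complex 0 u)) = norm (LBINT u:{0..}. (\<Sum>n. d n * exp (- (\<i> * of_real (x n * u)))) * of_real u ^ k * exp (\<i> * of_real (x n0 * u)) * exp (- of_real (\<epsilon> * u)))"
      by (simp only: norm_mult norm_power norm_ii power_one mult_1_left)
    have 2: "norm (LBINT u:{0..}. F \<epsilon> (Complex 0 u)) \<ge> norm (d n0) * fact k / \<epsilon> ^ Suc k - fact k / g ^ Suc k * (\<Sum>n. norm (d n))"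
      unfolding e
      by (rule exponential_sum_integral_lower_bound[where d = d and x = x and ?n0.0 = n0 and k = k and g = g, OF sm g _ \<epsilon>])
         (rule gap)
    show "norm (d n0) * fact k / \<epsilon> ^ Suc k - D \<le> norm (LBINT u:{0..}. \<phi> (Complex \<alpha> (T + u)) * Complex (\<alpha> - c) u ^ k *
           exp (of_real (x n0) * Complex (\<alpha> - c) u) * exp (\<i> * of_real \<epsilon> * Complex (\<alpha> - c) u))"
      unfolding Feq[symmetric] D_def
      using 1 2 norm_triangle_ineq2[of "LBINT u:{0..}. F \<epsilon> (Complex 0 u)" "LBINT u:{0..}. F \<epsilon> (Complex (\<alpha> - c) u)"]
      unfolding norm_minus_commute[of "LBINT u:{0..}. F \<epsilon> (Complex 0 u)"] by linarith
    show "set_integrable lborel {0..} (\<lambda>u. \<phi> (Complex \<alpha> (T + u)) * Complex (\<alpha> - c) u ^ k *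
           exp (of_real (x n0) * Complex (\<alpha> - c) u) * exp (\<i> * of_real \<epsilon> * Complex (\<alpha> - c) u))"
      unfolding Feq[symmetric] by (rule int[OF \<epsilon>]) (use \<alpha> in auto)
  qed
qed

section \<open>Zeros on the critical line\<close>

text \<open>From \<open>ln y \<le> y - 1\<close> at \<open>y = \<eta> * t / q\<close>, which is
  sharp at the maximum t = q/\<eta>. The constant is q^q; the extra factor exp(-q) is
  dropped.\<close>

lemma powr_exp_bound:
  fixes q \<eta> t :: real
  assumes "q > 0" "\<eta> > 0" "t > 0"
  shows "t powr q * exp (- (\<eta> * t)) \<le> exp (q * ln q) * \<eta> powr (- q)"
proof -
  have "ln (\<eta> * t / q) \<le> \<eta> * t / q - 1" using assms by (intro ln_le_minus_one) auto
  hence "q * ln (\<eta> * t / q) \<le> q * (\<eta> * t / q)" using assms by (intro mult_left_mono) auto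
  hence "q * ln t - \<eta> * t \<le> q * ln q - q * ln \<eta>"
    using assms by (simp add: ln_mult ln_div field_simps)
  hence "exp (q * ln t - \<eta> * t) \<le> exp (q * ln q - q * ln \<eta>)" by simp
  thus ?thesis using assms by (simp add: powr_def exp_add[symmetric] exp_minus exp_diff field_simps)
qed

lemma nonzero_constant_sign:
  fixes f :: "real \<Rightarrow> real"
  assumes cont: "continuous_on {T..} f" and nz: "\<And>t. t \<ge> T \<Longrightarrow> f t \<noteq> 0"
  obtains \<rho> where "\<bar>\<rho>\<bar> = 1" "\<And>t. t \<ge> T \<Longrightarrow> f t = \<rho> * \<bar>f t\<bar>"
proof -
  have same: "f t * f T > 0" if t: "t \<ge> T" for t
  proof (rule ccontr)
    assume "\<not> f t * f T > 0"
    hence "(f T \<le> 0 \<and> 0 \<le> f t) \<or> (f t \<le> 0 \<and> 0 \<le> f T)" by (auto simp: zero_less_mult_iff not_less)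
    moreover have "continuous_on {T..t} f" by (rule continuous_on_subset[OF cont]) auto
    ultimately have "\<exists>x. T \<le> x \<and> x \<le> t \<and> f x = 0"
      using IVT'[of f T 0 t] IVT2'[of f t 0 T] t by auto
    thus False using nz by auto
  qed
  show ?thesis
  proof (rule that[of "sgn (f T)"])
    show "\<bar>sgn (f T)\<bar> = 1" using nz[of T] by (simp add: abs_sgn_eq)
    fix t assume "t \<ge> T"
    from same[OF this] show "f t = sgn (f T) * \<bar>f t\<bar>"
      by (auto simp: sgn_if zero_less_mult_iff)
  qed
qed

text \<open>By monotonicity only the two neighbours of \<open>n0\<close> matter. The gap depends on
  \<open>n0\<close>; no uniform separation of the frequencies is claimed.\<close>

lemma frequency_gap:
  assumes l: "frequency_seq l"
  obtains g where "g > 0" "\<And>n. n \<noteq> n0 \<Longrightarrow> \<bar>ln (l (Suc n)) - ln (l (Suc n0))\<bar> \<ge> g"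
proof -
  have pos: "l (Suc n) > 0" for n using l by (simp add: frequency_seq_def)
  have mono: "l (Suc i) < l (Suc j)" if "i < j" for i j
    using l that by (auto simp: frequency_seq_def strict_mono_on_def)
  have mono': "l (Suc i) \<le> l (Suc j)" if "i \<le> j" for i j
    using mono[of i j] that by (cases "i = j") auto
  define g1 where "g1 = ln (l (Suc (Suc n0))) - ln (l (Suc n0))"
  \<comment> \<open>For \<open>n0 = 0\<close> there is no left neighbour, and \<open>g1\<close>
    stands in.\<close>
  define g2 where "g2 = (if n0 = 0 then g1 else ln (l (Suc n0)) - ln (l (Suc (n0 - 1))))"
  have "g1 > 0" using mono[of n0 "Suc n0"] pos[of n0] pos[of "Suc n0"] by (simp add: g1_def)
  moreover have "g2 > 0" using mono[of "n0 - 1" n0] pos[of n0] pos[of "n0 - 1"] \<open>g1 > 0\<close>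
    by (cases n0) (auto simp: g2_def)
  ultimately have "min g1 g2 > 0" by simp
  moreover have "\<bar>ln (l (Suc n)) - ln (l (Suc n0))\<bar> \<ge> min g1 g2" if "n \<noteq> n0" for n
  proof (cases "n > n0")
    case True
    hence "ln (l (Suc (Suc n0))) \<le> ln (l (Suc n))" using mono'[of "Suc n0" n] pos[of n] pos[of "Suc n0"] by simp
    thus ?thesis by (simp add: g1_def)
  next
    case False
    hence "n < n0" using that by simp
    hence "ln (l (Suc n)) \<le> ln (l (Suc (n0 - 1)))" using mono'[of n "n0 - 1"] pos[of n] pos[of "n0 - 1"] by simp
    thus ?thesis using \<open>n < n0\<close> by (simp add: g2_def)
  qed
  ultimately show ?thesis by (rule that)
qed

lemma set_integral_shift:
  fixes f :: "real \<Rightarrow> real"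
  assumes "set_integrable lborel {T..} f"
  shows "set_integrable lborel {0..} (\<lambda>u. f (T + u))"
    and "(LBINT u:{0..}. f (T + u)) = (LBINT t:{T..}. f t)"
proof -
  have i: "indicator {T..} (T + 1 * u) *\<^sub>R f (T + 1 * u) = indicator {0..} u *\<^sub>R f (T + u)" for u
    by (simp add: indicator_def)
  show "set_integrable lborel {0..} (\<lambda>u. f (T + u))"
    using lborel_integrable_real_affine[OF assms[unfolded set_integrable_def], of 1 T]
    unfolding set_integrable_def i by simp
  show "(LBINT u:{0..}. f (T + u)) = (LBINT t:{T..}. f t)"
    using lborel_integral_real_affine[of 1 "\<lambda>t. indicator {T..} t *\<^sub>R f t" T]
    unfolding set_lebesgue_integral_def i by simp
qed

text \<open>Multiplied by \<eta>^(k+1), the left side tends to a positive constant. On the right the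
  exponent k + 1 - q equals (r+1)/2, exactly what cancels the singularity allowed for
  \<open>Y\<close>, and arbitrarily small \<delta> beats that constant.\<close>

lemma resonance_lower_bound_contradiction:
  fixes Y :: "real \<Rightarrow> real"
  assumes r: "r > 0" and c1: "c1 > 0" and A: "A > 0" and R: "R > 0" and q: "q = real k + 1/2 - r/2"
    and lower: "\<And>\<eta>. \<lbrakk>0 < \<eta>; \<eta> < 1/2\<rbrakk> \<Longrightarrow> c1 / (2 * \<eta>) ^ Suc k - D \<le> R * \<eta> powr (- q) * (A * Y \<eta> + B)"
    and small: "\<And>\<delta>. \<delta> > 0 \<Longrightarrow> eventually (\<lambda>\<eta>. Y \<eta> \<le> \<delta> * \<eta> powr (- ((r + 1) / 2))) (at_right 0)"
  shows False
proof -
  define c2 where "c2 = c1 / 2 ^ Suc k"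
  have c2: "c2 > 0" using c1 by (simp add: c2_def)
  \<comment> \<open>Chosen so that \<open>R * A * \<delta>\<close> is \<open>c2 / 2\<close>; the
    limit then reads \<open>c2 \<le> c2 / 2\<close>.\<close>
  define \<delta> where "\<delta> = c2 / (2 * R * A)"
  have \<delta>: "\<delta> > 0" using c2 R A by (simp add: \<delta>_def)
  have "eventually (\<lambda>\<eta>::real. \<eta> < 1/2) (at_right 0)" by (rule eventually_at_right_field[THEN iffD2]) (auto intro!: exI[of _ "1/2"])
  moreover have "eventually (\<lambda>\<eta>::real. \<eta> > 0) (at_right 0)" by (rule eventually_at_right_less)
  ultimately have "eventually (\<lambda>\<eta>. c2 - D * \<eta> ^ Suc k \<le> R * A * \<delta> + R * B * \<eta> powr ((r + 1) / 2)) (at_right 0)"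
    using small[OF \<delta>]
  proof eventually_elim
    case (elim \<eta>)
    have p: "\<eta> ^ Suc k > 0" using elim by simp
    have pk: "\<eta> ^ Suc k = \<eta> powr (real k + 1)" using elim powr_realpow[of \<eta> "Suc k"] by (simp add: add.commute)
    have "(c1 / (2 * \<eta>) ^ Suc k - D) * \<eta> ^ Suc k \<le> (R * \<eta> powr (- q) * (A * Y \<eta> + B)) * \<eta> ^ Suc k"
      using lower[of \<eta>] elim p by (intro mult_right_mono) auto
    also have "\<dots> = R * (A * Y \<eta> + B) * (\<eta> powr (- q) * \<eta> powr (real k + 1))" by (simp only: pk mult_ac)
    also have "\<eta> powr (- q) * \<eta> powr (real k + 1) = \<eta> powr ((r + 1) / 2)"
      unfolding powr_add[symmetric] by (rule arg_cong[of _ _ "\<lambda>y. \<eta> powr y"]) (simp add: q field_simps)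
    also have "R * (A * Y \<eta> + B) * \<eta> powr ((r + 1) / 2) \<le> R * (A * (\<delta> * \<eta> powr (- ((r + 1) / 2))) + B) * \<eta> powr ((r + 1) / 2)"
      using elim R A by (intro mult_right_mono mult_left_mono add_right_mono) auto
    also have "\<dots> = R * A * \<delta> * (\<eta> powr (- ((r + 1) / 2)) * \<eta> powr ((r + 1) / 2)) + R * B * \<eta> powr ((r + 1) / 2)"
      by (simp add: algebra_simps)
    also have "\<eta> powr (- ((r + 1) / 2)) * \<eta> powr ((r + 1) / 2) = 1" using elim unfolding powr_add[symmetric] by simp
    also have "R * A * \<delta> * 1 + R * B * \<eta> powr ((r + 1) / 2) = R * A * \<delta> + R * B * \<eta> powr ((r + 1) / 2)" by simp
    also have "(c1 / (2 * \<eta>) ^ Suc k - D) * \<eta> ^ Suc k = c2 - D * \<eta> ^ Suc k"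
      using elim by (simp add: c2_def power_mult_distrib left_diff_distrib)
    finally show ?case .
  qed
  moreover have "((\<lambda>\<eta>. c2 - D * \<eta> ^ Suc k) \<longlongrightarrow> c2 - D * 0 ^ Suc k) (at_right 0)"
    by (intro tendsto_intros)
  moreover have "((\<lambda>\<eta>. R * A * \<delta> + R * B * \<eta> powr ((r + 1) / 2)) \<longlongrightarrow> R * A * \<delta> + R * B * 0) (at_right 0)"
  proof (intro tendsto_intros)
    show "((\<lambda>\<eta>. \<eta> powr ((r + 1) / 2)) \<longlongrightarrow> 0) (at_right 0)" using r by real_asymp
  qed
  ultimately have "c2 - D * 0 ^ Suc k \<le> R * A * \<delta> + R * B * 0"
    by (intro tendsto_le[OF trivial_limit_at_right_real])
  thus False using c2 R A by (simp add: \<delta>_def)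
qed

theorem corollary4p2:
  fixes r :: real
    and a b :: "nat \<Rightarrow> complex"
    and l m :: "nat \<Rightarrow> real"
    and \<phi> \<psi> :: "complex \<Rightarrow> complex"
  assumes "r > 0"
    and "class_A r a l b m \<phi> \<psi>"
    and "\<And>n. n \<ge> 1 \<Longrightarrow> b n = cnj (a n)"
    and "\<And>n. n \<ge> 1 \<Longrightarrow> l n = m n"
    and "abs_conv_abscissa a l < ereal (min 1 r + 1 / 2 * max 1 r)"
    and "(\<lambda>\<epsilon>. Theta (exp (\<i> * of_real (pi / 2 - \<epsilon>))) a l)
           \<in> o[at_right 0](\<lambda>\<epsilon>. of_real (\<epsilon> powr (- ((r + 1) / 2))))"
  shows "infinite {s. Re s = r / 2 \<and> \<phi> s = 0}"
proof
  assume fin: "finite {s. Re s = r / 2 \<and> \<phi> s = 0}"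
  note r = assms(1)
  have H: "hecke_pair r a l b m" and P: "continuation_simple_pole r a l \<phi>"
    using assms(2) by (auto simp: class_A_def)
  have l: "frequency_seq l" using H by (auto simp: hecke_pair_def)
  have pos: "l (Suc n) > 0" for n using l by (simp add: frequency_seq_def)
  \<comment> \<open>Any nonzero coefficient can be made to resonate.\<close>
  obtain n0 where n0: "a (Suc n0) \<noteq> 0"
  proof -
    have "\<exists>n\<ge>1. a n \<noteq> 0" using H by (auto simp: hecke_pair_def)
    then obtain n where "n \<ge> 1" "a n \<noteq> 0" by blast
    thus ?thesis using that[of "n - 1"] by simp
  qed
  obtain g where g: "g > 0" "\<And>n. n \<noteq> n0 \<Longrightarrow> \<bar>ln (l (Suc n)) - ln (l (Suc n0))\<bar> \<ge> g"
    using frequency_gap[OF l, of n0] by blast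
  obtain \<alpha> where \<alpha>: "abs_conv_abscissa a l = ereal \<alpha>" using H by (cases "abs_conv_abscissa a l") (auto simp: hecke_pair_def)
  have phol: "\<phi> holomorphic_on - {of_real r}"
    using P[unfolded continuation_simple_pole_def, THEN conjunct2, THEN conjunct1] .
  have phi: "\<phi> s = dirichlet_series a l s" if "Re s > \<alpha>" for s
    using P[unfolded continuation_simple_pole_def, THEN conjunct1] that by (simp add: \<alpha>)
  obtain T0 where T0: "T0 > 0"
    "\<And>s. Im s > T0 \<Longrightarrow> Gamma s * \<phi> s = cnj (Gamma (of_real r - cnj s) * \<phi> (of_real r - cnj s))"
    "\<And>\<sigma>1 \<sigma>2. \<exists>T1. \<forall>\<sigma> t. \<sigma>1 \<le> \<sigma> \<and> \<sigma> \<le> \<sigma>2 \<and> t \<ge> T1 \<longrightarrow> norm (Gamma (Complex \<sigma> t) * \<phi> (Complex \<sigma> t)) \<le> 1"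
    using class_A_upper_half_plane[OF assms(2-4)] by blast
  \<comment> \<open>The line Re s = 1/2 + N must lie to the right both of the abscissa of absolute
    convergence and of the possible pole at \<open>r\<close>.\<close>
  obtain N :: nat where N': "real N > max \<alpha> r" using reals_Archimedean2 by blast
  define c where "c = 1/2 + real N"
  have N: "r < 1/2 + real N" "\<alpha> < c" using N' by (auto simp: c_def)
  have sm: "summable (\<lambda>n. norm (a (Suc n) * of_real (l (Suc n)) powr (- s)))" if "Re s > \<alpha>" for s
    using dirichlet_summable[OF l, of a s] that by (simp add: \<alpha>)
  define S where "S = (\<Sum>n. norm (a (Suc n) * of_real (l (Suc n)) powr (- of_real c)))"
  have smc: "summable (\<lambda>n. norm (a (Suc n) * of_real (l (Suc n)) powr (- of_real c)))"
    using N by (intro sm) simp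
  have phic: "\<phi> (Complex c t) = dirichlet_series a l (Complex c t)" for t using N by (intro phi) simp
  have right: "norm (\<phi> (Complex (1/2 + real N) t)) \<le> S" for t
    unfolding c_def[symmetric] phic dirichlet_series_def S_def
    by (rule norm_suminf_le[OF _ smc]) (simp add: norm_dirichlet_term[OF pos])
  obtain T1 C where T1: "T1 > T0" "T1 \<ge> 1" and C: "C > 0" and
    gr: "\<And>\<sigma> t. \<lbrakk>r - (1/2 + real N) \<le> \<sigma>; \<sigma> \<le> 1/2 + real N; t \<ge> T1\<rbrakk>
       \<Longrightarrow> norm (Gamma (Complex \<sigma> t) * \<phi> (Complex \<sigma> t)) \<le> C * (real N + 1 + t) ^ N * exp (- (pi * t / 2))"
    using completed_function_growth[OF phol r T0 right N(1)] by blast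
  obtain T2 where T2: "\<And>s. s \<in> {s. Re s = r / 2 \<and> \<phi> s = 0} \<Longrightarrow> norm s \<le> T2"
    using finite_imp_bounded[OF fin] unfolding bounded_iff by blast
  \<comment> \<open>Beyond \<open>T2\<close> no zero on the critical line is left, by the assumed
    finiteness.\<close>
  define T where "T = max T1 (T2 + 1)"
  have T: "T \<ge> T1" "T > T2" by (auto simp: T_def)
  have T': "T > T0" "T \<ge> 1" using T T1 by auto
  define X where "X t = Gamma (Complex (r/2) t) * \<phi> (Complex (r/2) t)" for t
  have nz: "\<phi> (Complex (r/2) t) \<noteq> 0" if "t \<ge> T" for t
  proof
    assume "\<phi> (Complex (r/2) t) = 0"
    hence "norm (Complex (r/2) t) \<le> T2" by (intro T2) simp
    thus False using abs_Im_le_cmod[of "Complex (r/2) t"] that T by simp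
  qed
  have Xnz: "X t \<noteq> 0" if "t \<ge> T" for t
    using nz[OF that] that T' by (simp add: X_def Gamma_eq_zero_iff notin_nonpos_Ints_Im)
  have Xreal: "X t = of_real (Re (X t))" if "t \<ge> T" for t
  proof -
    have "of_real r - cnj (Complex (r/2) t) = Complex (r/2) t" by (simp add: complex_eq_iff)
    hence "X t = cnj (X t)" using T0(2)[of "Complex (r/2) t"] that T' by (simp add: X_def)
    thus ?thesis by (metis Reals_cnj_iff of_real_Re)
  qed
  have Xcont: "continuous_on {T..} X" unfolding X_def
    by (rule continuous_on_compose2[of "{s. Im s > T0}" "\<lambda>s. Gamma s * \<phi> s"])
       (use T' T0(1) in \<open>auto simp: notin_nonpos_Ints_Im intro!: holomorphic_on_imp_continuous_on holomorphic_intros holomorphic_on_subset[OF phol] continuous_intros\<close>)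
  obtain \<rho> where \<rho>: "\<bar>\<rho>\<bar> = 1" "\<And>t. t \<ge> T \<Longrightarrow> Re (X t) = \<rho> * \<bar>Re (X t)\<bar>"
  proof (rule nonzero_constant_sign[of T "\<lambda>t. Re (X t)"])
    show "continuous_on {T..} (\<lambda>t. Re (X t))" by (intro continuous_intros Xcont)
    show "Re (X t) \<noteq> 0" if "t \<ge> T" for t using Xnz[OF that] Xreal[OF that] by auto
  qed blast
  have Xsign: "X t = of_real (\<rho> * norm (X t))" if "t \<ge> T" for t
  proof -
    have "norm (X t) = \<bar>Re (X t)\<bar>" by (subst Xreal[OF that]) simp
    thus ?thesis using Xreal[OF that] \<rho>(2)[OF that] by simp
  qed
  obtain A B where AB: "A > 0" "B > 0"
    "\<And>\<theta>. \<lbrakk>0 < \<theta>; \<theta> < pi / 2\<rbrakk> \<Longrightarrow>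
       set_integrable lborel {T..} (\<lambda>t. Gamma (Complex (r/2) t) * \<phi> (Complex (r/2) t) * exp (- (Complex (r/2) t * (\<i> * of_real \<theta>))))"
    "\<And>\<theta>. \<lbrakk>0 < \<theta>; \<theta> < pi / 2\<rbrakk> \<Longrightarrow>
       norm (LBINT t:{T..}. Gamma (Complex (r/2) t) * \<phi> (Complex (r/2) t) * exp (- (Complex (r/2) t * (\<i> * of_real \<theta>))))
         \<le> A * norm (Theta (exp (\<i> * of_real \<theta>)) a l) + B"
  proof (rule theta_critical_line_integral[OF phol r T0(1) pos smc[unfolded c_def] phic[unfolded c_def] N(1) T' C])
    show "norm (Gamma (Complex \<sigma> t) * \<phi> (Complex \<sigma> t)) \<le> C * (real N + 1 + t) ^ N * exp (- (pi * t / 2))"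
      if "r - (1/2 + real N) \<le> \<sigma>" "\<sigma> \<le> 1/2 + real N" "t \<ge> T" for \<sigma> t using gr that T by auto
  qed (rule that)
  have Xabs: "set_integrable lborel {T..} (\<lambda>t. norm (X t) * exp (t * \<theta>))"
    "(LBINT t:{T..}. norm (X t) * exp (t * \<theta>)) \<le> A * norm (Theta (exp (\<i> * of_real \<theta>)) a l) + B"
    if th: "0 < \<theta>" "\<theta> < pi / 2" for \<theta>
  proof -
    have nn: "norm (X t * exp (- (Complex (r/2) t * (\<i> * of_real \<theta>)))) = norm (X t) * exp (t * \<theta>)" for t
      by (simp add: norm_mult)
    have "set_integrable lborel {T..} (\<lambda>t. X t * exp (- (Complex (r/2) t * (\<i> * of_real \<theta>))))"
      using AB(3)[OF th] by (simp only: X_def)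
    from set_integrable_norm[OF this] show "set_integrable lborel {T..} (\<lambda>t. norm (X t) * exp (t * \<theta>))"
      by (simp only: nn)
    \<comment> \<open>The phase exp(-\<i>r\<theta>/2) of the kernel does not depend on t. Since
      \<open>X\<close> has constant sign, the integrand is a fixed number of modulus 1 times a
      nonnegative function, and taking absolute values inside the integral loses nothing.\<close>
    have "X t * exp (- (Complex (r/2) t * (\<i> * of_real \<theta>))) = (of_real \<rho> * exp (- (\<i> * of_real (r/2 * \<theta>)))) * of_real (norm (X t) * exp (t * \<theta>))"
      if "t \<ge> T" for t
    proof -
      have "exp (- (Complex (r/2) t * (\<i> * of_real \<theta>))) = exp (- (\<i> * of_real (r/2 * \<theta>))) * of_real (exp (t * \<theta>))"
        unfolding exp_of_real[symmetric] exp_add[symmetric] by (intro arg_cong[of _ _ exp]) (simp add: complex_eq_iff)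
      thus ?thesis by (subst Xsign[OF that]) (simp only: of_real_mult mult_ac)
    qed
    hence "(LBINT t:{T..}. X t * exp (- (Complex (r/2) t * (\<i> * of_real \<theta>)))) = (LBINT t:{T..}. (of_real \<rho> * exp (- (\<i> * of_real (r/2 * \<theta>)))) * of_real (norm (X t) * exp (t * \<theta>)))"
      by (intro set_lebesgue_integral_cong) auto
    also have "\<dots> = (of_real \<rho> * exp (- (\<i> * of_real (r/2 * \<theta>)))) * of_real (LBINT t:{T..}. norm (X t) * exp (t * \<theta>))"
      by (simp only: set_integral_mult_right set_integral_complex_of_real)
    finally have "norm (LBINT t:{T..}. X t * exp (- (Complex (r/2) t * (\<i> * of_real \<theta>)))) = \<bar>LBINT t:{T..}. norm (X t) * exp (t * \<theta>)\<bar>"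
      using \<rho>(1) by (simp add: norm_mult)
    thus "(LBINT t:{T..}. norm (X t) * exp (t * \<theta>)) \<le> A * norm (Theta (exp (\<i> * of_real \<theta>)) a l) + B"
      using AB(4)[OF th] by (simp only: X_def)
  qed
  obtain R where R: "R > 0" "\<And>\<sigma> t. \<lbrakk>0 \<le> \<sigma>; \<sigma> \<le> 1/2 + real N; t \<ge> 1\<rbrakk>
     \<Longrightarrow> norm (rGamma (Complex \<sigma> t)) \<le> R * exp (pi * t / 2) * t powr (1/2 - \<sigma>)"
    using rGamma_strip_bound[of N] by blast
  have rG: "\<phi> (Complex \<sigma> t) = (Gamma (Complex \<sigma> t) * \<phi> (Complex \<sigma> t)) * rGamma (Complex \<sigma> t)" if "t \<ge> T" for \<sigma> t
    using that T' by (simp add: rGamma_inverse_Gamma Gamma_eq_zero_iff notin_nonpos_Ints_Im)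
  have rc: "0 \<le> r/2" "r/2 \<le> c" using r N by (auto simp: c_def)
  \<comment> \<open>The decay of X and the growth of \<open>1/\<Gamma>\<close> cancel up to a power
    of t, so \<phi> has polynomial growth in the strip, as required for moving the weighted
    integral.\<close>
  have poly: "norm (\<phi> (Complex \<sigma> t)) \<le> C * R * (real N + 1 + t) ^ Suc N" if s: "r/2 \<le> \<sigma>" "\<sigma> \<le> c" "t \<ge> T" for \<sigma> t
  proof -
    have t1: "t \<ge> 1" using s T' by simp
    have "t powr (1/2 - \<sigma>) \<le> t powr 1" using t1 s r by (intro powr_mono) auto
    hence p: "t powr (1/2 - \<sigma>) \<le> real N + 1 + t" using t1 by simp
    have "norm (\<phi> (Complex \<sigma> t)) \<le> (C * (real N + 1 + t) ^ N * exp (- (pi * t / 2))) * (R * exp (pi * t / 2) * t powr (1/2 - \<sigma>))"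
      by (subst rG[OF s(3)], subst norm_mult, intro mult_mono gr R(2)) (use s T t1 r N C in \<open>auto simp: c_def\<close>)
    also have "\<dots> = C * R * (real N + 1 + t) ^ N * (exp (- (pi * t / 2)) * exp (pi * t / 2)) * t powr (1/2 - \<sigma>)" by (simp only: mult_ac)
    also have "exp (- (pi * t / 2)) * exp (pi * t / 2) = 1" by (simp add: exp_minus)
    also have "C * R * (real N + 1 + t) ^ N * 1 * t powr (1/2 - \<sigma>) \<le> C * R * (real N + 1 + t) ^ N * 1 * (real N + 1 + t)"
      using p C R t1 by (intro mult_left_mono) auto
    finally show ?thesis by (simp add: mult_ac)
  qed
  define d where "d n = a (Suc n) * of_real (l (Suc n)) powr (- Complex c T)" for n
  define x where "x n = ln (l (Suc n))" for n
  have smd: "summable (\<lambda>n. norm (d n))" unfolding d_def using N by (intro sm) simp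
  have ser: "\<phi> (Complex c (T + u)) = (\<Sum>n. d n * exp (- (\<i> * of_real (x n * u))))" for u
    unfolding phic dirichlet_series_def
  proof (intro suminf_cong)
    fix n
    have "- Complex c (T + u) * Ln (of_real (l (Suc n))) = - Complex c T * Ln (of_real (l (Suc n))) + - (\<i> * of_real (x n * u))"
      using pos[of n] by (simp add: Ln_of_real x_def complex_eq_iff algebra_simps)
    hence "of_real (l (Suc n)) powr (- Complex c (T + u)) = of_real (l (Suc n)) powr (- Complex c T) * exp (- (\<i> * of_real (x n * u)))"
      using pos[of n] by (simp only: powr_def exp_add) simp
    thus "a (Suc n) * of_real (l (Suc n)) powr (- Complex c (T + u)) = d n * exp (- (\<i> * of_real (x n * u)))"
      by (simp only: d_def mult.assoc)
  qed
  \<comment> \<open>With k > r the exponent \<open>q\<close> is positive, as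
    \<open>powr_exp_bound\<close> requires.\<close>
  obtain k :: nat where k: "real k > r" using reals_Archimedean2 by blast
  define q where "q = real k + 1/2 - r/2"
  have q: "q > 0" using k r by (simp add: q_def)
  have phT: "\<phi> holomorphic_on {s. Im s > T0}" by (rule holomorphic_on_subset[OF phol]) (use T0(1) in auto)
  define J where "J \<epsilon> u = \<phi> (Complex (r/2) (T + u)) * Complex (r/2 - c) u ^ k *
           exp (of_real (x n0) * Complex (r/2 - c) u) * exp (\<i> * of_real \<epsilon> * Complex (r/2 - c) u)" for \<epsilon> u :: real
  have T00: "T \<ge> 0" "real N + 1 \<ge> 0" "C * R \<ge> 0" using T' C R by auto
  obtain D where D: "\<And>\<epsilon>. \<epsilon> > 0 \<Longrightarrow> norm (d n0) * fact k / \<epsilon> ^ Suc k - D \<le> norm (LBINT u:{0..}. J \<epsilon> u)"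
    "\<And>\<epsilon>. \<epsilon> > 0 \<Longrightarrow> set_integrable lborel {0..} (J \<epsilon>)"
  proof (rule weighted_line_integral_lower_bound[where d = d and x = x and ?n0.0 = n0 and k = k, OF phT T'(1) T00(1) rc _ T00(3,2) smd ser g(1)])
    show "\<bar>x n - x n0\<bar> \<ge> g" if "n \<noteq> n0" for n using g(2)[OF that] by (simp only: x_def)
    show "norm (\<phi> (Complex \<sigma> t)) \<le> C * R * (real N + 1 + t) ^ Suc N" if "r/2 \<le> \<sigma>" "\<sigma> \<le> c" "t \<ge> T" for \<sigma> t
      using that by (rule poly)
    fix D
    assume D1: "\<And>\<epsilon>. \<epsilon> > 0 \<Longrightarrow> norm (d n0) * fact k / \<epsilon> ^ Suc k - D
     \<le> norm (LBINT u:{0..}. \<phi> (Complex (r/2) (T + u)) * Complex (r/2 - c) u ^ k *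
           exp (of_real (x n0) * Complex (r/2 - c) u) * exp (\<i> * of_real \<epsilon> * Complex (r/2 - c) u))"
    and D2: "\<And>\<epsilon>. \<epsilon> > 0 \<Longrightarrow> set_integrable lborel {0..} (\<lambda>u. \<phi> (Complex (r/2) (T + u)) * Complex (r/2 - c) u ^ k *
           exp (of_real (x n0) * Complex (r/2 - c) u) * exp (\<i> * of_real \<epsilon> * Complex (r/2 - c) u))"
    show thesis
    proof (rule that)
      fix \<epsilon> :: real assume \<epsilon>: "\<epsilon> > 0"
      show "norm (d n0) * fact k / \<epsilon> ^ Suc k - D \<le> norm (LBINT u:{0..}. J \<epsilon> u)"
        unfolding J_def by (rule D1[OF \<epsilon>])
      show "set_integrable lborel {0..} (J \<epsilon>)" unfolding J_def[abs_def] by (rule D2[OF \<epsilon>])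
    qed
  qed
  define E where "E = exp (\<bar>x n0\<bar> * (c - r/2))"
  define R' where "R' = R * (c + 1) ^ k * E * exp T * exp (q * ln q)"
  have R': "R' > 0" using R rc by (auto simp: R'_def E_def intro!: mult_pos_pos zero_less_power)
  have upper: "norm (LBINT u:{0..}. J (2 * \<eta>) u) \<le> R' * \<eta> powr (- q) * (A * norm (Theta (exp (\<i> * of_real (pi / 2 - \<eta>))) a l) + B)"
    if \<eta>: "0 < \<eta>" "\<eta> < 1/2" for \<eta>
  proof -
    \<comment> \<open>The weight is used with parameter \<open>2 * \<eta>\<close> but \<Theta> with
      angle pi/2 - \<eta>, so a damping exp(-\<eta>t) is left over. The bound \<eta> < 1/2 keeps
      \<theta> positive and \<open>2 * \<eta> * T\<close> below \<open>T\<close>.\<close>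
    define \<theta> where "\<theta> = pi / 2 - \<eta>"
    have th: "0 < \<theta>" "\<theta> < pi / 2" using \<eta> pi_gt3 by (auto simp: \<theta>_def)
    define h where "h t = norm (X t) * exp (t * \<theta>)" for t
    have hint: "set_integrable lborel {T..} h" using Xabs(1)[OF th] by (simp only: h_def[abs_def])
    have bd: "norm (J (2 * \<eta>) u) \<le> R' * \<eta> powr (- q) * h (T + u)" if u: "u \<ge> 0" for u
    proof -
      define t where "t = T + u"
      have t: "t \<ge> T" "t \<ge> 1" using u T' by (auto simp: t_def)
      have 1: "norm (\<phi> (Complex (r/2) t)) \<le> norm (X t) * (R * exp (pi * t / 2) * t powr (1/2 - r/2))"
        by (subst rG[OF t(1)], subst norm_mult, unfold X_def, intro mult_left_mono R(2)) (use t rc in \<open>auto simp: c_def\<close>)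
      have "norm (Complex (r/2 - c) u) \<le> (c - r/2) + u" using cmod_le[of "Complex (r/2 - c) u"] rc u by simp
      also have "\<dots> \<le> c * 1 + t" using r T' by (simp add: t_def)
      also have "\<dots> \<le> c * t + t" using rc t by (intro add_right_mono mult_left_mono) auto
      finally have "norm (Complex (r/2 - c) u) \<le> (c + 1) * t" by (simp add: algebra_simps)
      hence 2: "norm (Complex (r/2 - c) u ^ k) \<le> (c + 1) ^ k * t ^ k"
        unfolding norm_power power_mult_distrib[symmetric] by (intro power_mono) auto
      have "- x n0 * (c - r/2) \<le> \<bar>x n0\<bar> * (c - r/2)" using rc by (intro mult_right_mono) auto
      hence "x n0 * (r/2 - c) \<le> \<bar>x n0\<bar> * (c - r/2)" by (simp add: algebra_simps)
      hence 3: "norm (exp (of_real (x n0) * Complex (r/2 - c) u)) \<le> E" by (simp add: E_def)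
      \<comment> \<open>The damping is in u = t - T; rewriting it in t costs exp(2\<eta>T), at most
        \<open>exp T\<close>.\<close>
      have "norm (exp (\<i> * of_real (2 * \<eta>) * Complex (r/2 - c) u)) = exp (2 * \<eta> * T) * exp (- (2 * \<eta> * t))"
        by (simp add: t_def exp_add[symmetric] algebra_simps)
      also have "\<dots> \<le> exp T * exp (- (2 * \<eta> * t))" using \<eta> T' by (intro mult_right_mono) auto
      finally have 4: "norm (exp (\<i> * of_real (2 * \<eta>) * Complex (r/2 - c) u)) \<le> exp T * exp (- (2 * \<eta> * t))" .
      have "norm (J (2 * \<eta>) u) \<le> (norm (X t) * (R * exp (pi * t / 2) * t powr (1/2 - r/2))) * ((c + 1) ^ k * t ^ k) * E * (exp T * exp (- (2 * \<eta> * t)))"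
        unfolding J_def t_def[symmetric] norm_mult[of "_ * _ * _"] norm_mult[of "_ * _ ^ _"] norm_mult[of "\<phi> _"]
        using 1 2 3 4 R(1) rc t
        by (intro mult_mono mult_nonneg_nonneg) (auto simp: E_def)
      also have "\<dots> = R * (c + 1) ^ k * E * exp T * norm (X t) * (exp (pi * t / 2) * exp (- (2 * \<eta> * t))) * (t powr (1/2 - r/2) * t ^ k)"
        by (simp only: mult_ac)
      also have "t powr (1/2 - r/2) * t ^ k = t powr q"
        using t by (simp add: q_def powr_realpow[symmetric] powr_add[symmetric] algebra_simps)
      \<comment> \<open>One half of the damping turns exp(pi t/2) into exp(\<theta>t), the kernel
        whose integral against |X| is controlled by \<Theta>; the other half is spent on
        t^q.\<close>
      also have "exp (pi * t / 2) * exp (- (2 * \<eta> * t)) = exp (t * \<theta>) * exp (- (\<eta> * t))"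
        unfolding exp_add[symmetric] by (simp add: \<theta>_def algebra_simps)
      also have "R * (c + 1) ^ k * E * exp T * norm (X t) * (exp (t * \<theta>) * exp (- (\<eta> * t))) * t powr q
         = R * (c + 1) ^ k * E * exp T * h t * (t powr q * exp (- (\<eta> * t)))" by (simp only: h_def mult_ac)
      also have "\<dots> \<le> R * (c + 1) ^ k * E * exp T * h t * (exp (q * ln q) * \<eta> powr (- q))"
        using R(1) rc t by (intro mult_left_mono powr_exp_bound q \<eta>(1)) (auto simp: E_def h_def)
      also have "\<dots> = R' * \<eta> powr (- q) * h (T + u)" by (simp only: R'_def t_def mult_ac)
      finally show ?thesis .
    qed
    have "norm (LBINT u:{0..}. J (2 * \<eta>) u) \<le> (LBINT u:{0..}. R' * \<eta> powr (- q) * h (T + u))"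
      unfolding set_lebesgue_integral_def
    proof (rule Bochner_Integration.integral_norm_bound_integral)
      show "integrable lborel (\<lambda>u. indicator {0..} u *\<^sub>R J (2 * \<eta>) u)" using D(2)[of "2 * \<eta>"] \<eta> by (simp add: set_integrable_def)
      show "integrable lborel (\<lambda>u. indicator {0..} u *\<^sub>R (R' * \<eta> powr (- q) * h (T + u)))"
        using set_integrable_mult_right[OF set_integral_shift(1)[OF hint], of "R' * \<eta> powr (- q)"] by (simp only: set_integrable_def)
      show "norm (indicator {0..} u *\<^sub>R J (2 * \<eta>) u) \<le> indicator {0..} u *\<^sub>R (R' * \<eta> powr (- q) * h (T + u))" for u
        using bd[of u] by (simp add: indicator_def)
    qed
    also have "\<dots> = R' * \<eta> powr (- q) * (LBINT t:{T..}. h t)"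
      by (simp only: set_integral_mult_right set_integral_shift(2)[OF hint])
    also have "\<dots> \<le> R' * \<eta> powr (- q) * (A * norm (Theta (exp (\<i> * of_real \<theta>)) a l) + B)"
      using Xabs(2)[OF th] R' unfolding h_def[abs_def] by (intro mult_left_mono) auto
    finally show ?thesis by (simp only: \<theta>_def)
  qed
  show False
  proof (rule resonance_lower_bound_contradiction[OF r _ AB(1) R' q_def, where ?c1.0 = "norm (d n0) * fact k" and D = D and B = B and Y = "\<lambda>\<eta>. norm (Theta (exp (\<i> * of_real (pi / 2 - \<eta>))) a l)"])
    show "norm (d n0) * fact k > 0" using n0 pos[of n0] by (simp add: d_def)
    show "norm (d n0) * fact k / (2 * \<eta>) ^ Suc k - D \<le> R' * \<eta> powr (- q) * (A * norm (Theta (exp (\<i> * of_real (pi / 2 - \<eta>))) a l) + B)"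
      if "0 < \<eta>" "\<eta> < 1/2" for \<eta>
      using D(1)[of "2 * \<eta>"] upper[OF that] that by linarith
    show "eventually (\<lambda>\<eta>. norm (Theta (exp (\<i> * of_real (pi / 2 - \<eta>))) a l) \<le> \<delta> * \<eta> powr (- ((r + 1) / 2))) (at_right 0)"
      if "\<delta> > 0" for \<delta>
      using landau_o.smallD[OF assms(6) that] by simp
  qed
qed

end
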